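(* Let $D$ be the quantum Dirac type operator $D=\begin{pmatrix}\delta_1&\delta_0\\ \delta_2&-\delta_1\end{pmatrix}$ in the Hilbert space $\mathcal{H}=\mathcal{H}_0\otimes\mathbb{C}^2$, and let $\{K_{m,n}(k)\}$ be any quantum $K$ function. Consider $D$ with domain $\mathrm{dom}(D)$ determined by the boundary condition at infinity associated with $\{K_{m,n}(k)\}$ (as defined in the context). Then $D:\mathrm{dom}(D)\to\mathcal{H}$ is an invertible operator, and its inverse $Q$ is a compact operator on $\mathcal{H}$.
   Context: **Data.** For $n,k\in\mathbb{Z}_{\ge0}$ let $a_n(k)>0$ be weights such that $s(n):=\sum_{k\ge0}1/a_n(k)<\infty$ for each $n$ and $s(n)\to0$ as $n\to\infty$. For $i=1,2$ let $0<c_{i,n}(k)\le1$ be such that for each $n$ the infinite products $\prod_{k}c_{1,n}(k)$ and $\prod_k c_{2,n}(k)$ exist and are nonzero, and such that there is a constant $\kappa$ with $1/\kappa\le c_{i,n}(k)\le1$ for all $i,n,k$. **Algebra.** In $\ell^2(\mathbb{Z}_{\ge0}\times\mathbb{Z})$ with canonical basis $\{e_{k,l}\}$ and $\theta\in[0,2\pi)$, put $Ue_{k,l}=e^{-2\pi il\theta}e_{k+1,l}$, $Ve_{k,l}=e_{k,l+1}$, $\mathbb{K}e_{k,l}=ke_{k,l}$. **Hilbert spaces.** $\mathcal{H}_0$ is the Hilbert space of formal series $f=\sum_{n\ge0,m\in\mathbb{Z}}V^mU^nf^+_{m,n}(\mathbb{K})+\sum_{n\ge1,m\in\mathbb{Z}}f^-_{m,n}(\mathbb{K})V^m(U^*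 )^n$, with coefficients $f_{m,n}^\pm:\mathbb{Z}_{\ge0}\to\mathbb{C}$ and finite norm $\|f\|^2=\sum_{k\ge0}\sum_{n\ge0,m}\frac{1}{a_n(k)}|f^+_{m,n}(k)|^2+\sum_{k\ge0}\sum_{n\ge1,m}\frac1{a_n(k)}|f^-_{m,n}(k)|^2$. The $n=0$ terms may be written either with the $+$ or with the $-$ terms. Let $\mathcal{H}=\mathcal{H}_0\otimes\mathbb{C}^2$. An element $F=(f,g)^t\in\mathcal{H}$ is written with $f=\sum_{n\ge1,m}V^mU^nf_{m,n}^+(\mathbb{K})+\sum_{n\ge0,m}f_{m,n}^-(\mathbb{K})V^m(U^* )^n$ and $g=\sum_{n\ge0,m}V^mU^ng_{m,n}^+(\mathbb{K})+\sum_{n\ge1,m}g_{m,n}^-(\mathbb{K})V^m(U^* )^n$. **Operators.** For $h:\mathbb{Z}_{\ge0}\to\mathbb{C}$ (with the convention $h(-1)=0$) let $B_nh(k)=a_n(k)\big(h(k)-c_{2,n}(k-1)h(k-1)\big)$ and $\overline{B}_nh(k)=a_{n+1}(k)\big(h(k)-c_{1,n}(k)h(k+1)\big)$. Define on formal series $\delta_0(f)=-\sum_{n\ge0,m}V^mU^{n+1}\overline{B}_nf^+_{m,n}(\mathbb{K})+\sum_{n\ge1,m}B_{n-1}f^-_{m,n}(\mathbb{K})V^m(U^* )^{n-1}$, $\delta_2(f)=-\sum_{n\ge1,m}V^mU^{n-1}B_{n-1}f^+_{m,n}(\mathbb{K})+\sum_{n\ge0,m}\overline{B}_nf^-_{m,n}(\mathbb{K})V^m(U^*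 )^{n+1}$, and let $\delta_1$ multiply each coefficient $f^\pm_{m,n}$ by $m$. In $DF=(\delta_1f+\delta_0g,\ \delta_2f-\delta_1g)^t$, the components $f$ and $g$ are expanded as in the decomposition of $F$ above, so for $n\ge0$ the coefficients of $DF=(p,q)^t$ are $p^+_{m,n+1}=mf^+_{m,n+1}-\overline{B}_ng^+_{m,n}$, $q^+_{m,n}=-B_nf^+_{m,n+1}-mg^+_{m,n}$, $p^-_{m,n}=mf^-_{m,n}+B_ng^-_{m,n+1}$, $q^-_{m,n+1}=\overline{B}_nf^-_{m,n}-mg^-_{m,n+1}$. **Quantum $K$ function.** For $m\in\mathbb{Z}$, $n,k\ge0$ let $C_{m,n}(k)=\begin{pmatrix}\frac1{c_{1,n}(k)}&\frac{-m}{a_{n+1}(k)c_{1,n}(k)}\\ \frac{-m}{a_n(k+1)c_{1,n}(k)}&c_{2,n}(k)+\frac{m^2}{a_n(k+1)a_{n+1}(k)c_{1,n}(k)}\end{pmatrix}$. Products of matrices are ordered from right to left: $\prod_{i=0}^{k}C_{m,n}(i)=C_{m,n}(k)\cdots C_{m,n}(0)$; the empty product is $I$. A quantum $K$ function is a collection of vectors $K_{m,n}(k)=(K^{(1)}_{m,n}(k),K^{(2)}_{m,n}(k))^t\in\mathbb{R}^2$, $m\in\mathbb{Z}$, $n,k\ge0$, with $K_{m,n}(k)=\big(\prod_{i=0}^{k-1}C_{m,n}(i)\big)K_{m,n}(0)$ and, writing $K_{m,n}(\infty)=\lim_{k\to\infty}K_{m,n}(k)$ (this limit exists): 1) if $m>0$: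 $K^{(1)}_{m,n}(\infty)>0$ and $K^{(2)}_{m,n}(\infty)>0$; 2) if $m<0$: $K^{(1)}_{m,n}(\infty)<0$ and $K^{(2)}_{m,n}(\infty)>0$; 3) if $m=0$: $K^{(1)}_{0,n}(\infty)=0$ and $K^{(2)}_{0,n}(\infty)\neq0$; 4) for $m\ne0$: $K^{(1)}_{m,n}(\infty)/K^{(2)}_{m,n}(\infty)\to0$ as $|m|\to\infty$, uniformly in $n$. **Domain.** $\mathrm{dom}(D)$ is the space of all $F\in\mathcal{H}$ with $DF\in\mathcal{H}$ (the limits of the Fourier coefficients as $k\to\infty$, denoted by the argument $\infty$, then exist) such that for all $m\in\mathbb{Z}$, $n\ge0$ there are $\beta^\pm_{m,n}\in\mathbb{C}$ with $g^+_{m,n}(\infty)=\beta^+_{m,n}K^{(1)}_{m,n}(\infty)$, $f^+_{m,n+1}(\infty)=\beta^+_{m,n}K^{(2)}_{m,n}(\infty)$, and $f^-_{m,n}(\infty)=\beta^-_{m,n}K^{(1)}_{m,n}(\infty)$, $g^-_{m,n+1}(\infty)=\beta^-_{m,n}K^{(2)}_{m,n}(\infty)$.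
   Formalization: Condition 4) is taken to require also that, for each fixed m≠0, the quotients K^(1)_{m,n}(∞)/K^(2)_{m,n}(∞) are bounded in n; if only large |m| is restricted, Q need not be compact (e.g. c=1, a_n(k)=(n+1)2^k, quotient 1/s(n) at m=1). *)

theory Defs
  imports "HOL-Analysis.Analysis" "HOL-Library.Function_Algebras"
begin

text \<open>
  A formal series
    \<open>\<Sum>\<^sub>n\<^sub>\<ge>\<^sub>0 V\<^sup>m U\<^sup>n f\<^sup>+\<^sub>m\<^sub>,\<^sub>n(\<bbbK>) + \<Sum>\<^sub>n\<^sub>\<ge>\<^sub>1 f\<^sup>-\<^sub>m\<^sub>,\<^sub>n(\<bbbK>) V\<^sup>m (U\<^sup>*)\<^sup>n\<close>
  is the family of its Fourier coefficients. They are stored as \<open>f m j k\<close> with \<open>j\<close> an integer: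
  \<open>f m j\<close> is \<open>f\<^sup>+\<^sub>m\<^sub>,\<^sub>j\<close> for \<open>j \<ge> 0\<close> and \<open>f\<^sup>-\<^sub>m\<^sub>,\<^sub>-\<^sub>j\<close> for \<open>j \<le> 0\<close>. The two cases agree at \<open>j = 0\<close>
  because \<open>V\<close> commutes with \<open>\<bbbK>\<close>, so \<open>V\<^sup>m h(\<bbbK>) = h(\<bbbK>) V\<^sup>m\<close>: this is why the terms with \<open>n = 0\<close>
  may be counted with either part.
\<close>

type_synonym series = "int \<Rightarrow> int \<Rightarrow> nat \<Rightarrow> complex"

definition coeff_plus :: "series \<Rightarrow> int \<Rightarrow> nat \<Rightarrow> nat \<Rightarrow> complex" where
  "coeff_plus f m n = f m (int n)"

definition coeff_minus :: "series \<Rightarrow> int \<Rightarrow> nat \<Rightarrow> nat \<Rightarrow> complex" where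
  "coeff_minus f m n = f m (- int n)"

definition H0 :: "(nat \<Rightarrow> nat \<Rightarrow> real) \<Rightarrow> series set" where
  "H0 a = {f. (\<lambda>(m, j, k). (cmod (f m j k))\<^sup>2 / a (nat \<bar>j\<bar>) k) summable_on UNIV}"

definition norm0 :: "(nat \<Rightarrow> nat \<Rightarrow> real) \<Rightarrow> series \<Rightarrow> real" where
  "norm0 a f = sqrt (\<Sum>\<^sub>\<infinity>(m, j, k). (cmod (f m j k))\<^sup>2 / a (nat \<bar>j\<bar>) k)"

definition H :: "(nat \<Rightarrow> nat \<Rightarrow> real) \<Rightarrow> (series \<times> series) set" where
  "H a = H0 a \<times> H0 a"

definition hnorm :: "(nat \<Rightarrow> nat \<Rightarrow> real) \<Rightarrow> series \<times> series \<Rightarrow> real" where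
  "hnorm a F = sqrt ((norm0 a (fst F))\<^sup>2 + (norm0 a (snd F))\<^sup>2)"

definition hdist :: "(nat \<Rightarrow> nat \<Rightarrow> real) \<Rightarrow> series \<times> series \<Rightarrow> series \<times> series \<Rightarrow> real" where
  "hdist a F G = hnorm a (F - G)"

definition hscale :: "complex \<Rightarrow> series \<times> series \<Rightarrow> series \<times> series" where
  "hscale z F = ((\<lambda>m j k. z * fst F m j k), (\<lambda>m j k. z * snd F m j k))"

definition linear_operator ::
    "(series \<times> series) set \<Rightarrow> (series \<times> series \<Rightarrow> series \<times> series) \<Rightarrow> bool" where
  "linear_operator S T \<longleftrightarrow>
     0 \<in> S \<and>
     (\<forall>F\<in>S. \<forall>G\<in>S. F + G \<in> S \<and> T (F + G) = T F + T G) \<and>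
     (\<forall>z. \<forall>F\<in>S. hscale z F \<in> S \<and> T (hscale z F) = hscale z (T F))"

text \<open>
  An unbounded operator with domain \<open>S\<close> is invertible if it is a bijection from \<open>S\<close> onto the
  whole Hilbert space with bounded inverse.
\<close>

definition invertible_operator ::
    "(nat \<Rightarrow> nat \<Rightarrow> real) \<Rightarrow> (series \<times> series) set \<Rightarrow> (series \<times> series \<Rightarrow> series \<times> series) \<Rightarrow> bool"
  where
  "invertible_operator a S T \<longleftrightarrow>
     S \<subseteq> H a \<and> linear_operator S T \<and> bij_betw T S (H a) \<and>
     (\<exists>C. \<forall>F\<in>S. hnorm a F \<le> C * hnorm a (T F))"

definition compact_operator ::
    "(nat \<Rightarrow> nat \<Rightarrow> real) \<Rightarrow> (series \<times> series \<Rightarrow> series \<times> series) \<Rightarrow> bool" where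
  "compact_operator a T \<longleftrightarrow>
     linear_operator (H a) T \<and> T ` H a \<subseteq> H a \<and>
     (\<forall>S. Metric_space.mbounded (H a) (hdist a) S \<longrightarrow>
        compactin (Metric_space.mtopology (H a) (hdist a))
          (Metric_space.mtopology (H a) (hdist a) closure_of (T ` S)))"

definition B_op ::
    "(nat \<Rightarrow> nat \<Rightarrow> real) \<Rightarrow> (nat \<Rightarrow> nat \<Rightarrow> real) \<Rightarrow> nat \<Rightarrow> (nat \<Rightarrow> complex) \<Rightarrow> nat \<Rightarrow> complex" where
  "B_op a c2 n h k =
     of_real (a n k) * (h k - (if k = 0 then 0 else of_real (c2 n (k - 1)) * h (k - 1)))"

definition Bbar_op ::
    "(nat \<Rightarrow> nat \<Rightarrow> real) \<Rightarrow> (nat \<Rightarrow> nat \<Rightarrow> real) \<Rightarrow> nat \<Rightarrow> (nat \<Rightarrow> complex) \<Rightarrow> nat \<Rightarrow> complex" where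
  "Bbar_op a c1 n h k = of_real (a (n + 1) k) * (h k - of_real (c1 n k) * h (k + 1))"

text \<open>
  Both \<open>\<delta>\<^sub>0\<close> and \<open>\<delta>\<^sub>2\<close> shift the integer Fourier index by one; the case distinction records whether
  the resulting term belongs to \<open>U\<^sup>j\<close> or to \<open>(U\<^sup>*)\<^sup>-\<^sup>j\<close>.
\<close>

definition delta0 ::
    "(nat \<Rightarrow> nat \<Rightarrow> real) \<Rightarrow> (nat \<Rightarrow> nat \<Rightarrow> real) \<Rightarrow> (nat \<Rightarrow> nat \<Rightarrow> real) \<Rightarrow> series \<Rightarrow> series" where
  "delta0 a c1 c2 f = (\<lambda>m j k.
     if 1 \<le> j then - Bbar_op a c1 (nat (j - 1)) (coeff_plus f m (nat (j - 1))) k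
     else B_op a c2 (nat (- j)) (coeff_minus f m (nat (- j) + 1)) k)"

definition delta1 :: "series \<Rightarrow> series" where
  "delta1 f = (\<lambda>m j k. of_int m * f m j k)"

definition delta2 ::
    "(nat \<Rightarrow> nat \<Rightarrow> real) \<Rightarrow> (nat \<Rightarrow> nat \<Rightarrow> real) \<Rightarrow> (nat \<Rightarrow> nat \<Rightarrow> real) \<Rightarrow> series \<Rightarrow> series" where
  "delta2 a c1 c2 f = (\<lambda>m j k.
     if 0 \<le> j then - B_op a c2 (nat j) (coeff_plus f m (nat j + 1)) k
     else Bbar_op a c1 (nat (- j - 1)) (coeff_minus f m (nat (- j - 1))) k)"

definition Dirac ::
    "(nat \<Rightarrow> nat \<Rightarrow> real) \<Rightarrow> (nat \<Rightarrow> nat \<Rightarrow> real) \<Rightarrow> (nat \<Rightarrow> nat \<Rightarrow> real) \<Rightarrow>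
     series \<times> series \<Rightarrow> series \<times> series" where
  "Dirac a c1 c2 F =
     (delta1 (fst F) + delta0 a c1 c2 (snd F), delta2 a c1 c2 (fst F) - delta1 (snd F))"

definition C_mat ::
    "(nat \<Rightarrow> nat \<Rightarrow> real) \<Rightarrow> (nat \<Rightarrow> nat \<Rightarrow> real) \<Rightarrow> (nat \<Rightarrow> nat \<Rightarrow> real) \<Rightarrow>
     int \<Rightarrow> nat \<Rightarrow> nat \<Rightarrow> real^2^2" where
  "C_mat a c1 c2 m n k = vector
     [vector [1 / c1 n k, - of_int m / (a (n + 1) k * c1 n k)],
      vector [- of_int m / (a n (k + 1) * c1 n k),
              c2 n k + (of_int m)\<^sup>2 / (a n (k + 1) * a (n + 1) k * c1 n k)]]"

text \<open>\<open>C_prod a c1 c2 m n k\<close> is \<open>C(k-1) \<cdots> C(0)\<close>.\<close>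

primrec C_prod ::
    "(nat \<Rightarrow> nat \<Rightarrow> real) \<Rightarrow> (nat \<Rightarrow> nat \<Rightarrow> real) \<Rightarrow> (nat \<Rightarrow> nat \<Rightarrow> real) \<Rightarrow>
     int \<Rightarrow> nat \<Rightarrow> nat \<Rightarrow> real^2^2" where
  "C_prod a c1 c2 m n 0 = mat 1"
| "C_prod a c1 c2 m n (Suc k) = C_mat a c1 c2 m n k ** C_prod a c1 c2 m n k"

definition K_infty :: "(int \<Rightarrow> nat \<Rightarrow> nat \<Rightarrow> real^2) \<Rightarrow> int \<Rightarrow> nat \<Rightarrow> real^2" where
  "K_infty K m n = lim (K m n)"

text \<open>
  In the last condition, convergence uniform in \<open>n\<close> means that the quotients are dominated, for
  every \<open>m \<noteq> 0\<close> and all \<open>n\<close>, by numbers \<open>r m\<close> tending to \<open>0\<close>; in particular, for each fixed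
  \<open>m \<noteq> 0\<close> they are bounded in \<open>n\<close>. An \<open>\<epsilon>\<close>-\<open>M\<close> condition that only restricts large \<open>\<bar>m\<bar>\<close> would leave
  the quotients with, say, \<open>m = 1\<close> unrestricted as \<open>n \<rightarrow> \<infinity>\<close>, and then the inverse of the Dirac type
  operator need not be compact.
\<close>

definition quantum_K_function ::
    "(nat \<Rightarrow> nat \<Rightarrow> real) \<Rightarrow> (nat \<Rightarrow> nat \<Rightarrow> real) \<Rightarrow> (nat \<Rightarrow> nat \<Rightarrow> real) \<Rightarrow>
     (int \<Rightarrow> nat \<Rightarrow> nat \<Rightarrow> real^2) \<Rightarrow> bool" where
  "quantum_K_function a c1 c2 K \<longleftrightarrow>
     (\<forall>m n k. K m n k = C_prod a c1 c2 m n k *v K m n 0) \<and>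
     (\<forall>m n. m > 0 \<longrightarrow> K_infty K m n $ 1 > 0 \<and> K_infty K m n $ 2 > 0) \<and>
     (\<forall>m n. m < 0 \<longrightarrow> K_infty K m n $ 1 < 0 \<and> K_infty K m n $ 2 > 0) \<and>
     (\<forall>n. K_infty K 0 n $ 1 = 0 \<and> K_infty K 0 n $ 2 \<noteq> 0) \<and>
     (\<exists>r :: int \<Rightarrow> real.
        (\<forall>m n. m \<noteq> 0 \<longrightarrow> \<bar>K_infty K m n $ 1 / K_infty K m n $ 2\<bar> \<le> r m) \<and>
        (r \<longlongrightarrow> 0) (filtercomap abs at_top))"

definition dom_Dirac ::
    "(nat \<Rightarrow> nat \<Rightarrow> real) \<Rightarrow> (nat \<Rightarrow> nat \<Rightarrow> real) \<Rightarrow> (nat \<Rightarrow> nat \<Rightarrow> real) \<Rightarrow>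
     (int \<Rightarrow> nat \<Rightarrow> nat \<Rightarrow> real^2) \<Rightarrow> (series \<times> series) set" where
  "dom_Dirac a c1 c2 K = {(f, g). (f, g) \<in> H a \<and> Dirac a c1 c2 (f, g) \<in> H a \<and>
     (\<forall>m n.
        (\<exists>\<beta> :: complex.
           lim (coeff_plus g m n) = \<beta> * of_real (K_infty K m n $ 1) \<and>
           lim (coeff_plus f m (n + 1)) = \<beta> * of_real (K_infty K m n $ 2)) \<and>
        (\<exists>\<beta> :: complex.
           lim (coeff_minus f m n) = \<beta> * of_real (K_infty K m n $ 1) \<and>
           lim (coeff_minus g m (n + 1)) = \<beta> * of_real (K_infty K m n $ 2)))}"

lemma Dirac_coeffs:
  assumes "Dirac a c1 c2 (f, g) = (p, q)"
  shows "coeff_plus p m (n + 1) k =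
           of_int m * coeff_plus f m (n + 1) k - Bbar_op a c1 n (coeff_plus g m n) k"
    and "coeff_plus q m n k =
           - B_op a c2 n (coeff_plus f m (n + 1)) k - of_int m * coeff_plus g m n k"
    and "coeff_minus p m n k =
           of_int m * coeff_minus f m n k + B_op a c2 n (coeff_minus g m (n + 1)) k"
    and "coeff_minus q m (n + 1) k =
           Bbar_op a c1 n (coeff_minus f m n) k - of_int m * coeff_minus g m (n + 1) k"
proof -
  have p: "p = delta1 f + delta0 a c1 c2 g" and q: "q = delta2 a c1 c2 f - delta1 g"
    using assms by (auto simp: Dirac_def)
  show "coeff_plus p m (n + 1) k =
           of_int m * coeff_plus f m (n + 1) k - Bbar_op a c1 n (coeff_plus g m n) k"
    by (simp add: p delta1_def delta0_def coeff_plus_def)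
  show "coeff_plus q m n k =
           - B_op a c2 n (coeff_plus f m (n + 1)) k - of_int m * coeff_plus g m n k"
    by (simp add: q delta1_def delta2_def coeff_plus_def)
  show "coeff_minus p m n k =
           of_int m * coeff_minus f m n k + B_op a c2 n (coeff_minus g m (n + 1)) k"
    by (simp add: p delta1_def delta0_def coeff_minus_def)
  show "coeff_minus q m (n + 1) k =
           Bbar_op a c1 n (coeff_minus f m n) k - of_int m * coeff_minus g m (n + 1) k"
    by (simp add: q delta1_def delta2_def coeff_minus_def)
qed

text \<open>
  The next lemmas establish that \<open>hdist\<close> is a metric on \<open>H\<close>, so that the metric notions used in
  \<open>compact_operator\<close> have their usual meaning.
\<close>

lemma norm0_triangle:
  assumes a: "\<And>n k. a n k > (0::real)" and f: "f \<in> H0 a" and g: "g \<in> H0 a"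
  shows "f + g \<in> H0 a" and "norm0 a (f + g) \<le> norm0 a f + norm0 a g"
proof -
  define u where "u = (\<lambda>(f::series) (m, j, k). cmod (f m j k) / sqrt (a (nat \<bar>j\<bar>) k))"
  have sq: "(\<lambda>(m, j, k). (cmod (f m j k))\<^sup>2 / a (nat \<bar>j\<bar>) k) = (\<lambda>x. (u f x)\<^sup>2)" for f
    using a by (auto simp: u_def fun_eq_iff power_divide less_imp_le)
  have H0: "f \<in> H0 a \<longleftrightarrow> (\<lambda>x. (u f x)\<^sup>2) summable_on UNIV" for f
    by (simp add: H0_def sq)
  have n0: "norm0 a f = sqrt (\<Sum>\<^sub>\<infinity>x. (u f x)\<^sup>2)" for f
    by (simp add: norm0_def sq)
  have pos: "0 \<le> u f x" for f x
    by (cases x) (use a in \<open>auto simp: u_def less_imp_le\<close>)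
  have tri: "u (f + g) x \<le> u f x + u g x" for x
    by (cases x) (use a in \<open>auto simp: u_def add_divide_distrib[symmetric] less_imp_le
        intro!: divide_right_mono norm_triangle_ineq\<close>)
  have L2: "L2_set (u f) A \<le> norm0 a f" if "finite A" "f \<in> H0 a" for f A
    unfolding L2_set_def n0 using that by (auto intro!: finite_sum_le_infsum simp: H0)
  have bound: "(\<Sum>x\<in>A. (u (f + g) x)\<^sup>2) \<le> (norm0 a f + norm0 a g)\<^sup>2" if "finite A" for A
  proof -
    have "L2_set (u (f + g)) A \<le> L2_set (\<lambda>x. u f x + u g x) A"
      by (rule L2_set_mono) (auto simp: tri pos)
    also have "\<dots> \<le> L2_set (u f) A + L2_set (u g) A"
      by (rule L2_set_triangle_ineq)
    also have "\<dots> \<le> norm0 a f + norm0 a g"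
      using L2[OF that f] L2[OF that g] by simp
    finally have "(L2_set (u (f + g)) A)\<^sup>2 \<le> (norm0 a f + norm0 a g)\<^sup>2"
      by (simp add: power_mono)
    then show ?thesis
      by (simp add: L2_set_def sum_nonneg)
  qed
  show fg: "f + g \<in> H0 a"
    unfolding H0 by (rule nonneg_bdd_above_summable_on) (auto intro!: bdd_aboveI2 bound)
  have "(\<Sum>\<^sub>\<infinity>x. (u (f + g) x)\<^sup>2) \<le> (norm0 a f + norm0 a g)\<^sup>2"
    using fg bound by (intro infsum_le_finite_sums) (auto simp: H0)
  then have "norm0 a (f + g) \<le> sqrt ((norm0 a f + norm0 a g)\<^sup>2)"
    unfolding n0[of "f + g"] by (rule real_sqrt_le_mono)
  then show "norm0 a (f + g) \<le> norm0 a f + norm0 a g"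
    by (simp add: n0 infsum_nonneg)
qed

lemma norm0_minus: "norm0 a (f - g) = norm0 a (g - f)" for f g :: series
  by (simp add: norm0_def norm_minus_commute)

lemma H0_diff:
  assumes "\<And>n k. a n k > (0::real)" "f \<in> H0 a" "g \<in> H0 a"
  shows "f - g \<in> H0 a"
proof -
  have "- g \<in> H0 a"
    using assms(3) by (simp add: H0_def)
  from norm0_triangle(1)[OF assms(1,2) this] show ?thesis
    by simp
qed

lemma norm0_eq_0:
  assumes a: "\<And>n k. a n k > (0::real)" and f: "f \<in> H0 a"
  shows "norm0 a f = 0 \<longleftrightarrow> f = 0"
proof
  assume "norm0 a f = 0"
  then have s: "(\<Sum>\<^sub>\<infinity>(m, j, k). (cmod (f m j k))\<^sup>2 / a (nat \<bar>j\<bar>) k) = 0"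
    by (simp add: norm0_def)
  have "(case (m, j, k) of (m, j, k) \<Rightarrow> (cmod (f m j k))\<^sup>2 / a (nat \<bar>j\<bar>) k) = 0" for m j k
    by (rule nonneg_infsum_le_0D[OF _ _ _ UNIV_I])
      (use s f a in \<open>auto simp: H0_def less_imp_le\<close>)
  then have "(cmod (f m j k))\<^sup>2 / a (nat \<bar>j\<bar>) k = 0" for m j k
    by simp
  then have "f m j k = 0" for m j k
    using a by (metis divide_eq_0_iff less_irrefl norm_eq_zero power2_eq_iff_nonneg zero_power2
        norm_ge_zero order_refl)
  then show "f = 0"
    by (simp add: fun_eq_iff)
qed (simp add: norm0_def case_prod_unfold)

lemma Metric_space_H:
  assumes a: "\<And>n k. a n k > (0::real)"
  shows "Metric_space (H a) (hdist a)"
proof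
  fix F G :: "series \<times> series"
  show "0 \<le> hdist a F G"
    by (simp add: hdist_def hnorm_def)
  show "hdist a F G = hdist a G F"
    by (simp add: hdist_def hnorm_def norm0_minus[of a "fst F"] norm0_minus[of a "snd F"])
  assume F: "F \<in> H a" and G: "G \<in> H a"
  have "hdist a F G = 0 \<longleftrightarrow> norm0 a (fst F - fst G) = 0 \<and> norm0 a (snd F - snd G) = 0"
    by (simp add: hdist_def hnorm_def add_nonneg_eq_0_iff)
  also have "\<dots> \<longleftrightarrow> fst F - fst G = 0 \<and> snd F - snd G = 0"
  proof -
    have "fst F - fst G \<in> H0 a" "snd F - snd G \<in> H0 a"
      using F G by (auto simp: H_def intro!: H0_diff[OF a])
    then show ?thesis
      by (simp only: norm0_eq_0[OF a])
  qed
  finally show "hdist a F G = 0 \<longleftrightarrow> F = G"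
    by (simp add: prod_eq_iff)
next
  fix F G E :: "series \<times> series"
  assume F: "F \<in> H a" and G: "G \<in> H a" and E: "E \<in> H a"
  have nn: "0 \<le> norm0 a f" for f
    unfolding norm0_def using a by (auto intro!: infsum_nonneg simp: less_imp_le)
  have 1: "norm0 a (fst F - fst E) \<le> norm0 a (fst F - fst G) + norm0 a (fst G - fst E)"
    using norm0_triangle(2)[OF a, where f = "fst F - fst G" and g = "fst G - fst E"] F G E
    by (auto simp: H_def H0_diff[OF a])
  have 2: "norm0 a (snd F - snd E) \<le> norm0 a (snd F - snd G) + norm0 a (snd G - snd E)"
    using norm0_triangle(2)[OF a, where f = "snd F - snd G" and g = "snd G - snd E"] F G E
    by (auto simp: H_def H0_diff[OF a])
  have "hdist a F E \<le> sqrt ((norm0 a (fst F - fst G) + norm0 a (fst G - fst E))\<^sup>2 +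
      (norm0 a (snd F - snd G) + norm0 a (snd G - snd E))\<^sup>2)"
    unfolding hdist_def hnorm_def using 1 2 nn
    by (auto intro!: add_mono power_mono)
  also have "\<dots> \<le> hdist a F G + hdist a G E"
    unfolding hdist_def hnorm_def fst_diff snd_diff by (rule real_sqrt_sum_squares_triangle_ineq)
  finally show "hdist a F E \<le> hdist a F G + hdist a G E" .
qed

end

theory Submission
  imports Defs "HOL-Library.Diagonal_Subsequence"
begin

text \<open>
  Writing the Dirac equation in Fourier coefficients splits it into independent problems, one for
  each frequency \<open>m\<close> and each pair of neighbouring radial indices: two first order recurrences for
  sequences \<open>x\<close> and \<open>y\<close>, where \<open>x\<close> is propagated forward from \<open>k = 0\<close>, \<open>y\<close> is propagated backward
  from infinity, and the boundary condition prescribes the quotient \<open>y(\<infinity>) / x(\<infinity>)\<close>. The inverse of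
  the Dirac operator is then a direct sum of solution operators. It is bounded if these are bounded
  uniformly; it is compact if each of them is compact and their norms tend to \<open>0\<close>.

  Each radial problem is hyperbolic and is solved by factorization. One homogeneous solution is
  regular at \<open>0\<close>, another one, coming from the quantum K function, satisfies the condition at
  infinity; let \<open>- lam = x / y\<close> and \<open>kap = y / x\<close> be their quotients. The sign conditions on the K
  function are what makes \<open>kap\<close> nonnegative (after replacing \<open>y\<close> by \<open>- y\<close> for \<open>m < 0\<close>). The
  combinations \<open>x + lam * y\<close> and \<open>y - kap * x\<close> decouple and obey contracting recurrences in the forward
  and in the backward direction, respectively (\<open>forward_component\<close>, \<open>backward_component\<close>), and
  \<open>x\<close>, \<open>y\<close> can be recovered from them because \<open>1 + kap * lam \<ge> 1\<close>. The Riccati equations for \<open>lam\<close>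
  and \<open>kap\<close> give, by telescoping, weighted square sum bounds that do not depend on \<open>m\<close> nor on the
  infinite products (\<open>sum_lam'\<close>, \<open>sum_kap'\<close>). The outcome is \<open>solution_bound\<close>: for sources of energy
  at most \<open>1\<close> all solutions lie below a fixed summable profile, whose sum is at most
  \<open>16 * s(n) * (s(n+1) + R)\<close> with \<open>R\<close> a bound for the quotients \<open>K\<^sup>1(\<infinity>) / K\<^sup>2(\<infinity>)\<close>. Hence the
  solution operators exist, are unique, are compact, and are small for large \<open>n\<close>, uniformly in \<open>m\<close>.

  This bound does not decay in \<open>m\<close>. For fixed \<open>n\<close> an energy identity gives a norm of order \<open>1 / \<bar>m\<bar>\<close>
  (\<open>high_frequency_bound\<close>), with a constant that depends on \<open>n\<close>; its boundary term has the right sign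
  because the quotient \<open>y(\<infinity>) / x(\<infinity>)\<close> has the sign of \<open>m\<close>. Together the two bounds show that only
  finitely many solution operators exceed a given norm (\<open>small_components\<close>). Compactness follows
  from the criterion that a bounded family with uniformly small tails is relatively compact
  (\<open>relatively_compact_of_uniform_tails\<close>, \<open>uniform_tails\<close>).
\<close>

section \<open>Summable perturbations of first order recurrences\<close>

lemma prod_lessThan_tendsto_prodinf:
  fixes c :: "nat \<Rightarrow> real"
  assumes "convergent_prod c"
  shows "(\<lambda>n. \<Prod>i<n. c i) \<longlonglongrightarrow> prodinf c"
proof -
  have "(\<lambda>n. \<Prod>i<Suc n. c i) \<longlonglongrightarrow> prodinf c"
    using convergent_prod_LIMSEQ[OF assms] by (simp add: lessThan_Suc_atMost)
  then show ?thesis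
    by (rule LIMSEQ_imp_Suc)
qed

lemma prod_lessThan_bounds:
  fixes c :: "nat \<Rightarrow> real"
  assumes c: "\<And>k. 0 < c k \<and> c k \<le> 1" and conv: "convergent_prod c"
  shows "0 < prodinf c" "prodinf c \<le> (\<Prod>i<n. c i)" "(\<Prod>i<n. c i) \<le> 1"
proof -
  have dec: "decseq (\<lambda>n. \<Prod>i<n. c i)"
    using c by (intro decseq_SucI) (simp add: mult_left_le prod_nonneg less_imp_le)
  show le: "prodinf c \<le> (\<Prod>i<n. c i)" for n
    by (rule decseq_ge[OF dec prod_lessThan_tendsto_prodinf[OF conv]])
  show "(\<Prod>i<n. c i) \<le> 1"
    using c by (intro prod_le_1) (auto simp: less_imp_le)
  have "0 \<le> prodinf c"
    by (rule LIMSEQ_le_const[OF prod_lessThan_tendsto_prodinf[OF conv]])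
      (auto intro!: prod_nonneg simp: c less_imp_le)
  moreover have "prodinf c \<noteq> 0"
    using prodinf_nonzero[OF conv] c by (metis less_irrefl)
  ultimately show "0 < prodinf c"
    by simp
qed

text \<open>
  Normalizing by the partial products of \<open>c\<close> turns either recurrence into a telescoping sum with
  absolutely summable increments; undoing it is harmless because the products stay away from \<open>0\<close>.
\<close>

lemma convergent_forward_recurrence:
  fixes x e :: "nat \<Rightarrow> 'a::{real_normed_field,banach}" and c :: "nat \<Rightarrow> real"
  assumes c: "\<And>k. 0 < c k \<and> c k \<le> 1" and conv: "convergent_prod c"
    and e: "summable (\<lambda>k. norm (e k))"
    and rec: "\<And>k. x (Suc k) = of_real (c k) * x k + e k"
  shows "convergent x"
proof -
  define \<gamma> where "\<gamma> n = (\<Prod>i<n. c i)" for n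
  note b = prod_lessThan_bounds[OF c conv, folded \<gamma>_def]
  have pos: "0 < \<gamma> n" for n
    using b(1) b(2)[of n] by linarith
  have step: "x (Suc k) / of_real (\<gamma> (Suc k)) = x k / of_real (\<gamma> k) + e k / of_real (\<gamma> (Suc k))" for k
  proof -
    have "c k \<noteq> 0" using c[of k] by simp
    then show ?thesis
      using pos[of k] by (simp add: rec \<gamma>_def add_divide_distrib)
  qed
  have "norm (e k / of_real (\<gamma> (Suc k))) \<le> norm (e k) / prodinf c" for k
    using b(1) b(2)[of "Suc k"] pos[of "Suc k"]
    by (auto simp: norm_divide intro!: divide_left_mono)
  then have sm: "summable (\<lambda>k. e k / of_real (\<gamma> (Suc k)))"
    by (intro summable_comparison_test[OF _ summable_divide[OF e]]) blast
  have "x n / of_real (\<gamma> n) = x 0 + (\<Sum>k<n. e k / of_real (\<gamma> (Suc k)))" for n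
  proof (induction n)
    case (Suc n)
    then show ?case by (simp only: step) simp
  qed (simp add: \<gamma>_def)
  moreover have "convergent (\<lambda>n. x 0 + (\<Sum>k<n. e k / of_real (\<gamma> (Suc k))))"
    using sm by (intro convergent_add convergent_const) (simp add: summable_iff_convergent)
  ultimately have "convergent (\<lambda>n. x n / of_real (\<gamma> n))"
    by simp
  moreover have "convergent (\<lambda>n. of_real (\<gamma> n) :: 'a)"
    using tendsto_of_real[OF prod_lessThan_tendsto_prodinf[OF conv]]
    unfolding convergent_def \<gamma>_def by blast
  ultimately have "convergent (\<lambda>n. x n / of_real (\<gamma> n) * of_real (\<gamma> n))"
    by (rule convergent_mult)
  then show ?thesis
    using pos by (simp add: less_imp_neq[symmetric])
qed

lemma convergent_backward_recurrence:
  fixes y e :: "nat \<Rightarrow> 'a::{real_normed_field,banach}" and c :: "nat \<Rightarrow> real"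
  assumes c: "\<And>k. 0 < c k \<and> c k \<le> 1" and conv: "convergent_prod c"
    and e: "summable (\<lambda>k. norm (e k))"
    and rec: "\<And>k. y k = of_real (c k) * y (Suc k) + e k"
  shows "convergent y"
proof -
  define \<gamma> where "\<gamma> n = (\<Prod>i<n. c i)" for n
  note b = prod_lessThan_bounds[OF c conv, folded \<gamma>_def]
  have pos: "0 < \<gamma> n" for n
    using b(1) b(2)[of n] by linarith
  have step: "of_real (\<gamma> (Suc k)) * y (Suc k) = of_real (\<gamma> k) * y k - of_real (\<gamma> k) * e k" for k
    by (subst (2) rec) (simp add: \<gamma>_def algebra_simps)
  have "norm (of_real (\<gamma> k) * e k) \<le> norm (e k)" for k
    using b(3)[of k] pos[of k] by (simp add: norm_mult mult_left_le_one_le)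
  then have sm: "summable (\<lambda>k. of_real (\<gamma> k) * e k)"
    by (intro summable_comparison_test[OF _ e]) blast
  have "of_real (\<gamma> n) * y n = y 0 - (\<Sum>k<n. of_real (\<gamma> k) * e k)" for n
  proof (induction n)
    case (Suc n)
    then show ?case by (simp only: step) simp
  qed (simp add: \<gamma>_def)
  moreover have "convergent (\<lambda>n. y 0 - (\<Sum>k<n. of_real (\<gamma> k) * e k))"
    using sm by (intro convergent_diff convergent_const) (simp add: summable_iff_convergent)
  ultimately have "convergent (\<lambda>n. of_real (\<gamma> n) * y n)"
    by simp
  moreover have "(\<lambda>n. inverse (of_real (\<gamma> n)) :: 'a) \<longlonglongrightarrow> inverse (of_real (prodinf c))"
    using tendsto_of_real[OF prod_lessThan_tendsto_prodinf[OF conv]] b(1)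
    by (intro tendsto_inverse) (auto simp: \<gamma>_def simp del: of_real_prod)
  then have "convergent (\<lambda>n. inverse (of_real (\<gamma> n)) :: 'a)"
    by (auto simp: convergent_def)
  ultimately have "convergent (\<lambda>n. inverse (of_real (\<gamma> n)) * (of_real (\<gamma> n) * y n))"
    by (intro convergent_mult[of "\<lambda>n. inverse (of_real (\<gamma> n))"])
  moreover have "inverse (of_real (\<gamma> n)) * (of_real (\<gamma> n) * y n) = y n" for n
    using pos[of n] by simp
  ultimately show ?thesis
    by simp
qed

section \<open>The radial boundary value problem\<close>

lemma weighted_Cauchy_Schwarz:
  fixes f g f' g' v w :: "'i \<Rightarrow> real"
  assumes v: "\<And>i. 0 \<le> v i" and w: "\<And>i. 0 \<le> w i"
  shows "(\<Sum>i\<in>A. v i * f i * g i + w i * f' i * g' i)\<^sup>2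
    \<le> (\<Sum>i\<in>A. v i * (f i)\<^sup>2 + w i * (f' i)\<^sup>2) * (\<Sum>i\<in>A. v i * (g i)\<^sup>2 + w i * (g' i)\<^sup>2)"
proof -
  define F where "F z = (if snd z then sqrt (v (fst z)) * f (fst z) else sqrt (w (fst z)) * f' (fst z))" for z
  define G where "G z = (if snd z then sqrt (v (fst z)) * g (fst z) else sqrt (w (fst z)) * g' (fst z))" for z
  have S: "(\<Sum>z\<in>A \<times> UNIV. h z) = (\<Sum>i\<in>A. h (i, True) + h (i, False))"
    for h :: "'i \<times> bool \<Rightarrow> real"
    using sum.cartesian_product[of "\<lambda>i b. h (i, b)" UNIV A] by (simp add: UNIV_bool add.commute)
  have r: "sqrt t * a * (sqrt t * b) = t * a * b" if "0 \<le> t" for t a b :: real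
  proof -
    have "sqrt t * a * (sqrt t * b) = (sqrt t * sqrt t) * a * b" by (simp only: mult_ac)
    then show ?thesis using that by simp
  qed
  have "(\<Sum>z\<in>A \<times> UNIV. F z * G z)\<^sup>2 \<le> (\<Sum>z\<in>A \<times> UNIV. (F z)\<^sup>2) * (\<Sum>z\<in>A \<times> UNIV. (G z)\<^sup>2)"
    by (rule Cauchy_Schwarz_ineq_sum)
  then show ?thesis
    using v w unfolding S by (simp add: F_def G_def r power_mult_distrib)
qed

lemma quotient_defect:
  fixes w l :: real
  assumes "0 \<le> l" "0 \<le> w"
  shows "w * (l / (1 + w * l))\<^sup>2 \<le> l - l / (1 + w * l)"
proof -
  have d: "1 \<le> 1 + w * l" using assms by simp
  define t where "t = l / (1 + w * l)"
  have l: "l = t * (1 + w * l)"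
    using d by (simp add: t_def)
  have "0 \<le> t"
    using d assms by (simp add: t_def)
  moreover have "t * 1 \<le> t * (1 + w * l)"
    using d calculation by (rule mult_left_mono)
  ultimately have t: "0 \<le> t" "t \<le> l"
    using l by auto
  have "w * t\<^sup>2 \<le> w * (t * l)"
    using assms t by (auto simp: power2_eq_square intro!: mult_left_mono)
  also have "\<dots> = l - t"
    by (subst (2) l) (simp add: algebra_simps)
  finally show ?thesis
    by (simp add: t_def)
qed

lemma square_triangle_bound:
  fixes a b r t A B :: real
  assumes "0 \<le> r" "r \<le> a + t * b" "a\<^sup>2 \<le> A" "b\<^sup>2 \<le> B"
  shows "r\<^sup>2 \<le> 2 * (A + t\<^sup>2 * B)"
proof -
  have "r\<^sup>2 \<le> (a + t * b)\<^sup>2"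
    using assms by (intro power_mono) auto
  also have "\<dots> \<le> 2 * (a\<^sup>2 + (t * b)\<^sup>2)"
    using sum_squares_bound[of a "t * b"] unfolding power2_sum distrib_left by linarith
  also have "\<dots> = 2 * (a\<^sup>2 + t\<^sup>2 * b\<^sup>2)"
    by (simp add: power_mult_distrib)
  also have "\<dots> \<le> 2 * (A + t\<^sup>2 * B)"
    using assms by (intro mult_left_mono add_mono) auto
  finally show ?thesis .
qed

text \<open>
  One Fourier component of the Dirac equation, with \<open>x\<close> square summable for the weight \<open>w1\<close>, \<open>y\<close>
  for the weight \<open>w0\<close>, and \<open>mu = \<bar>m\<bar>\<close>. The sequence \<open>kap\<close> is the quotient \<open>y / x\<close> of a homogeneous
  solution that satisfies the condition at infinity \<open>y(\<infinity>) = \<rho> x(\<infinity>)\<close>; passing to the quotient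
  turns the linear recurrence into the discrete Riccati equation \<open>kap_rec\<close>. The bound
  \<open>\<rho> \<le> mu * R\<close> covers \<open>mu = 0\<close>, where it forces \<open>\<rho> = 0\<close>, as well as \<open>mu \<ge> 1\<close>, where it follows
  from \<open>\<rho> \<le> R\<close>; in this form it scales with \<open>mu\<close> like all the estimates below.
\<close>

locale radial_problem =
  fixes w0 w1 c1 c2 kap :: "nat \<Rightarrow> real" and mu \<rho> R :: real
  assumes w0_pos: "0 < w0 k" and w1_pos: "0 < w1 k"
    and w0_summable: "summable w0" and w1_summable: "summable w1"
    and c1: "0 < c1 k \<and> c1 k \<le> 1" and c2: "0 < c2 k \<and> c2 k \<le> 1"
    and c1_prod: "convergent_prod c1" and c2_prod: "convergent_prod c2"
    and mu: "0 \<le> mu"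
    and kap_nonneg: "0 \<le> kap k"
    and kap_rec: "kap k = c1 k * c2 k * kap (Suc k) / (1 + mu * w0 (Suc k) * kap (Suc k)) + mu * w1 k"
    and kap_lim: "kap \<longlonglongrightarrow> \<rho>" and \<rho>: "\<rho> \<le> mu * R" and R: "0 \<le> R"
begin

definition solves :: "(nat \<Rightarrow> complex) \<Rightarrow> (nat \<Rightarrow> complex) \<Rightarrow> (nat \<Rightarrow> complex) \<Rightarrow> (nat \<Rightarrow> complex) \<Rightarrow> bool"
  where "solves x y p q \<longleftrightarrow>
    (\<forall>k. y k = of_real (c1 k) * y (Suc k) + of_real (w1 k) * (of_real mu * x k - p k)) \<and>
    x 0 = - of_real (w0 0) * (of_real mu * y 0 + q 0) \<and>
    (\<forall>k. x (Suc k) = of_real (c2 k) * x k - of_real (w0 (Suc k)) * (of_real mu * y (Suc k) + q (Suc k)))"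

text \<open>
  Minus the quotient \<open>x / y\<close> of the homogeneous solution that is regular at \<open>0\<close>: the forward
  counterpart of \<open>kap\<close>. The primed sequences are the damped quotients that enter the next step of
  the two Riccati equations.
\<close>

primrec lam :: "nat \<Rightarrow> real" where
  "lam 0 = mu * w0 0"
| "lam (Suc k) = mu * w0 (Suc k) + c1 k * c2 k * lam k / (1 + mu * w1 k * lam k)"

definition lam' :: "nat \<Rightarrow> real" where "lam' k = lam k / (1 + mu * w1 k * lam k)"
definition kap' :: "nat \<Rightarrow> real" where "kap' k = kap k / (1 + mu * w0 k * kap k)"

definition S1 :: real where "S1 = suminf w1 + R"

lemma lam_nonneg: "0 \<le> lam k"
  by (induction k) (use w0_pos w1_pos c1 c2 mu in \<open>auto simp: less_imp_le intro!: add_nonneg_nonneg divide_nonneg_nonneg mult_nonneg_nonneg\<close>)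

lemma denominators: "1 \<le> 1 + mu * w1 k * lam k" "1 \<le> 1 + mu * w0 k * kap k"
  using lam_nonneg[of k] kap_nonneg[of k] mu w0_pos[of k] w1_pos[of k] by auto

lemma lam'_nonneg: "0 \<le> lam' k" and kap'_nonneg: "0 \<le> kap' k"
  using lam_nonneg[of k] kap_nonneg[of k] denominators[of k] by (auto simp: lam'_def kap'_def)

lemma lam_Suc: "lam (Suc k) = mu * w0 (Suc k) + c1 k * c2 k * lam' k"
  and kap_Suc: "kap k = c1 k * c2 k * kap' (Suc k) + mu * w1 k"
  using kap_rec[of k] by (simp_all add: lam'_def kap'_def)

lemma sum_w0: "(\<Sum>k<n. w0 k) \<le> suminf w0" and sum_w1: "(\<Sum>k<n. w1 k) \<le> suminf w1"
  by (simp_all add: sum_le_suminf less_imp_le w0_pos w1_pos w0_summable w1_summable)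

lemma kap_zero: "kap k = 0" if "mu = 0"
proof -
  have "incseq kap"
  proof (rule incseq_SucI)
    fix k
    have "c1 k * c2 k \<le> 1"
      using c1[of k] c2[of k] by (simp add: mult_le_one)
    then show "kap k \<le> kap (Suc k)"
      using kap_rec[of k] that kap_nonneg[of "Suc k"] by (simp add: mult_left_le_one_le c1 c2 less_imp_le)
  qed
  from incseq_le[OF this kap_lim, of k] \<rho> that kap_nonneg[of k] show ?thesis
    by simp
qed

text \<open>
  The decisive bounds. A Riccati step loses at least \<open>mu * w1 * lam'\<^sup>2\<close> while it gains at most
  \<open>mu * w0\<close>, so the losses telescope against the gains and a common factor \<open>mu\<close> cancels: the weighted
  square sums are bounded independently of \<open>mu\<close> and of the products of \<open>c1\<close> and \<open>c2\<close>. For \<open>kap\<close> the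
  weights are exchanged and the starting value \<open>\<rho>\<close> at infinity is added.
\<close>

lemma sum_lam': "(\<Sum>k<n. w1 k * (lam' k)\<^sup>2) \<le> suminf w0"
proof (cases "mu = 0")
  case True
  have "lam k = 0" for k
  proof (induction k)
    case (Suc k)
    show ?case unfolding lam.simps Suc unfolding True by simp
  next
    case 0
    show ?case unfolding lam.simps unfolding True by simp
  qed
  then show ?thesis
    unfolding lam'_def by (simp add: suminf_nonneg w0_summable w0_pos less_imp_le)
next
  case False
  have cc: "c1 k * c2 k * lam' k \<le> lam' k" for k
    using c1[of k] c2[of k] lam'_nonneg[of k] by (simp add: mult_left_le_one_le mult_le_one less_imp_le)
  have "mu * (w1 k * (lam' k)\<^sup>2) \<le> lam k - lam' k" for k
    using quotient_defect[of "lam k" "mu * w1 k"] lam_nonneg[of k] mu w1_pos[of k]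
    by (simp add: lam'_def mult.assoc less_imp_le)
  then have step: "mu * (w1 k * (lam' k)\<^sup>2) \<le> lam k - lam (Suc k) + mu * w0 (Suc k)" for k
    using cc[of k] lam_Suc[of k] by (smt (verit))
  have "mu * (\<Sum>k<n. w1 k * (lam' k)\<^sup>2) + lam n \<le> mu * (\<Sum>k<Suc n. w0 k)"
  proof (induction n)
    case (Suc n)
    then show ?case using step[of n] by (simp add: algebra_simps)
  qed simp
  also have "\<dots> \<le> mu * suminf w0"
    using sum_w0[of "Suc n"] mu by (rule mult_left_mono)
  finally have "mu * (\<Sum>k<n. w1 k * (lam' k)\<^sup>2) \<le> mu * suminf w0"
    using lam_nonneg[of n] by simp
  then show ?thesis
    using False mu by simp
qed

lemma sum_kap': "(\<Sum>k<n. w0 k * (kap' k)\<^sup>2) \<le> S1"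
proof (cases "mu = 0")
  case True
  then show ?thesis
    using suminf_nonneg[OF w1_summable less_imp_le[OF w1_pos]] R
    unfolding kap'_def kap_zero[OF True] S1_def by simp
next
  case False
  have cc: "c1 k * c2 k * kap' (Suc k) \<le> kap' (Suc k)" for k
    using c1[of k] c2[of k] kap'_nonneg[of "Suc k"] by (simp add: mult_left_le_one_le mult_le_one less_imp_le)
  have defect: "mu * (w0 k * (kap' k)\<^sup>2) \<le> kap k - kap' k" for k
    using quotient_defect[of "kap k" "mu * w0 k"] kap_nonneg[of k] mu w0_pos[of k]
    by (simp add: kap'_def mult.assoc less_imp_le)
  then have step: "mu * (w0 (Suc k) * (kap' (Suc k))\<^sup>2) \<le> kap (Suc k) - kap k + mu * w1 k" for k
    using cc[of k] defect[of "Suc k"] kap_Suc[of k] by linarith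
  have part: "mu * (\<Sum>k<Suc N. w0 k * (kap' k)\<^sup>2) \<le> kap N + mu * suminf w1" for N
  proof -
    have "mu * (\<Sum>k<Suc N. w0 k * (kap' k)\<^sup>2) \<le> kap N + mu * (\<Sum>k<N. w1 k)"
    proof (induction N)
      case 0
      then show ?case using defect[of 0] kap'_nonneg[of 0] by simp
    next
      case (Suc N)
      then show ?case using step[of N] by (simp add: algebra_simps)
    qed
    also have "\<dots> \<le> kap N + mu * suminf w1"
      using sum_w1 mu by (intro add_left_mono mult_left_mono) auto
    finally show ?thesis .
  qed
  have "mu * (\<Sum>k<n. w0 k * (kap' k)\<^sup>2) \<le> kap N + mu * suminf w1" if "n \<le> N" for N
  proof -
    have "(\<Sum>k<n. w0 k * (kap' k)\<^sup>2) \<le> (\<Sum>k<Suc N. w0 k * (kap' k)\<^sup>2)"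
      using that w0_pos by (intro sum_mono2) (auto simp: less_imp_le)
    then have "mu * (\<Sum>k<n. w0 k * (kap' k)\<^sup>2) \<le> mu * (\<Sum>k<Suc N. w0 k * (kap' k)\<^sup>2)"
      using mu by (rule mult_left_mono)
    with part[of N] show ?thesis
      by simp
  qed
  then have "mu * (\<Sum>k<n. w0 k * (kap' k)\<^sup>2) \<le> \<rho> + mu * suminf w1"
    by (intro LIMSEQ_le_const[OF tendsto_add[OF kap_lim tendsto_const]]) blast
  also have "\<dots> \<le> mu * S1"
    using \<rho> by (simp add: S1_def algebra_simps)
  finally show ?thesis
    using False mu by simp
qed

lemma S1_ge: "suminf w1 \<le> S1" and S1_nonneg: "0 \<le> S1" and s0_nonneg: "0 \<le> suminf w0"
  using suminf_nonneg[OF w1_summable less_imp_le[OF w1_pos]]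
    suminf_nonneg[OF w0_summable less_imp_le[OF w0_pos]] R by (simp_all add: S1_def)

text \<open>
  The combinations \<open>x + lam * y\<close> and \<open>y - kap * x\<close> vanish on the two distinguished homogeneous
  solutions. They therefore decouple, the first one obeying a contracting recurrence in the forward
  and the second one in the backward direction; the sources enter with the damped quotients.
\<close>

lemma forward_component:
  assumes "solves x y p q"
  defines "u \<equiv> \<lambda>k. x k + of_real (lam k) * y k"
  shows "u 0 = - of_real (w0 0) * q 0"
    and "u (Suc k) = of_real (c2 k / (1 + mu * w1 k * lam k)) * u k
           + of_real (c2 k * w1 k * lam' k) * p k - of_real (w0 (Suc k)) * q (Suc k)"
proof -
  show "u 0 = - of_real (w0 0) * q 0"
  proof -
    have "x 0 = - of_real (w0 0) * (of_real mu * y 0 + q 0)"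
      using assms(1) unfolding solves_def by blast
    then show ?thesis by (simp add: u_def algebra_simps)
  qed
  define e :: complex where "e = 1 + of_real mu * of_real (w1 k) * of_real (lam k)"
  have "e = of_real (1 + mu * w1 k * lam k)" by (simp add: e_def)
  moreover have "1 + mu * w1 k * lam k \<noteq> 0" using denominators(1)[of k] by linarith
  ultimately have e: "e \<noteq> 0" by (simp only: of_real_eq_0_iff not_False_eq_True)
  have Y: "of_real (c1 k) * y (Suc k) = y k - of_real (w1 k) * (of_real mu * x k - p k)"
  proof -
    have "y k = of_real (c1 k) * y (Suc k) + of_real (w1 k) * (of_real mu * x k - p k)"
      using assms(1) unfolding solves_def by blast
    then show ?thesis by (simp only: add_diff_cancel_right')
  qed
  have X: "x (Suc k) = of_real (c2 k) * x k - of_real (w0 (Suc k)) * (of_real mu * y (Suc k) + q (Suc k))"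
    using assms(1) unfolding solves_def by blast
  have "u (Suc k) = of_real (c2 k) * (x k + of_real (lam k) / e * (of_real (c1 k) * y (Suc k)))
      - of_real (w0 (Suc k)) * q (Suc k)"
    unfolding u_def X lam.simps e_def by (simp add: algebra_simps)
  also have "\<dots> = of_real (c2 k) / e * (u k + of_real (w1 k * lam k) * p k) - of_real (w0 (Suc k)) * q (Suc k)"
  proof -
    have "e * x k + of_real (lam k) * (y k - of_real (w1 k) * (of_real mu * x k - p k))
       = u k + of_real (w1 k * lam k) * p k"
      by (simp add: e_def u_def algebra_simps)
    then have "x k + of_real (lam k) / e * (of_real (c1 k) * y (Suc k)) = (u k + of_real (w1 k * lam k) * p k) / e"
      unfolding Y using e by (simp add: field_simps)
    then show ?thesis by simp
  qed
  finally show "u (Suc k) = of_real (c2 k / (1 + mu * w1 k * lam k)) * u k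
           + of_real (c2 k * w1 k * lam' k) * p k - of_real (w0 (Suc k)) * q (Suc k)"
    by (simp add: lam'_def e_def algebra_simps add_divide_distrib)
qed

lemma backward_component:
  assumes "solves x y p q"
  defines "z \<equiv> \<lambda>k. y k - of_real (kap k) * x k"
  shows "z k = of_real (c1 k / (1 + mu * w0 (Suc k) * kap (Suc k))) * z (Suc k)
           - of_real (w1 k) * p k - of_real (c1 k * w0 (Suc k) * kap' (Suc k)) * q (Suc k)"
proof -
  define d :: complex where "d = 1 + of_real mu * of_real (w0 (Suc k)) * of_real (kap (Suc k))"
  have "d = of_real (1 + mu * w0 (Suc k) * kap (Suc k))" by (simp add: d_def)
  moreover have "1 + mu * w0 (Suc k) * kap (Suc k) \<noteq> 0" using denominators(2)[of "Suc k"] by linarith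
  ultimately have d: "d \<noteq> 0" by (simp only: of_real_eq_0_iff not_False_eq_True)
  have Y: "y k = of_real (c1 k) * y (Suc k) + of_real (w1 k) * (of_real mu * x k - p k)"
    using assms(1) unfolding solves_def by blast
  have X: "x (Suc k) = of_real (c2 k) * x k - of_real (w0 (Suc k)) * (of_real mu * y (Suc k) + q (Suc k))"
    using assms(1) unfolding solves_def by blast
  have kk: "of_real (kap k) = of_real (c1 k) * of_real (c2 k) * of_real (kap (Suc k)) / d + of_real mu * of_real (w1 k)"
    by (subst kap_rec) (simp add: d_def)
  have Z: "z (Suc k) = d * y (Suc k) - of_real (kap (Suc k)) * of_real (c2 k) * x k
      + of_real (kap (Suc k)) * of_real (w0 (Suc k)) * q (Suc k)"
    by (simp add: z_def X d_def algebra_simps)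
  have "of_real (c1 k) / d * z (Suc k) = of_real (c1 k) * y (Suc k)
      - of_real (c1 k) * of_real (c2 k) * of_real (kap (Suc k)) / d * x k
      + of_real (c1 k) * of_real (w0 (Suc k)) * of_real (kap (Suc k)) / d * q (Suc k)"
    unfolding Z using d by (simp add: algebra_simps add_divide_distrib diff_divide_distrib)
  then have "z k = of_real (c1 k) / d * z (Suc k) - of_real (w1 k) * p k
      - of_real (c1 k) * of_real (w0 (Suc k)) * of_real (kap (Suc k)) / d * q (Suc k)"
    unfolding z_def kk by (subst Y) (simp add: algebra_simps)
  then show ?thesis
    by (simp add: kap'_def d_def)
qed

text \<open>
  Square summability with bound \<open>E\<close>, in terms of partial sums; it serves for sources and for
  solutions alike.
\<close>

definition energy_le :: "(nat \<Rightarrow> complex) \<Rightarrow> (nat \<Rightarrow> complex) \<Rightarrow> real \<Rightarrow> bool" where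
  "energy_le p q E \<longleftrightarrow>
     (\<forall>N. (\<Sum>k<N. w1 k * (cmod (p k))\<^sup>2 + w0 k * (cmod (q k))\<^sup>2) \<le> E)"

lemma energy_nonneg: "energy_le p q E \<Longrightarrow> 0 \<le> E"
  unfolding energy_le_def by (drule spec[of _ 0]) simp

lemma forward_bound:
  assumes sol: "solves x y p q" and src: "energy_le p q E"
  shows "(cmod (x k + of_real (lam k) * y k))\<^sup>2 \<le> 2 * suminf w0 * E"
proof -
  define u where "u k = x k + of_real (lam k) * y k" for k
  note rec = forward_component[OF sol, folded u_def]
  have nn: "0 \<le> w1 j * lam' j * cmod (p j)" "0 \<le> w0 j * cmod (q j)" for j
    using w0_pos[of j] w1_pos[of j] lam'_nonneg[of j] by auto
  define s where "s j = w1 j * lam' j * cmod (p j) + w0 j * 1 * cmod (q j)" for j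
  have "cmod (u k) + w1 k * lam' k * cmod (p k) \<le> (\<Sum>j<Suc k. s j)"
  proof (induction k)
    case 0
    show ?case using w0_pos[of 0] nn[of 0] by (simp add: rec s_def norm_mult)
  next
    case (Suc k)
    have c: "c2 k / (1 + mu * w1 k * lam k) \<le> 1" "0 \<le> c2 k / (1 + mu * w1 k * lam k)"
      using c2[of k] denominators(1)[of k] by auto
    have "cmod (u (Suc k)) \<le> cmod (of_real (c2 k / (1 + mu * w1 k * lam k)) * u k)
        + cmod (of_real (c2 k * w1 k * lam' k) * p k) + cmod (of_real (w0 (Suc k)) * q (Suc k))"
      unfolding rec(2) by (rule order_trans[OF norm_triangle_ineq4 add_right_mono[OF norm_triangle_ineq]])
    moreover have "cmod (of_real (c2 k / (1 + mu * w1 k * lam k)) * u k) \<le> cmod (u k)"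
      unfolding norm_mult norm_of_real abs_of_nonneg[OF c(2)] using c by (intro mult_left_le_one_le) auto
    moreover have "cmod (of_real (c2 k * w1 k * lam' k) * p k) \<le> w1 k * lam' k * cmod (p k)"
      using c2[of k] nn(1)[of k] w1_pos[of k] lam'_nonneg[of k]
      by (simp add: norm_mult abs_mult mult.assoc mult_left_le_one_le)
    moreover have "cmod (of_real (w0 (Suc k)) * q (Suc k)) = w0 (Suc k) * cmod (q (Suc k))"
      using w0_pos[of "Suc k"] by (simp add: norm_mult)
    ultimately have "cmod (u (Suc k)) + w1 (Suc k) * lam' (Suc k) * cmod (p (Suc k))
        \<le> cmod (u k) + w1 k * lam' k * cmod (p k) + s (Suc k)"
      by (simp add: s_def)
    then show ?case
      using Suc by (simp only: sum.lessThan_Suc)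
  qed
  then have "cmod (u k) \<le> (\<Sum>j<Suc k. s j)"
    using nn(1)[of k] by linarith
  then have "(cmod (u k))\<^sup>2 \<le> (\<Sum>j<Suc k. w1 j * lam' j * cmod (p j) + w0 j * 1 * cmod (q j))\<^sup>2"
    unfolding s_def by (intro power_mono) auto
  also have "\<dots> \<le> (\<Sum>j<Suc k. w1 j * (lam' j)\<^sup>2 + w0 j * 1\<^sup>2) *
      (\<Sum>j<Suc k. w1 j * (cmod (p j))\<^sup>2 + w0 j * (cmod (q j))\<^sup>2)"
    using w0_pos w1_pos by (intro weighted_Cauchy_Schwarz) (auto simp: less_imp_le)
  also have "\<dots> \<le> (2 * suminf w0) * E"
  proof (rule mult_mono)
    show "(\<Sum>j<Suc k. w1 j * (lam' j)\<^sup>2 + w0 j * 1\<^sup>2) \<le> 2 * suminf w0"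
      using sum_lam'[of "Suc k"] sum_w0[of "Suc k"] by (simp only: sum.distrib power_one mult_1_right)
    show "(\<Sum>j<Suc k. w1 j * (cmod (p j))\<^sup>2 + w0 j * (cmod (q j))\<^sup>2) \<le> E"
      using src unfolding energy_le_def by blast
  qed (use w0_pos w1_pos s0_nonneg in \<open>auto intro!: sum_nonneg add_nonneg_nonneg mult_nonneg_nonneg simp: less_imp_le\<close>)
  finally show ?thesis
    by (simp add: u_def)
qed

lemma backward_source_bound:
  assumes src: "energy_le p q E"
  shows "(\<Sum>j<N. w1 j * 1 * cmod (p j) + w0 j * kap' j * cmod (q j)) \<le> sqrt (2 * S1 * E)"
proof (rule real_le_rsqrt)
  have "(\<Sum>j<N. w1 j * 1 * cmod (p j) + w0 j * kap' j * cmod (q j))\<^sup>2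
    \<le> (\<Sum>j<N. w1 j * 1\<^sup>2 + w0 j * (kap' j)\<^sup>2) *
      (\<Sum>j<N. w1 j * (cmod (p j))\<^sup>2 + w0 j * (cmod (q j))\<^sup>2)"
    using w0_pos w1_pos by (intro weighted_Cauchy_Schwarz) (auto simp: less_imp_le)
  also have "\<dots> \<le> (2 * S1) * E"
  proof (rule mult_mono)
    show "(\<Sum>j<N. w1 j * 1\<^sup>2 + w0 j * (kap' j)\<^sup>2) \<le> 2 * S1"
      using sum_kap'[of N] sum_w1[of N] S1_ge by (simp only: sum.distrib power_one mult_1_right)
    show "(\<Sum>j<N. w1 j * (cmod (p j))\<^sup>2 + w0 j * (cmod (q j))\<^sup>2) \<le> E"
      using src unfolding energy_le_def by blast
  qed (use w0_pos w1_pos S1_nonneg in \<open>auto intro!: sum_nonneg add_nonneg_nonneg mult_nonneg_nonneg simp: less_imp_le\<close>)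
  finally show "(\<Sum>j<N. w1 j * 1 * cmod (p j) + w0 j * kap' j * cmod (q j))\<^sup>2 \<le> 2 * S1 * E" .
qed

text \<open>
  Stated for any \<open>z\<close> that obeys the backward recurrence and tends to \<open>0\<close>, because going back from
  infinity is the only information that the contraction needs.
\<close>

lemma backward_bound:
  assumes rec: "\<And>k. z k = of_real (c1 k / (1 + mu * w0 (Suc k) * kap (Suc k))) * z (Suc k)
           - of_real (w1 k) * p k - of_real (c1 k * w0 (Suc k) * kap' (Suc k)) * q (Suc k)"
    and src: "energy_le p q E" and lim: "z \<longlonglongrightarrow> 0"
  shows "(cmod (z k))\<^sup>2 \<le> 2 * S1 * E"
proof -
  define A where "A j = w1 j * 1 * cmod (p j)" for j
  define B where "B j = w0 j * kap' j * cmod (q j)" for j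
  have nn: "0 \<le> A j" "0 \<le> B j" for j
    using w0_pos[of j] w1_pos[of j] kap'_nonneg[of j] by (auto simp: A_def B_def)
  have step: "cmod (z k) \<le> A k + B (Suc k) + cmod (z (Suc k))" for k
  proof -
    have c: "c1 k / (1 + mu * w0 (Suc k) * kap (Suc k)) \<le> 1" "0 \<le> c1 k / (1 + mu * w0 (Suc k) * kap (Suc k))"
      using c1[of k] denominators(2)[of "Suc k"] by auto
    have "cmod (z k) \<le> cmod (of_real (c1 k / (1 + mu * w0 (Suc k) * kap (Suc k))) * z (Suc k))
        + cmod (of_real (w1 k) * p k) + cmod (of_real (c1 k * w0 (Suc k) * kap' (Suc k)) * q (Suc k))"
      by (subst rec) (rule order_trans[OF norm_triangle_ineq4 add_right_mono[OF norm_triangle_ineq4]])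
    moreover have "cmod (of_real (c1 k / (1 + mu * w0 (Suc k) * kap (Suc k))) * z (Suc k)) \<le> cmod (z (Suc k))"
      unfolding norm_mult norm_of_real abs_of_nonneg[OF c(2)] using c by (intro mult_left_le_one_le) auto
    moreover have "cmod (of_real (c1 k * w0 (Suc k) * kap' (Suc k)) * q (Suc k)) \<le> B (Suc k)"
      using c1[of k] nn(2)[of "Suc k"] w0_pos[of "Suc k"] kap'_nonneg[of "Suc k"]
      by (simp add: B_def norm_mult abs_mult mult.assoc mult_left_le_one_le)
    moreover have "cmod (of_real (w1 k) * p k) = A k"
      using w1_pos[of k] by (simp add: A_def norm_mult)
    ultimately show ?thesis by simp
  qed
  have "cmod (z k) \<le> (\<Sum>j\<in>{k..<k+n}. A j + B (Suc j)) + cmod (z (k + n))" for n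
  proof (induction n)
    case (Suc n)
    then show ?case using step[of "k + n"] by simp
  qed simp
  moreover have "(\<Sum>j\<in>{k..<k+n}. A j + B (Suc j)) \<le> (\<Sum>j<Suc (k+n). A j + B j)" for n
  proof -
    have "(\<Sum>j\<in>{k..<k+n}. A j) \<le> (\<Sum>j<Suc (k+n). A j)"
      using nn by (intro sum_mono2) auto
    moreover have "(\<Sum>j\<in>{k..<k+n}. B (Suc j)) = (\<Sum>j\<in>{Suc k..<Suc (k+n)}. B j)"
      by (rule sum.shift_bounds_Suc_ivl[symmetric])
    moreover have "\<dots> \<le> (\<Sum>j<Suc (k+n). B j)"
      using nn by (intro sum_mono2) auto
    ultimately show ?thesis by (simp only: sum.distrib)
  qed
  moreover have "(\<Sum>j<N. A j + B j) \<le> sqrt (2 * S1 * E)" for N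
    unfolding A_def B_def by (rule backward_source_bound[OF src])
  ultimately have "cmod (z k) \<le> sqrt (2 * S1 * E) + cmod (z (k + n))" for n
    by (smt (verit, best))
  moreover have "(\<lambda>n. sqrt (2 * S1 * E) + cmod (z (k + n))) \<longlonglongrightarrow> sqrt (2 * S1 * E) + cmod 0"
    using LIMSEQ_ignore_initial_segment[OF lim, of k]
    by (intro tendsto_intros) (simp add: add.commute)
  ultimately have "cmod (z k) \<le> sqrt (2 * S1 * E) + cmod 0"
    by (intro LIMSEQ_le_const) auto
  then have "(cmod (z k))\<^sup>2 \<le> (sqrt (2 * S1 * E))\<^sup>2"
    by (intro power_mono) auto
  then show ?thesis
    using S1_nonneg energy_nonneg[OF src] by simp
qed

text \<open>
  A summable majorant of the squares of all solutions with sources of energy at most \<open>1\<close>. Its sum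
  bounds the squared norm of the solution operator, and its tails being small makes this operator
  compact.
\<close>

definition profile :: "nat \<Rightarrow> real" where
  "profile k = 4 * (w1 k * (suminf w0 + (lam' k)\<^sup>2 * S1) + w0 k * (S1 + (kap' k)\<^sup>2 * suminf w0))"

lemma profile_nonneg: "0 \<le> profile k"
  using w0_pos[of k] w1_pos[of k] S1_nonneg s0_nonneg by (simp add: profile_def)

lemma sum_profile: "(\<Sum>k<N. profile k) \<le> 16 * (suminf w0 * S1)"
proof -
  have "(\<Sum>k<N. profile k) = 4 * (suminf w0 * (\<Sum>k<N. w1 k) + S1 * (\<Sum>k<N. w1 k * (lam' k)\<^sup>2)
     + (S1 * (\<Sum>k<N. w0 k) + suminf w0 * (\<Sum>k<N. w0 k * (kap' k)\<^sup>2)))"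
    by (simp add: profile_def sum_distrib_left sum.distrib[symmetric]) (simp add: algebra_simps)
  also have "\<dots> \<le> 4 * (suminf w0 * S1 + S1 * suminf w0 + (S1 * suminf w0 + suminf w0 * S1))"
    using sum_w0[of N] sum_w1[of N] S1_ge sum_lam'[of N] sum_kap'[of N] S1_nonneg s0_nonneg
    by (intro mult_left_mono add_mono) auto
  finally show ?thesis by simp
qed

lemma profile_summable: "summable profile"
  by (rule summableI_nonneg_bounded[OF profile_nonneg sum_profile])

text \<open>
  Solving for \<open>x\<close> and \<open>y\<close> in terms of the two decoupled combinations introduces the denominator
  \<open>1 + kap * lam\<close>. Since \<open>kap \<ge> mu * w1\<close> and \<open>lam \<ge> mu * w0\<close>, it dominates the denominators of both
  \<open>lam'\<close> and \<open>kap'\<close>, so that only these damped quotients, whose square sums are under control,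
  multiply the bounds for the two combinations.
\<close>

lemma solution_bound:
  assumes sol: "solves x y p q" and src: "energy_le p q E"
    and lim: "(\<lambda>k. y k - of_real (kap k) * x k) \<longlonglongrightarrow> 0"
  shows "w1 k * (cmod (x k))\<^sup>2 + w0 k * (cmod (y k))\<^sup>2 \<le> profile k * E"
proof -
  define u where "u = x k + of_real (lam k) * y k"
  define z where "z = y k - of_real (kap k) * x k"
  define D where "D = 1 + kap k * lam k"
  have u: "(cmod u)\<^sup>2 \<le> 2 * suminf w0 * E"
    unfolding u_def by (rule forward_bound[OF sol src])
  have z: "(cmod z)\<^sup>2 \<le> 2 * S1 * E"
    using backward_bound[OF backward_component[OF sol] src lim] by (simp add: z_def)
  have lam_ge: "mu * w0 k \<le> lam k"
    using lam'_nonneg c1 c2 by (cases k) (auto simp: lam_Suc less_imp_le simp del: lam.simps(2))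
  have kap_ge: "mu * w1 k \<le> kap k"
    using kap_Suc[of k] kap'_nonneg[of "Suc k"] c1[of k] c2[of k] by (simp add: less_imp_le)
  have D: "1 \<le> D" "1 + mu * w1 k * lam k \<le> D" "1 + mu * w0 k * kap k \<le> D"
    using mult_right_mono[OF kap_ge lam_nonneg[of k]] mult_right_mono[OF lam_ge kap_nonneg[of k]]
      lam_nonneg[of k] kap_nonneg[of k] by (auto simp: D_def mult.commute)
  have "of_real D * x k = u - of_real (lam k) * z" "of_real D * y k = z + of_real (kap k) * u"
    by (simp_all add: D_def u_def z_def algebra_simps)
  then have "cmod (of_real D * x k) \<le> cmod u + lam k * cmod z" "cmod (of_real D * y k) \<le> cmod z + kap k * cmod u"
    using norm_triangle_ineq4[of u "of_real (lam k) * z"] norm_triangle_ineq[of z "of_real (kap k) * u"]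
      lam_nonneg[of k] kap_nonneg[of k] by (auto simp: norm_mult)
  then have xy: "cmod (x k) \<le> cmod u / D + lam k / D * cmod z" "cmod (y k) \<le> cmod z / D + kap k / D * cmod u"
    using D by (simp_all add: norm_mult field_simps)
  have "cmod u / D \<le> cmod u / 1" "cmod z / D \<le> cmod z / 1"
    using D by (intro divide_left_mono; simp)+
  moreover have "lam k / D \<le> lam' k" "kap k / D \<le> kap' k"
    unfolding lam'_def kap'_def using D denominators[of k] lam_nonneg[of k] kap_nonneg[of k]
    by (intro divide_left_mono; simp)+
  ultimately have q: "cmod u / D \<le> cmod u" "cmod z / D \<le> cmod z" "lam k / D \<le> lam' k" "kap k / D \<le> kap' k"
    by simp_all
  have "cmod (x k) \<le> cmod u + lam' k * cmod z" "cmod (y k) \<le> cmod z + kap' k * cmod u"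
    using xy q(1,2) mult_right_mono[OF q(3), of "cmod z"] mult_right_mono[OF q(4), of "cmod u"] by auto
  then have "(cmod (x k))\<^sup>2 \<le> 2 * (2 * suminf w0 * E + (lam' k)\<^sup>2 * (2 * S1 * E))"
    "(cmod (y k))\<^sup>2 \<le> 2 * (2 * S1 * E + (kap' k)\<^sup>2 * (2 * suminf w0 * E))"
    using u z by (intro square_triangle_bound[where a = "cmod u" and b = "cmod z"]
        square_triangle_bound[where a = "cmod z" and b = "cmod u"]; simp)+
  then have "w1 k * (cmod (x k))\<^sup>2 + w0 k * (cmod (y k))\<^sup>2
     \<le> w1 k * (2 * (2 * suminf w0 * E + (lam' k)\<^sup>2 * (2 * S1 * E)))
       + w0 k * (2 * (2 * S1 * E + (kap' k)\<^sup>2 * (2 * suminf w0 * E)))"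
    using w0_pos[of k] w1_pos[of k] by (intro add_mono mult_left_mono) auto
  also have "\<dots> = profile k * E"
    by (simp add: profile_def algebra_simps)
  finally show ?thesis .
qed

text \<open>
  Every choice of \<open>y 0\<close> gives a solution by forward recursion. The condition at infinity means that
  \<open>y - kap * x\<close> is the convergent backward sum \<open>Z\<close>, and it suffices to impose this at \<open>k = 0\<close>.
\<close>

lemma solution_exists:
  assumes src: "energy_le p q E"
  shows "\<exists>x y. solves x y p q \<and> (\<lambda>k. y k - of_real (kap k) * x k) \<longlonglongrightarrow> 0"
proof -
  define S :: "nat \<Rightarrow> complex" where
    "S k = - of_real (w1 k) * p k - of_real (c1 k * w0 (Suc k) * kap' (Suc k)) * q (Suc k)" for k
  define r where "r k = c1 k / (1 + mu * w0 (Suc k) * kap (Suc k))" for k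
  have r: "0 < r k" "r k \<le> 1" for k
    using c1[of k] denominators(2)[of "Suc k"] by (auto simp: r_def)
  (* Multiplication by D makes the backward recurrence telescope. *)
  define D where "D n = (\<Prod>i<n. r i)" for n
  have D: "0 < D n" for n
    using r by (simp add: D_def prod_pos)
  have D_dec: "D (j + k) \<le> D k" for j k
  proof (induction j)
    case (Suc j)
    have "D (Suc j + k) \<le> D (j + k)"
      using r[of "j + k"] D[of "j + k"] by (simp add: D_def mult_left_le)
    with Suc show ?case by simp
  qed simp
  define A where "A j = w1 j * 1 * cmod (p j)" for j
  define B where "B j = w0 j * kap' j * cmod (q j)" for j
  have nn: "0 \<le> A j" "0 \<le> B j" for j
    using w0_pos[of j] w1_pos[of j] kap'_nonneg[of j] by (auto simp: A_def B_def)
  have AB: "(\<Sum>j<N. A j + B j) \<le> sqrt (2 * S1 * E)" for N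
    unfolding A_def B_def by (rule backward_source_bound[OF src])
  have sAB: "summable (\<lambda>j. A j + B j)"
    using nn AB by (intro summableI_nonneg_bounded) auto
  have "summable A" "summable B"
    using nn by (auto intro!: summable_comparison_test'[OF sAB, of 0])
  then have "summable (\<lambda>k. A k + B (Suc k))"
    by (intro summable_add) (simp_all add: summable_Suc_iff)
  moreover have "cmod (S k) \<le> A k + B (Suc k)" for k
  proof -
    have "cmod (of_real (c1 k * w0 (Suc k) * kap' (Suc k)) * q (Suc k)) \<le> B (Suc k)"
      using c1[of k] nn(2)[of "Suc k"] w0_pos[of "Suc k"] kap'_nonneg[of "Suc k"]
      by (simp add: B_def norm_mult abs_mult mult.assoc mult_left_le_one_le)
    moreover have "cmod (- of_real (w1 k) * p k) = A k"
      using w1_pos[of k] by (simp add: A_def norm_mult)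
    ultimately show ?thesis
      unfolding S_def
      by (rule order_trans[OF norm_triangle_ineq4 add_mono[OF eq_refl], rotated])
  qed
  ultimately have Ssum: "summable (\<lambda>k. cmod (S k))"
    by (auto intro: summable_comparison_test'[where N = 0 and g = "\<lambda>k. A k + B (Suc k)"])
  have DS_le: "cmod (of_real (D (j + k)) * S (j + k)) \<le> D k * cmod (S (j + k))" for j k
    using D_dec[of j k] D[of "j + k"] by (simp add: norm_mult mult_right_mono)
  have DSn: "summable (\<lambda>j. cmod (of_real (D (j + k)) * S (j + k)))" for k
  proof (rule summable_comparison_test'[where N = 0])
    show "summable (\<lambda>j. D k * cmod (S (j + k)))"
      by (rule summable_mult[OF summable_ignore_initial_segment[OF Ssum]])
  qed (use DS_le in simp)
  define Z where "Z k = (\<Sum>j. of_real (D (j + k)) * S (j + k)) / of_real (D k)" for k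
  have Z_rec: "Z k = of_real (r k) * Z (Suc k) + S k" for k
  proof -
    have "(\<Sum>j. of_real (D (j + k)) * S (j + k)) =
        of_real (D k) * S k + (\<Sum>j. of_real (D (j + Suc k)) * S (j + Suc k))"
      using suminf_split_head[OF summable_norm_cancel[OF DSn[of k]]] by simp
    moreover have "D (Suc k) = D k * r k"
      by (simp add: D_def)
    ultimately show ?thesis
      using D[of k] r[of k] by (simp add: Z_def add_divide_distrib)
  qed
  have Z_le: "cmod (Z k) \<le> (\<Sum>j. cmod (S (j + k)))" for k
  proof -
    have "cmod (\<Sum>j. of_real (D (j + k)) * S (j + k)) \<le> (\<Sum>j. cmod (of_real (D (j + k)) * S (j + k)))"
      by (rule summable_norm[OF DSn])
    also have "\<dots> \<le> (\<Sum>j. D k * cmod (S (j + k)))"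
      by (rule suminf_le[OF DS_le DSn summable_mult[OF summable_ignore_initial_segment[OF Ssum]]])
    also have "\<dots> = D k * (\<Sum>j. cmod (S (j + k)))"
      by (rule suminf_mult[OF summable_ignore_initial_segment[OF Ssum]])
    finally show ?thesis
      using D[of k] by (simp add: Z_def norm_divide divide_le_eq mult.commute)
  qed
  have "(\<lambda>k. suminf (\<lambda>j. cmod (S j)) - (\<Sum>j<k. cmod (S j))) \<longlonglongrightarrow> suminf (\<lambda>j. cmod (S j)) - suminf (\<lambda>j. cmod (S j))"
    by (intro tendsto_diff tendsto_const summable_LIMSEQ Ssum)
  then have "(\<lambda>k. \<Sum>j. cmod (S (j + k))) \<longlonglongrightarrow> 0"
    by (simp add: suminf_minus_initial_segment[OF Ssum])
  then have Z_lim: "Z \<longlonglongrightarrow> 0"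
    by (rule Lim_null_comparison[rotated]) (simp add: Z_le)
  (* The equation y 0 - kap 0 * x 0 = Z 0 after inserting the equation for x 0. *)
  define y0 where "y0 = (Z 0 - of_real (kap 0 * w0 0) * q 0) / of_real (1 + mu * w0 0 * kap 0)"
  define xy where "xy = rec_nat (- of_real (w0 0) * (of_real mu * y0 + q 0), y0)
     (\<lambda>k (x, y). let y' = (y - of_real (w1 k) * (of_real mu * x - p k)) / of_real (c1 k)
        in (of_real (c2 k) * x - of_real (w0 (Suc k)) * (of_real mu * y' + q (Suc k)), y'))"
  define x where "x k = fst (xy k)" for k
  define y where "y k = snd (xy k)" for k
  have y_Suc: "y (Suc k) = (y k - of_real (w1 k) * (of_real mu * x k - p k)) / of_real (c1 k)" for k
    by (simp add: x_def y_def xy_def case_prod_unfold Let_def)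
  have x_Suc: "x (Suc k) = of_real (c2 k) * x k - of_real (w0 (Suc k)) * (of_real mu * y (Suc k) + q (Suc k))" for k
    by (simp add: x_def y_def xy_def case_prod_unfold Let_def)
  have x_0: "x 0 = - of_real (w0 0) * (of_real mu * y 0 + q 0)" and y_0: "y 0 = y0"
    by (simp_all add: x_def y_def xy_def)
  have y_rec: "y k = of_real (c1 k) * y (Suc k) + of_real (w1 k) * (of_real mu * x k - p k)" for k
  proof -
    have "of_real (c1 k) * y (Suc k) = y k - of_real (w1 k) * (of_real mu * x k - p k)"
      unfolding y_Suc using c1[of k] by simp
    then show ?thesis by (simp only: diff_add_cancel)
  qed
  have sol: "solves x y p q"
    unfolding solves_def using x_0 x_Suc y_rec by blast
  define z where "z k = y k - of_real (kap k) * x k" for k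
  have z_rec: "z k = of_real (r k) * z (Suc k) + S k" for k
    using backward_component[OF sol, of k] by (simp add: z_def S_def r_def)
  have "z k = Z k" for k
  proof (induction k)
    case 0
    have "y 0 * of_real (1 + mu * w0 0 * kap 0) = Z 0 - of_real (kap 0 * w0 0) * q 0"
      using denominators(2)[of 0] unfolding y_0 y0_def
      by (metis nonzero_eq_divide_eq not_one_le_zero of_real_eq_0_iff)
    then show ?case
      by (simp add: z_def x_0 algebra_simps)
  next
    case (Suc k)
    then have "of_real (r k) * z (Suc k) = of_real (r k) * Z (Suc k)"
      using z_rec[of k] Z_rec[of k] by simp
    then show ?case
      using r(1)[of k] by simp
  qed
  then have "z = Z" by auto
  then have "(\<lambda>k. y k - of_real (kap k) * x k) \<longlonglongrightarrow> 0"
    using Z_lim by (simp add: z_def[abs_def])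
  with sol show ?thesis by blast
qed

lemma energy_summable:
  assumes "energy_le f g E"
  shows "summable (\<lambda>k. w1 k * cmod (f k))" "summable (\<lambda>k. w0 k * cmod (g k))"
proof -
  have nn: "0 \<le> w1 k" "0 \<le> w0 k" for k
    using w0_pos[of k] w1_pos[of k] by auto
  have fg: "summable (\<lambda>k. w1 k * (cmod (f k))\<^sup>2 + w0 k * (cmod (g k))\<^sup>2)"
    using assms nn unfolding energy_le_def by (intro summableI_nonneg_bounded) auto
  have "summable (\<lambda>k. w1 k * (cmod (f k))\<^sup>2)" "summable (\<lambda>k. w0 k * (cmod (g k))\<^sup>2)"
    using nn by (auto intro!: summable_comparison_test'[OF fg, of 0])
  then have *: "summable (\<lambda>k. w1 k + w1 k * (cmod (f k))\<^sup>2)" "summable (\<lambda>k. w0 k + w0 k * (cmod (g k))\<^sup>2)"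
    using w0_summable w1_summable by (auto intro: summable_add)
  have "t \<le> 1 + t\<^sup>2" for t :: real
    using sum_squares_bound[of 1 t] zero_le_power2[of t] unfolding one_power2 by linarith
  then have "w * t \<le> w + w * t\<^sup>2" if "0 \<le> w" for w t :: real
    using mult_left_mono[OF _ that, of t "1 + t\<^sup>2"] by (simp add: algebra_simps)
  then show "summable (\<lambda>k. w1 k * cmod (f k))" "summable (\<lambda>k. w0 k * cmod (g k))"
    using nn by (auto intro: summable_comparison_test'[OF *(1), of 0] summable_comparison_test'[OF *(2), of 0])
qed

lemma solution_convergent:
  assumes sol: "solves x y p q" and src: "energy_le p q E" and xy: "energy_le x y B"
  shows "convergent x" "convergent y"
proof -
  have sums: "summable (\<lambda>k. mu * (w1 k * cmod (x k)) + w1 k * cmod (p k))"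
     "summable (\<lambda>k. mu * (w0 (Suc k) * cmod (y (Suc k))) + w0 (Suc k) * cmod (q (Suc k)))"
    using energy_summable[OF src] energy_summable[OF xy]
      summable_Suc_iff[of "\<lambda>k. w0 k * cmod (y k)"] summable_Suc_iff[of "\<lambda>k. w0 k * cmod (q k)"]
    by (auto intro!: summable_add summable_mult)
  have le: "cmod (of_real w * (of_real mu * a + b)) \<le> mu * (w * cmod a) + w * cmod b" if "0 \<le> w" for w a b
  proof -
    have "cmod (of_real w * (of_real mu * a + b)) = w * cmod (of_real mu * a + b)"
      using that by (simp add: norm_mult)
    also have "\<dots> \<le> w * (cmod (of_real mu * a) + cmod b)"
      by (rule mult_left_mono[OF norm_triangle_ineq that])
    finally show ?thesis
      using mu by (simp add: norm_mult algebra_simps)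
  qed
  show "convergent x"
  proof (rule convergent_forward_recurrence[OF c2 c2_prod])
    show "x (Suc k) = of_real (c2 k) * x k + (- (of_real (w0 (Suc k)) * (of_real mu * y (Suc k) + q (Suc k))))" for k
    proof -
      have "x (Suc k) = of_real (c2 k) * x k - of_real (w0 (Suc k)) * (of_real mu * y (Suc k) + q (Suc k))"
        using sol unfolding solves_def by blast
      then show ?thesis by (simp only: diff_conv_add_uminus)
    qed
    show "summable (\<lambda>k. cmod (- (of_real (w0 (Suc k)) * (of_real mu * y (Suc k) + q (Suc k)))))"
      using le[OF less_imp_le[OF w0_pos]] unfolding norm_minus_cancel
      by (intro summable_comparison_test'[OF sums(2), of 0]) auto
  qed
  show "convergent y"
  proof (rule convergent_backward_recurrence[OF c1 c1_prod])
    show "y k = of_real (c1 k) * y (Suc k) + of_real (w1 k) * (of_real mu * x k - p k)" for k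
      using sol unfolding solves_def by blast
    show "summable (\<lambda>k. cmod (of_real (w1 k) * (of_real mu * x k - p k)))"
      using le[OF less_imp_le[OF w1_pos], of _ _ "- p _"]
      by (intro summable_comparison_test'[OF sums(1), of 0]) auto
  qed
qed

text \<open>
  The bound by \<open>profile\<close> does not decay in \<open>mu\<close>, while infinitely many frequencies occur for each
  radial index. The decay comes from pairing the two equations with \<open>x\<close> and \<open>- y\<close>. The cross terms
  telescope once they are weighted with the products \<open>\<sigma>\<close> of the quotients \<open>c1 / c2\<close>, and the
  remaining boundary term tends to a positive multiple of \<open>\<rho> * \<bar>x(\<infinity>)\<bar>\<^sup>2 \<ge> 0\<close>. The price is a constant that
  depends on the infinite products, hence on the radial index.
\<close>

lemma high_frequency_bound:
  assumes mu_pos: "0 < mu" and sol: "solves x y p q" and src: "energy_le p q E"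
    and xy: "energy_le x y B"
    and lim: "(\<lambda>k. y k - of_real (kap k) * x k) \<longlonglongrightarrow> 0"
  shows "energy_le x y (E / (prodinf c1 * prodinf c2 * mu\<^sup>2))"
proof -
  define g1 where "g1 n = (\<Prod>i<n. c1 i)" for n
  define g2 where "g2 n = (\<Prod>i<n. c2 i)" for n
  note b1 = prod_lessThan_bounds[OF c1 c1_prod, folded g1_def]
  note b2 = prod_lessThan_bounds[OF c2 c2_prod, folded g2_def]
  have g_pos: "0 < g1 n" "0 < g2 n" for n
    using b1(1) b1(2)[of n] b2(1) b2(2)[of n] by linarith+
  define \<sigma> where "\<sigma> n = g1 n / g2 n" for n
  have \<sigma>_pos: "0 < \<sigma> n" for n
    using g_pos by (simp add: \<sigma>_def)
  have \<sigma>_Suc: "\<sigma> (Suc n) * c2 n = \<sigma> n * c1 n" for n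
    using c2[of n] by (simp add: \<sigma>_def g1_def g2_def)
  have \<sigma>_ge: "prodinf c1 \<le> \<sigma> n" for n
  proof -
    have "prodinf c1 * g2 n \<le> g1 n * 1"
      using b1 b2(3)[of n] g_pos[of n] by (intro mult_mono) (auto simp: less_imp_le)
    then show ?thesis using g_pos[of n] by (simp add: \<sigma>_def pos_le_divide_eq)
  qed
  have \<sigma>_le: "\<sigma> n \<le> 1 / prodinf c2" for n
    unfolding \<sigma>_def using b1(3)[of n] b2(1) b2(2)[of n] g_pos[of n] by (intro frac_le) auto
  have Y: "w1 k *\<^sub>R p k = (mu * w1 k) *\<^sub>R x k + c1 k *\<^sub>R y (Suc k) - y k" for k
  proof -
    have "y k = of_real (c1 k) * y (Suc k) + of_real (w1 k) * (of_real mu * x k - p k)"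
      using sol unfolding solves_def by blast
    then show ?thesis by (simp add: scaleR_conv_of_real algebra_simps)
  qed
  have X0: "w0 0 *\<^sub>R q 0 = - x 0 - (mu * w0 0) *\<^sub>R y 0"
  proof -
    have "x 0 = - of_real (w0 0) * (of_real mu * y 0 + q 0)"
      using sol unfolding solves_def by blast
    show ?thesis unfolding \<open>x 0 = _\<close> by (simp add: scaleR_conv_of_real algebra_simps)
  qed
  have X: "w0 (Suc k) *\<^sub>R q (Suc k) = c2 k *\<^sub>R x k - x (Suc k) - (mu * w0 (Suc k)) *\<^sub>R y (Suc k)" for k
  proof -
    have "x (Suc k) = of_real (c2 k) * x k - of_real (w0 (Suc k)) * (of_real mu * y (Suc k) + q (Suc k))"
      using sol unfolding solves_def by blast
    then show ?thesis by (simp add: scaleR_conv_of_real algebra_simps)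
  qed
  define e where "e k = w1 k * (cmod (x k))\<^sup>2 + w0 k * (cmod (y k))\<^sup>2" for k
  define e' where "e' k = w1 k * (cmod (p k))\<^sup>2 + w0 k * (cmod (q k))\<^sup>2" for k
  have e_nonneg: "0 \<le> e k" "0 \<le> e' k" for k
    using w0_pos[of k] w1_pos[of k] by (auto simp: e_def e'_def)
  define t where "t k = w1 k * (p k \<bullet> x k) - w0 k * (q k \<bullet> y k)" for k
  define b where "b N = \<sigma> N * c1 N * (y (Suc N) \<bullet> x N)" for N
  have p_x: "w1 k * (p k \<bullet> x k) = mu * w1 k * (cmod (x k))\<^sup>2 + c1 k * (y (Suc k) \<bullet> x k) - y k \<bullet> x k" for k
    using arg_cong[OF Y[of k], of "\<lambda>v. v \<bullet> x k"]
    by (simp add: inner_add_left inner_diff_left power2_norm_eq_inner)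
  have q_y0: "w0 0 * (q 0 \<bullet> y 0) = - (x 0 \<bullet> y 0) - mu * w0 0 * (cmod (y 0))\<^sup>2"
    using arg_cong[OF X0, of "\<lambda>v. v \<bullet> y 0"]
    by (simp add: inner_add_left inner_diff_left power2_norm_eq_inner)
  have q_y: "w0 (Suc k) * (q (Suc k) \<bullet> y (Suc k)) =
      c2 k * (x k \<bullet> y (Suc k)) - x (Suc k) \<bullet> y (Suc k) - mu * w0 (Suc k) * (cmod (y (Suc k)))\<^sup>2" for k
    using arg_cong[OF X[of k], of "\<lambda>v. v \<bullet> y (Suc k)"]
    by (simp add: inner_add_left inner_diff_left power2_norm_eq_inner)
  have t0: "t 0 = mu * e 0 + c1 0 * (y 1 \<bullet> x 0)"
    unfolding t_def p_x q_y0 by (simp add: e_def inner_commute algebra_simps)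
  have tS: "t (Suc k) = mu * e (Suc k) + c1 (Suc k) * (y (Suc (Suc k)) \<bullet> x (Suc k)) - c2 k * (y (Suc k) \<bullet> x k)" for k
    unfolding t_def p_x q_y by (simp add: e_def inner_commute algebra_simps)
  have identity: "(\<Sum>k<Suc N. \<sigma> k * t k) = mu * (\<Sum>k<Suc N. \<sigma> k * e k) + b N" for N
  proof (induction N)
    case 0
    show ?case by (simp add: t0 b_def algebra_simps)
  next
    case (Suc N)
    have "\<sigma> (Suc N) * t (Suc N) = mu * (\<sigma> (Suc N) * e (Suc N)) + b (Suc N)
        - (\<sigma> (Suc N) * c2 N) * (y (Suc N) \<bullet> x N)"
      unfolding tS b_def by (simp add: algebra_simps)
    also have "\<dots> = mu * (\<sigma> (Suc N) * e (Suc N)) + b (Suc N) - b N"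
      unfolding \<sigma>_Suc b_def by simp
    finally show ?case
      using Suc by (simp add: algebra_simps)
  qed
  (* With this splitting half of the energy of the solution is absorbed on the left-hand side. *)
  have young: "u \<bullet> v \<le> mu / 2 * (cmod v)\<^sup>2 + (cmod u)\<^sup>2 / (2 * mu)" for u v :: complex
  proof -
    have "0 \<le> (cmod (mu *\<^sub>R v - u))\<^sup>2" by simp
    also have "\<dots> = mu\<^sup>2 * (cmod v)\<^sup>2 - 2 * mu * (u \<bullet> v) + (cmod u)\<^sup>2"
      unfolding power2_norm_eq_inner
      by (simp add: inner_diff_left inner_diff_right inner_commute power2_eq_square algebra_simps)
    finally have "(2 * mu) * (u \<bullet> v) \<le> (2 * mu) * (mu / 2 * (cmod v)\<^sup>2 + (cmod u)\<^sup>2 / (2 * mu))"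
      using mu_pos by (simp add: distrib_left power2_eq_square)
    then show ?thesis
      by (rule mult_left_le_imp_le) (use mu_pos in simp)
  qed
  have t_le: "t k \<le> mu / 2 * e k + e' k / (2 * mu)" for k
  proof -
    have "w1 k * (p k \<bullet> x k) + w0 k * ((- q k) \<bullet> y k) \<le>
      w1 k * (mu / 2 * (cmod (x k))\<^sup>2 + (cmod (p k))\<^sup>2 / (2 * mu)) +
      w0 k * (mu / 2 * (cmod (y k))\<^sup>2 + (cmod (- q k))\<^sup>2 / (2 * mu))"
      using w0_pos[of k] w1_pos[of k] by (intro add_mono mult_left_mono young) auto
    then show ?thesis
      by (simp add: t_def e_def e'_def algebra_simps add_divide_distrib)
  qed
  have W: "(\<Sum>k<Suc N. \<sigma> k * e k) \<le> E / (prodinf c2 * mu\<^sup>2) - 2 / mu * b N" for N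
  proof -
    have "(\<Sum>k<Suc N. \<sigma> k * e' k) \<le> (\<Sum>k<Suc N. 1 / prodinf c2 * e' k)"
      using \<sigma>_le e_nonneg by (intro sum_mono mult_right_mono) auto
    also have "\<dots> = 1 / prodinf c2 * (\<Sum>k<Suc N. e' k)"
      by (rule sum_distrib_left[symmetric])
    also have "\<dots> \<le> 1 / prodinf c2 * E"
      using src b2(1) unfolding energy_le_def e'_def by (intro mult_left_mono) (blast, simp)
    finally have E': "(\<Sum>k<Suc N. \<sigma> k * e' k) \<le> E / prodinf c2"
      by simp
    have "(\<Sum>k<Suc N. \<sigma> k * t k) \<le> (\<Sum>k<Suc N. \<sigma> k * (mu / 2 * e k + e' k / (2 * mu)))"
      using \<sigma>_pos t_le by (intro sum_mono mult_left_mono) (auto simp: less_imp_le)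
    also have "\<dots> = mu / 2 * (\<Sum>k<Suc N. \<sigma> k * e k) + (\<Sum>k<Suc N. \<sigma> k * e' k) / (2 * mu)"
      unfolding sum_distrib_left sum_divide_distrib sum.distrib[symmetric]
      by (intro sum.cong) (auto simp: algebra_simps)
    also have "\<dots> \<le> mu / 2 * (\<Sum>k<Suc N. \<sigma> k * e k) + E / prodinf c2 / (2 * mu)"
      using E' mu_pos by (intro add_left_mono divide_right_mono) auto
    finally have "mu / 2 * (\<Sum>k<Suc N. \<sigma> k * e k) \<le> E / prodinf c2 / (2 * mu) - b N"
      unfolding identity by linarith
    then have "2 / mu * (mu / 2 * (\<Sum>k<Suc N. \<sigma> k * e k)) \<le> 2 / mu * (E / prodinf c2 / (2 * mu) - b N)"
      using mu_pos by (intro mult_left_mono) auto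
    moreover have "2 / mu * (mu / 2 * W) = W" for W
      using mu_pos by simp
    moreover have "2 / mu * (E / prodinf c2 / (2 * mu) - b N) = E / (prodinf c2 * mu\<^sup>2) - 2 / mu * b N"
      by (simp add: right_diff_distrib power2_eq_square mult.assoc mult.commute)
    ultimately show ?thesis
      by (simp only:)
  qed
  obtain x' y' where x': "x \<longlonglongrightarrow> x'" and y': "y \<longlonglongrightarrow> y'"
    using solution_convergent[OF sol src xy] by (auto simp: convergent_def)
  have "(\<lambda>k. y k - of_real (kap k) * x k) \<longlonglongrightarrow> y' - of_real \<rho> * x'"
    by (intro tendsto_intros x' y' kap_lim)
  with lim have "y' - of_real \<rho> * x' = 0"
    using LIMSEQ_unique by blast
  then have y'_eq: "y' = \<rho> *\<^sub>R x'"
    by (simp add: scaleR_conv_of_real)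
  have "0 \<le> \<rho>"
    using kap_lim kap_nonneg by (intro LIMSEQ_le_const) auto
  have \<sigma>_lim: "\<sigma> \<longlonglongrightarrow> prodinf c1 / prodinf c2"
    unfolding \<sigma>_def[abs_def] g1_def g2_def using b2(1)
    by (intro tendsto_divide prod_lessThan_tendsto_prodinf c1_prod c2_prod) auto
  have "b \<longlonglongrightarrow> prodinf c1 / prodinf c2 * 1 * (y' \<bullet> x')"
    unfolding b_def[abs_def]
    by (intro tendsto_intros \<sigma>_lim x' LIMSEQ_Suc[OF y'] convergent_prod_imp_LIMSEQ c1_prod)
  then have "(\<lambda>N. E / (prodinf c2 * mu\<^sup>2) - 2 / mu * b N) \<longlonglongrightarrow>
      E / (prodinf c2 * mu\<^sup>2) - 2 / mu * (prodinf c1 / prodinf c2 * 1 * (y' \<bullet> x'))"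
    by (intro tendsto_intros)
  moreover have "(\<Sum>k<n. \<sigma> k * e k) \<le> E / (prodinf c2 * mu\<^sup>2) - 2 / mu * b N" if "n \<le> N" for n N
  proof -
    have "(\<Sum>k<n. \<sigma> k * e k) \<le> (\<Sum>k<Suc N. \<sigma> k * e k)"
      using that \<sigma>_pos e_nonneg by (intro sum_mono2) (auto simp: less_imp_le)
    with W[of N] show ?thesis by linarith
  qed
  ultimately have le: "(\<Sum>k<n. \<sigma> k * e k) \<le> E / (prodinf c2 * mu\<^sup>2) - 2 / mu * (prodinf c1 / prodinf c2 * 1 * (y' \<bullet> x'))" for n
    by (intro LIMSEQ_le_const) blast+
  have ge: "0 \<le> 2 / mu * (prodinf c1 / prodinf c2 * 1 * (y' \<bullet> x'))"
    using mu_pos b1(1) b2(1) \<open>0 \<le> \<rho>\<close> by (simp add: y'_eq)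
  have main: "(\<Sum>k<n. \<sigma> k * e k) \<le> E / (prodinf c2 * mu\<^sup>2)" for n
    using le[of n] ge by linarith
  have "(\<Sum>k<n. e k) \<le> E / (prodinf c1 * prodinf c2 * mu\<^sup>2)" for n
  proof -
    have "prodinf c1 * (\<Sum>k<n. e k) \<le> (\<Sum>k<n. \<sigma> k * e k)"
      unfolding sum_distrib_left using \<sigma>_ge e_nonneg by (intro sum_mono mult_right_mono) auto
    also note main[of n]
    finally have "(\<Sum>k<n. e k) * prodinf c1 \<le> E / (prodinf c2 * mu\<^sup>2)"
      by (subst mult.commute)
    then have "(\<Sum>k<n. e k) \<le> E / (prodinf c2 * mu\<^sup>2) / prodinf c1"
      by (rule iffD2[OF pos_le_divide_eq[OF b1(1)]])
    also have "\<dots> = E / (prodinf c1 * prodinf c2 * mu\<^sup>2)"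
      by (simp add: mult_ac)
    finally show ?thesis .
  qed
  then show ?thesis
    by (simp add: energy_le_def e_def)
qed

end

section \<open>Square summable families\<close>

lemma pointwise_convergent_subsequence:
  fixes v :: "nat \<Rightarrow> 'i::countable \<Rightarrow> 'a::heine_borel"
  assumes bdd: "\<And>i. bounded (range (\<lambda>n. v n i))"
  shows "\<exists>r. strict_mono r \<and> (\<forall>i. convergent (\<lambda>n. v (r n) i))"
proof -
  define P where "P n s \<longleftrightarrow> convergent (\<lambda>k. v (s k) (from_nat n))" for n and s :: "nat \<Rightarrow> nat"
  interpret subseqs P
  proof
    fix n and s :: "nat \<Rightarrow> nat"
    have "bounded (range (\<lambda>k. v (s k) (from_nat n)))"
      by (rule bounded_subset[OF bdd]) auto
    then show "\<exists>r'. strict_mono r' \<and> P n (s \<circ> r')"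
      unfolding P_def convergent_def o_def using bounded_imp_convergent_subsequence[unfolded o_def] by blast
  qed
  have "P n (s \<circ> r)" if "strict_mono r" "P n s" for n s r
    using that LIMSEQ_subseq_LIMSEQ by (auto simp: P_def convergent_def o_def)
  then have "P n (diagseq \<circ> (+) (Suc n))" for n
    by (rule diagseq_holds)
  then have "convergent (\<lambda>k. v (diagseq (k + Suc n)) (from_nat n))" for n
    unfolding P_def o_def by (subst add.commute)
  then have "convergent (\<lambda>k. v (diagseq k) (from_nat n))" for n
    using convergent_ignore_initial_segment[of "\<lambda>k. v (diagseq k) (from_nat n)" "Suc n"] by blast
  then have "convergent (\<lambda>k. v (diagseq k) i)" for i
    using from_nat_to_nat[of i] by metis
  with subseq_diagseq show ?thesis by blast
qed

lemma sq_norm_diff_le: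
  fixes a b :: "'a::real_inner"
  shows "(norm (a - b))\<^sup>2 \<le> 2 * (norm a)\<^sup>2 + 2 * (norm b)\<^sup>2"
proof -
  have "(norm (a - b))\<^sup>2 + (norm (a + b))\<^sup>2 = 2 * (norm a)\<^sup>2 + 2 * (norm b)\<^sup>2"
    by (simp add: power2_norm_eq_inner inner_diff_left inner_diff_right inner_add_left inner_add_right)
  then show ?thesis
    using zero_le_power2[of "norm (a + b)"] by linarith
qed

lemma Cauchy_of_uniform_tails:
  fixes v :: "nat \<Rightarrow> 'i \<Rightarrow> 'a::real_inner"
  assumes conv: "\<And>i. convergent (\<lambda>n. v n i)"
    and tails: "\<And>\<epsilon>. 0 < \<epsilon> \<Longrightarrow> \<exists>I. finite I \<and> (\<forall>n J. finite J \<longrightarrow> J \<inter> I = {} \<longrightarrow> (\<Sum>i\<in>J. (norm (v n i))\<^sup>2) \<le> \<epsilon>)"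
    and \<epsilon>: "0 < \<epsilon>"
  shows "\<exists>N. \<forall>n\<ge>N. \<forall>n'\<ge>N. \<forall>J. finite J \<longrightarrow> (\<Sum>i\<in>J. (norm (v n i - v n' i))\<^sup>2) \<le> \<epsilon>"
proof -
  obtain I where I: "finite I"
    and tail: "\<And>n J. finite J \<Longrightarrow> J \<inter> I = {} \<Longrightarrow> (\<Sum>i\<in>J. (norm (v n i))\<^sup>2) \<le> \<epsilon> / 8"
    using tails[of "\<epsilon> / 8"] \<epsilon> by auto
  define l where "l i = lim (\<lambda>n. v n i)" for i
  have l: "(\<lambda>n. v n i) \<longlonglongrightarrow> l i" for i
    using conv[of i] by (simp add: l_def convergent_LIMSEQ_iff)
  have "(\<lambda>n. \<Sum>i\<in>I. (norm (v n i - l i))\<^sup>2) \<longlonglongrightarrow> (\<Sum>i\<in>I. (norm (l i - l i))\<^sup>2)"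
    by (intro tendsto_intros l)
  then have "eventually (\<lambda>n. (\<Sum>i\<in>I. (norm (v n i - l i))\<^sup>2) < \<epsilon> / 8) sequentially"
    by (rule order_tendstoD) (use \<epsilon> in simp)
  then obtain N where N: "\<And>n. n \<ge> N \<Longrightarrow> (\<Sum>i\<in>I. (norm (v n i - l i))\<^sup>2) \<le> \<epsilon> / 8"
    unfolding eventually_sequentially by (meson less_imp_le)
  have "(\<Sum>i\<in>J. (norm (v n i - v n' i))\<^sup>2) \<le> \<epsilon>" if n: "n \<ge> N" "n' \<ge> N" and J: "finite J" for n n' J
  proof -
    have "(\<Sum>i\<in>J. (norm (v n i - v n' i))\<^sup>2) =
        (\<Sum>i\<in>J \<inter> I. (norm (v n i - v n' i))\<^sup>2) + (\<Sum>i\<in>J - I. (norm (v n i - v n' i))\<^sup>2)"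
      by (rule sum.Int_Diff[OF J])
    also have "(\<Sum>i\<in>J \<inter> I. (norm (v n i - v n' i))\<^sup>2) \<le> (\<Sum>i\<in>I. (norm (v n i - v n' i))\<^sup>2)"
      using I by (intro sum_mono2) auto
    also have "\<dots> \<le> (\<Sum>i\<in>I. 2 * (norm (v n i - l i))\<^sup>2 + 2 * (norm (v n' i - l i))\<^sup>2)"
    proof (rule sum_mono)
      fix i
      show "(norm (v n i - v n' i))\<^sup>2 \<le> 2 * (norm (v n i - l i))\<^sup>2 + 2 * (norm (v n' i - l i))\<^sup>2"
        using sq_norm_diff_le[of "v n i - l i" "v n' i - l i"] by simp
    qed
    also have "\<dots> = 2 * (\<Sum>i\<in>I. (norm (v n i - l i))\<^sup>2) + 2 * (\<Sum>i\<in>I. (norm (v n' i - l i))\<^sup>2)"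
      by (simp add: sum.distrib sum_distrib_left)
    also have "\<dots> \<le> \<epsilon> / 2"
      using N[OF n(1)] N[OF n(2)] by simp
    also have "(\<Sum>i\<in>J - I. (norm (v n i - v n' i))\<^sup>2) \<le> (\<Sum>i\<in>J - I. 2 * (norm (v n i))\<^sup>2 + 2 * (norm (v n' i))\<^sup>2)"
      by (intro sum_mono sq_norm_diff_le)
    also have "\<dots> = 2 * (\<Sum>i\<in>J - I. (norm (v n i))\<^sup>2) + 2 * (\<Sum>i\<in>J - I. (norm (v n' i))\<^sup>2)"
      by (simp add: sum.distrib sum_distrib_left)
    also have "\<dots> \<le> \<epsilon> / 2"
      using tail[of "J - I" n] tail[of "J - I" n'] J by (simp add: Int_commute)
    finally show ?thesis by simp
  qed
  then show ?thesis by blast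
qed

section \<open>Splitting the Hilbert space into radial components\<close>

text \<open>
  The Dirac operator couples the coefficient of \<open>f\<close> at \<open>j\<close> with that of \<open>g\<close> at \<open>j - 1\<close> and no others.
  For \<open>j \<ge> 1\<close> this pair comes from the \<open>+\<close> parts and for \<open>j \<le> 0\<close> from the \<open>-\<close> parts, where \<open>f\<close> and
  \<open>g\<close> exchange their roles. In both cases \<open>xpart\<close> is the member whose weight is \<open>a (rad j + 1)\<close> and
  \<open>ypart\<close> the one whose weight is \<open>a (rad j)\<close>.
\<close>

definition rad :: "int \<Rightarrow> nat" where
  "rad j = (if 1 \<le> j then nat (j - 1) else nat (- j))"

definition xpart :: "series \<times> series \<Rightarrow> int \<Rightarrow> int \<Rightarrow> nat \<Rightarrow> complex" where
  "xpart F m j = (if 1 \<le> j then fst F m j else snd F m (j - 1))"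

definition ypart :: "series \<times> series \<Rightarrow> int \<Rightarrow> int \<Rightarrow> nat \<Rightarrow> complex" where
  "ypart F m j = (if 1 \<le> j then snd F m (j - 1) else fst F m j)"

definition assemble :: "(int \<Rightarrow> int \<Rightarrow> nat \<Rightarrow> complex) \<Rightarrow> (int \<Rightarrow> int \<Rightarrow> nat \<Rightarrow> complex) \<Rightarrow> series \<times> series" where
  "assemble X Y = ((\<lambda>m j. if 1 \<le> j then X m j else Y m j),
                   (\<lambda>m j. if 0 \<le> j then Y m (j + 1) else X m (j + 1)))"

lemma parts_assemble [simp]: "xpart (assemble X Y) = X" "ypart (assemble X Y) = Y"
  by (auto simp: assemble_def xpart_def ypart_def fun_eq_iff)

lemma parts_eqI:
  assumes "xpart F = xpart G" "ypart F = ypart G"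
  shows "F = G"
proof -
  have x: "xpart F m j k = xpart G m j k" and y: "ypart F m j k = ypart G m j k" for m j k
    using assms by auto
  have "fst F m j k = fst G m j k" for m j k
    using x[of m j k] y[of m j k] by (auto simp: xpart_def ypart_def split: if_splits)
  moreover have "snd F m j k = snd G m j k" for m j k
    using x[of m "j + 1" k] y[of m "j + 1" k] by (auto simp: xpart_def ypart_def split: if_splits)
  ultimately show ?thesis
    by (simp add: prod_eq_iff fun_eq_iff)
qed

lemma parts_zero: "xpart 0 = (\<lambda>m j k. 0)" "ypart 0 = (\<lambda>m j k. 0)"
  by (auto simp: xpart_def ypart_def fun_eq_iff)

lemma parts_add: "xpart (F + G) m j k = xpart F m j k + xpart G m j k"
   "ypart (F + G) m j k = ypart F m j k + ypart G m j k"
  by (auto simp: xpart_def ypart_def)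

lemma parts_diff: "xpart (F - G) m j k = xpart F m j k - xpart G m j k"
   "ypart (F - G) m j k = ypart F m j k - ypart G m j k"
  by (auto simp: xpart_def ypart_def)

lemma parts_hscale: "xpart (hscale c F) m j k = c * xpart F m j k"
   "ypart (hscale c F) m j k = c * ypart F m j k"
  by (auto simp: xpart_def ypart_def hscale_def)

text \<open>
  An isometry onto the square summable families with values in \<open>\<complex>\<^sup>2\<close>; the finite-dimensional values
  keep the two coupled coefficients together.
\<close>

definition coord :: "(nat \<Rightarrow> nat \<Rightarrow> real) \<Rightarrow> series \<times> series \<Rightarrow> int \<times> int \<times> nat \<Rightarrow> complex \<times> complex" where
  "coord a F = (\<lambda>(m, j, k). (xpart F m j k / of_real (sqrt (a (rad j + 1) k)),
                             ypart F m j k / of_real (sqrt (a (rad j) k))))"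

locale positive_weights =
  fixes a :: "nat \<Rightarrow> nat \<Rightarrow> real"
  assumes a_pos: "0 < a n k"
begin

lemma norm_coord:
  "(norm (coord a F (m, j, k)))\<^sup>2 =
     (cmod (xpart F m j k))\<^sup>2 / a (rad j + 1) k + (cmod (ypart F m j k))\<^sup>2 / a (rad j) k"
  using a_pos[of "rad j" k] a_pos[of "rad j + 1" k]
  by (simp add: coord_def norm_Pair norm_divide power_divide)

lemma coord_zero: "coord a 0 i = 0"
  unfolding coord_def parts_zero by (simp add: zero_prod_def split: prod.split)

lemma coord_diff: "coord a (F - G) i = coord a F i - coord a G i"
  by (simp add: coord_def parts_diff diff_divide_distrib split: prod.split)

lemma norm_coord_hscale: "(norm (coord a (hscale c F) i))\<^sup>2 = (cmod c)\<^sup>2 * (norm (coord a F i))\<^sup>2"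
  by (cases i) (simp add: norm_coord parts_hscale norm_mult power_mult_distrib distrib_left)

lemma coord_surj: "\<exists>F. coord a F = v"
proof
  show "coord a (assemble (\<lambda>m j k. fst (v (m, j, k)) * of_real (sqrt (a (rad j + 1) k)))
     (\<lambda>m j k. snd (v (m, j, k)) * of_real (sqrt (a (rad j) k)))) = v"
    using a_pos by (auto simp: coord_def fun_eq_iff less_imp_neq[symmetric])
qed

abbreviation fterm :: "series \<Rightarrow> int \<times> int \<times> nat \<Rightarrow> real" where
  "fterm f \<equiv> (\<lambda>(m, j, k). (cmod (f m j k))\<^sup>2 / a (nat \<bar>j\<bar>) k)"

lemma fterm_nonneg: "0 \<le> fterm f i"
  using a_pos by (cases i) (auto simp: less_imp_le)

abbreviation shift :: "int \<times> int \<times> nat \<Rightarrow> int \<times> int \<times> nat" where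
  "shift \<equiv> (\<lambda>(m, j, k). (m, j - 1, k))"

lemma bij_shift: "bij shift"
  by (rule bij_betw_byWitness[where f' = "\<lambda>(m, j, k). (m, j + 1, k)"]) auto

lemma norm_coord_eq_fterm: "(norm (coord a F i))\<^sup>2 = fterm (fst F) i + fterm (snd F) (shift i)"
proof (cases i)
  case (fields m j k)
  have "nat \<bar>j\<bar> = rad j + 1" "nat \<bar>j - 1\<bar> = rad j" if "1 \<le> j"
    using that by (auto simp: rad_def)
  moreover have "nat \<bar>j\<bar> = rad j" "nat \<bar>j - 1\<bar> = rad j + 1" if "\<not> 1 \<le> j"
    using that by (auto simp: rad_def)
  ultimately show ?thesis
    by (cases "1 \<le> j") (auto simp: fields norm_coord xpart_def ypart_def)
qed

lemma H_iff_coord: "F \<in> H a \<longleftrightarrow> (\<lambda>i. (norm (coord a F i))\<^sup>2) summable_on UNIV"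
proof -
  have sh: "(\<lambda>i. fterm (snd F) (shift i)) summable_on UNIV \<longleftrightarrow> fterm (snd F) summable_on UNIV"
    by (rule summable_on_reindex_bij_betw[OF bij_shift])
  show ?thesis
  proof
    assume "F \<in> H a"
    then show "(\<lambda>i. (norm (coord a F i))\<^sup>2) summable_on UNIV"
      unfolding norm_coord_eq_fterm using sh
      by (intro summable_on_add) (auto simp: H_def H0_def)
  next
    assume s: "(\<lambda>i. (norm (coord a F i))\<^sup>2) summable_on UNIV"
    have "fterm (fst F) summable_on UNIV" "(\<lambda>i. fterm (snd F) (shift i)) summable_on UNIV"
      using fterm_nonneg by (auto intro!: summable_on_comparison_test[OF s] simp: norm_coord_eq_fterm)
    then show "F \<in> H a"
      using sh by (cases F) (auto simp: H_def H0_def)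
  qed
qed

lemma hnorm_coord:
  assumes "F \<in> H a"
  shows "(hnorm a F)\<^sup>2 = (\<Sum>\<^sub>\<infinity>i. (norm (coord a F i))\<^sup>2)"
proof -
  have sh: "(\<lambda>i. fterm (snd F) (shift i)) summable_on UNIV \<longleftrightarrow> fterm (snd F) summable_on UNIV"
    by (rule summable_on_reindex_bij_betw[OF bij_shift])
  have n0: "(norm0 a f)\<^sup>2 = infsum (fterm f) UNIV" for f
    using fterm_nonneg by (simp add: norm0_def infsum_nonneg)
  have "(\<Sum>\<^sub>\<infinity>i. (norm (coord a F i))\<^sup>2) = infsum (fterm (fst F)) UNIV + (\<Sum>\<^sub>\<infinity>i. fterm (snd F) (shift i))"
    unfolding norm_coord_eq_fterm using assms sh by (intro infsum_add) (auto simp: H_def H0_def)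
  also have "(\<Sum>\<^sub>\<infinity>i. fterm (snd F) (shift i)) = infsum (fterm (snd F)) UNIV"
    by (rule infsum_reindex_bij_betw[OF bij_shift])
  finally show ?thesis
    by (simp add: hnorm_def n0[symmetric])
qed

lemma hnorm_nonneg: "0 \<le> hnorm a F"
  by (simp add: hnorm_def)

lemma sum_coord_le:
  assumes "F \<in> H a" "finite J"
  shows "(\<Sum>i\<in>J. (norm (coord a F i))\<^sup>2) \<le> (hnorm a F)\<^sup>2"
  unfolding hnorm_coord[OF assms(1)] using assms by (intro finite_sum_le_infsum) (auto simp: H_iff_coord)

lemma H_of_coord_bound:
  assumes "\<And>J. finite J \<Longrightarrow> (\<Sum>i\<in>J. (norm (coord a F i))\<^sup>2) \<le> B"
  shows "F \<in> H a" "(hnorm a F)\<^sup>2 \<le> B"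
proof -
  show F: "F \<in> H a"
    unfolding H_iff_coord using assms by (intro nonneg_bdd_above_summable_on) (auto intro!: bdd_aboveI2)
  show "(hnorm a F)\<^sup>2 \<le> B"
    unfolding hnorm_coord[OF F] using F assms by (intro infsum_le_finite_sums) (auto simp: H_iff_coord)
qed

lemma H_zero: "0 \<in> H a"
  by (rule H_of_coord_bound[where B = 0]) (simp add: coord_zero)

lemma H_add: "F \<in> H a \<Longrightarrow> G \<in> H a \<Longrightarrow> F + G \<in> H a"
  using norm0_triangle(1)[OF a_pos] by (auto simp: H_def)

lemma H_diff: "F \<in> H a \<Longrightarrow> G \<in> H a \<Longrightarrow> F - G \<in> H a"
  using H0_diff[OF a_pos] by (auto simp: H_def)

lemma H_hscale: "F \<in> H a \<Longrightarrow> hscale c F \<in> H a"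
proof (rule H_of_coord_bound(1))
  fix J :: "(int \<times> int \<times> nat) set"
  assume "F \<in> H a" "finite J"
  then have "(cmod c)\<^sup>2 * (\<Sum>i\<in>J. (norm (coord a F i))\<^sup>2) \<le> (cmod c)\<^sup>2 * (hnorm a F)\<^sup>2"
    by (intro mult_left_mono sum_coord_le) simp_all
  then show "(\<Sum>i\<in>J. (norm (coord a (hscale c F) i))\<^sup>2) \<le> (cmod c)\<^sup>2 * (hnorm a F)\<^sup>2"
    by (simp add: norm_coord_hscale sum_distrib_left)
qed

lemma hdist_le_iff:
  assumes "F \<in> H a" "G \<in> H a" "0 \<le> t"
  shows "hdist a F G \<le> t \<longleftrightarrow> (\<forall>J. finite J \<longrightarrow> (\<Sum>i\<in>J. (norm (coord a F i - coord a G i))\<^sup>2) \<le> t\<^sup>2)"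
proof
  assume "hdist a F G \<le> t"
  then have "(hnorm a (F - G))\<^sup>2 \<le> t\<^sup>2"
    unfolding hdist_def by (rule power_mono[OF _ hnorm_nonneg])
  then show "\<forall>J. finite J \<longrightarrow> (\<Sum>i\<in>J. (norm (coord a F i - coord a G i))\<^sup>2) \<le> t\<^sup>2"
    using sum_coord_le[OF H_diff[OF assms(1,2)]] unfolding coord_diff by (meson order_trans)
next
  assume "\<forall>J. finite J \<longrightarrow> (\<Sum>i\<in>J. (norm (coord a F i - coord a G i))\<^sup>2) \<le> t\<^sup>2"
  then have "(hnorm a (F - G))\<^sup>2 \<le> t\<^sup>2"
    unfolding coord_diff[symmetric] by (intro H_of_coord_bound(2)) blast
  then show "hdist a F G \<le> t"
    unfolding hdist_def using assms(3) by (rule power2_le_imp_le)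
qed

sublocale H: Metric_space "H a" "hdist a"
  by (rule Metric_space_H) (rule a_pos)

text \<open>
  Pointwise limits of coordinates exist, and a bound on finite partial sums passes to the limit.
\<close>

lemma H_complete: "H.mcomplete"
  unfolding H.mcomplete_def
proof (intro allI impI)
  fix s assume "H.MCauchy s"
  then have sH: "s n \<in> H a" for n
    unfolding H.MCauchy_def by blast
  have cau: "\<exists>N. \<forall>n\<ge>N. \<forall>n'\<ge>N. hdist a (s n) (s n') \<le> \<epsilon>" if "0 < \<epsilon>" for \<epsilon>
  proof -
    have "\<forall>\<epsilon>>0. \<exists>N. \<forall>n n'. N \<le> n \<longrightarrow> N \<le> n' \<longrightarrow> hdist a (s n) (s n') < \<epsilon>"
      using \<open>H.MCauchy s\<close> unfolding H.MCauchy_def by (rule conjunct2)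
    from this[rule_format, OF that] show ?thesis
      by (meson less_imp_le)
  qed
  have "Cauchy (\<lambda>n. coord a (s n) i)" for i
  proof (rule metric_CauchyI)
    fix e :: real assume "0 < e"
    then obtain N where N: "\<And>n n'. n \<ge> N \<Longrightarrow> n' \<ge> N \<Longrightarrow> hdist a (s n) (s n') \<le> e / 2"
      using cau[OF half_gt_zero[OF \<open>0 < e\<close>]] by blast
    have "dist (coord a (s n) i) (coord a (s n') i) < e" if "n \<ge> N" "n' \<ge> N" for n n'
    proof -
      have "(\<Sum>i\<in>{i}. (norm (coord a (s n) i - coord a (s n') i))\<^sup>2) \<le> (e / 2)\<^sup>2"
        by (rule iffD1[OF hdist_le_iff[OF sH sH] N[OF that], rule_format]) (use \<open>0 < e\<close> in simp_all)
      then have "(norm (coord a (s n) i - coord a (s n') i))\<^sup>2 \<le> (e / 2)\<^sup>2"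
        by simp
      then have "norm (coord a (s n) i - coord a (s n') i) \<le> e / 2"
        by (rule power2_le_imp_le) (use \<open>0 < e\<close> in simp)
      then show ?thesis using \<open>0 < e\<close> by (simp add: dist_norm)
    qed
    then show "\<exists>M. \<forall>m\<ge>M. \<forall>n\<ge>M. dist (coord a (s m) i) (coord a (s n) i) < e" by blast
  qed
  then have "\<exists>v. \<forall>i. (\<lambda>n. coord a (s n) i) \<longlonglongrightarrow> v i"
    by (meson Cauchy_convergent convergent_def)
  then obtain v where v: "\<And>i. (\<lambda>n. coord a (s n) i) \<longlonglongrightarrow> v i" by blast
  obtain G where G: "coord a G = v" using coord_surj by blast
  have lim: "\<exists>N. \<forall>n\<ge>N. \<forall>J. finite J \<longrightarrow> (\<Sum>i\<in>J. (norm (coord a (s n) i - coord a G i))\<^sup>2) \<le> \<epsilon>\<^sup>2"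
    if "0 < \<epsilon>" for \<epsilon>
  proof -
    obtain N where N: "\<And>n n'. n \<ge> N \<Longrightarrow> n' \<ge> N \<Longrightarrow> hdist a (s n) (s n') \<le> \<epsilon>"
      using cau[OF \<open>0 < \<epsilon>\<close>] by blast
    have "(\<Sum>i\<in>J. (norm (coord a (s n) i - coord a G i))\<^sup>2) \<le> \<epsilon>\<^sup>2" if "n \<ge> N" "finite J" for n J
    proof (rule LIMSEQ_le_const2)
      show "(\<lambda>n'. \<Sum>i\<in>J. (norm (coord a (s n) i - coord a (s n') i))\<^sup>2) \<longlonglongrightarrow>
          (\<Sum>i\<in>J. (norm (coord a (s n) i - coord a G i))\<^sup>2)"
        unfolding G by (intro tendsto_intros v)
      show "\<exists>M. \<forall>n'\<ge>M. (\<Sum>i\<in>J. (norm (coord a (s n) i - coord a (s n') i))\<^sup>2) \<le> \<epsilon>\<^sup>2"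
        using N[OF that(1)] hdist_le_iff[OF sH sH] \<open>0 < \<epsilon>\<close> that(2) by (meson less_imp_le)
    qed
    then show ?thesis by blast
  qed
  have GH: "G \<in> H a"
  proof -
    obtain N where "\<And>J. finite J \<Longrightarrow> (\<Sum>i\<in>J. (norm (coord a (s N) i - coord a G i))\<^sup>2) \<le> 1\<^sup>2"
      using lim[of 1] by auto
    then have "s N - G \<in> H a"
      unfolding coord_diff[symmetric] by (rule H_of_coord_bound(1))
    then have "s N - (s N - G) \<in> H a"
      by (rule H_diff[OF sH])
    then show ?thesis by simp
  qed
  show "\<exists>G. limitin H.mtopology s G sequentially"
  proof (rule exI, unfold H.limit_metric_sequentially, intro conjI allI impI)
    fix \<epsilon> :: real assume "0 < \<epsilon>"
    then obtain N where "\<forall>n\<ge>N. \<forall>J. finite J \<longrightarrow> (\<Sum>i\<in>J. (norm (coord a (s n) i - coord a G i))\<^sup>2) \<le> (\<epsilon> / 2)\<^sup>2"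
      using lim[of "\<epsilon> / 2"] by auto
    then have "\<forall>n\<ge>N. hdist a (s n) G \<le> \<epsilon> / 2"
      using hdist_le_iff[OF sH GH, of "\<epsilon> / 2"] \<open>0 < \<epsilon>\<close> by auto
    then show "\<exists>N. \<forall>n\<ge>N. s n \<in> H a \<and> hdist a (s n) G < \<epsilon>"
      using sH \<open>0 < \<epsilon>\<close> by (metis field_less_half_sum add_0 order_le_less_trans half_gt_zero_iff field_sum_of_halves less_add_same_cancel1)
  qed (rule GH)
qed

text \<open>
  A bounded sequence has a subsequence that converges in every coordinate, and uniformly small tails
  turn this into convergence in norm.
\<close>

lemma relatively_compact_of_uniform_tails:
  assumes A: "A \<subseteq> H a" and bdd: "\<And>F. F \<in> A \<Longrightarrow> hnorm a F \<le> B"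
    and tails: "\<And>\<epsilon>. 0 < \<epsilon> \<Longrightarrow> \<exists>I. finite I \<and>
        (\<forall>F\<in>A. \<forall>J. finite J \<longrightarrow> J \<inter> I = {} \<longrightarrow> (\<Sum>i\<in>J. (norm (coord a F i))\<^sup>2) \<le> \<epsilon>)"
  shows "compactin H.mtopology (H.mtopology closure_of A)"
proof -
  have "H.mtotally_bounded A"
    unfolding H.mtotally_bounded_sequentially
  proof (intro conjI allI impI)
    fix s :: "nat \<Rightarrow> series \<times> series" assume "range s \<subseteq> A"
    then have sA: "s n \<in> A" for n by auto
    with A have sH: "s n \<in> H a" for n by blast
    have "norm (coord a (s n) i) \<le> B" for n i
    proof -
      have "(norm (coord a (s n) i))\<^sup>2 \<le> (hnorm a (s n))\<^sup>2"
        using sum_coord_le[OF sH, of "{i}" n] by simp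
      then have "norm (coord a (s n) i) \<le> hnorm a (s n)"
        by (rule power2_le_imp_le) (rule hnorm_nonneg)
      with bdd[OF sA] show ?thesis by (meson order_trans)
    qed
    then have "bounded (range (\<lambda>n. coord a (s n) i))" for i
      unfolding bounded_iff by blast
    then obtain r where r: "strict_mono r" "\<And>i. convergent (\<lambda>n. coord a (s (r n)) i)"
      using pointwise_convergent_subsequence[of "\<lambda>n. coord a (s n)"] by blast
    have "H.MCauchy (s \<circ> r)"
      unfolding H.MCauchy_def
    proof (intro conjI allI impI)
      fix \<epsilon> :: real assume \<epsilon>: "0 < \<epsilon>"
      have "\<exists>N. \<forall>n\<ge>N. \<forall>n'\<ge>N. \<forall>J. finite J \<longrightarrow>
          (\<Sum>i\<in>J. (norm (coord a (s (r n)) i - coord a (s (r n')) i))\<^sup>2) \<le> (\<epsilon> / 2)\<^sup>2"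
      proof (rule Cauchy_of_uniform_tails[OF r(2)])
        fix e :: real assume "0 < e"
        then obtain I where "finite I"
          and I: "\<forall>F\<in>A. \<forall>J. finite J \<longrightarrow> J \<inter> I = {} \<longrightarrow> (\<Sum>i\<in>J. (norm (coord a F i))\<^sup>2) \<le> e"
          using tails[OF \<open>0 < e\<close>] by (elim exE conjE) (rule that)
        then show "\<exists>I. finite I \<and> (\<forall>n J. finite J \<longrightarrow> J \<inter> I = {} \<longrightarrow>
            (\<Sum>i\<in>J. (norm (coord a (s (r n)) i))\<^sup>2) \<le> e)"
          using bspec[OF I sA] by (intro exI[of _ I] conjI allI) auto
      qed (use \<epsilon> in simp)
      then obtain N where N: "\<And>n n' J. n \<ge> N \<Longrightarrow> n' \<ge> N \<Longrightarrow> finite J \<Longrightarrow>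
          (\<Sum>i\<in>J. (norm (coord a (s (r n)) i - coord a (s (r n')) i))\<^sup>2) \<le> (\<epsilon> / 2)\<^sup>2"
        by blast
      have half: "0 \<le> \<epsilon> / 2" "\<epsilon> / 2 < \<epsilon>" using \<epsilon> by auto
      have "hdist a (s (r n)) (s (r n')) < \<epsilon>" if "n \<ge> N" "n' \<ge> N" for n n'
        using iffD2[OF hdist_le_iff[OF sH sH half(1)]] N[OF that] half(2) by (meson order_le_less_trans)
      then show "\<exists>N. \<forall>n n'. N \<le> n \<longrightarrow> N \<le> n' \<longrightarrow> hdist a ((s \<circ> r) n) ((s \<circ> r) n') < \<epsilon>"
        unfolding o_def by blast
    qed (use sH in auto)
    with r(1) show "\<exists>r. strict_mono r \<and> H.MCauchy (s \<circ> r)" by blast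
  qed (rule A)
  then show ?thesis
    using H.mtotally_bounded_eq_compact_closure_of[OF H_complete] A by blast
qed

end

section \<open>The quantum K function\<close>

text \<open>
  For the quantum K function no square summability is known in advance, so boundedness comes from a
  discrete Gronwall argument for \<open>T\<close>, in which \<open>y\<close> is normalized by the products of \<open>c1\<close>.
\<close>

lemma hyperbolic_recurrence_convergent:
  fixes x y w0 w1 c1 c2 :: "nat \<Rightarrow> real" and m :: real
  assumes w: "\<And>k. 0 < w0 k" "\<And>k. 0 < w1 k" "summable w0" "summable w1"
    and c1: "\<And>k. 0 < c1 k \<and> c1 k \<le> 1" and c2: "\<And>k. 0 < c2 k \<and> c2 k \<le> 1"
    and prod: "convergent_prod c1" "convergent_prod c2"
    and y: "\<And>k. y k = c1 k * y (Suc k) + w1 k * (m * x k)"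
    and x: "\<And>k. x (Suc k) = c2 k * x k - w0 (Suc k) * (m * y (Suc k))"
  shows "convergent x" "convergent y"
proof -
  define g where "g n = (\<Prod>i<n. c1 i)" for n
  note b = prod_lessThan_bounds[OF c1 prod(1), folded g_def]
  have g_pos: "0 < g n" for n
    using b(1) b(2)[of n] by linarith
  define L where "L = \<bar>m\<bar> / prodinf c1"
  have L: "0 \<le> L" using b(1) by (simp add: L_def)
  have mL: "\<bar>m\<bar> \<le> L"
    using b(1) order_trans[OF b(2) b(3)] mult_left_mono[of "prodinf c1" 1 "\<bar>m\<bar>"]
    by (simp add: L_def pos_le_divide_eq)
  (* L also pays for the passage from g k * y k back to y k, hence the infinite product in it. *)
  define T where "T k = \<bar>g k * y k\<bar> + \<bar>x k\<bar>" for k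
  have T_nonneg: "0 \<le> T k" for k by (simp add: T_def)
  have T_Suc: "T (Suc k) \<le> exp (L * (w0 (Suc k) + w1 k)) * T k" for k
  proof -
    have "g (Suc k) * y (Suc k) = g k * (c1 k * y (Suc k))"
      by (simp add: g_def)
    also have "\<dots> = g k * y k - g k * (w1 k * (m * x k))"
      by (subst (2) y) (simp add: algebra_simps)
    finally have "\<bar>g (Suc k) * y (Suc k)\<bar> \<le> \<bar>g k * y k\<bar> + \<bar>g k * (w1 k * (m * x k))\<bar>"
      by linarith
    moreover have "\<bar>g k * (w1 k * (m * x k))\<bar> \<le> 1 * (w1 k * (L * \<bar>x k\<bar>))"
      unfolding abs_mult using g_pos[of k] b(3)[of k] w(2)[of k] mL
      by (intro mult_mono) (auto simp: less_imp_le)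
    ultimately have gy: "\<bar>g (Suc k) * y (Suc k)\<bar> \<le> \<bar>g k * y k\<bar> + L * w1 k * \<bar>x k\<bar>"
      by (simp add: mult_ac)
    have "\<bar>y (Suc k)\<bar> * prodinf c1 \<le> \<bar>y (Suc k)\<bar> * g (Suc k)"
      using b(2) by (rule mult_left_mono) simp
    then have "\<bar>y (Suc k)\<bar> \<le> \<bar>g (Suc k) * y (Suc k)\<bar> / prodinf c1"
      using b(1) g_pos[of "Suc k"] by (simp add: pos_le_divide_eq abs_mult mult.commute)
    then have "\<bar>m\<bar> * \<bar>y (Suc k)\<bar> \<le> \<bar>m\<bar> * (\<bar>g (Suc k) * y (Suc k)\<bar> / prodinf c1)"
      by (rule mult_left_mono) simp
    then have "\<bar>m * y (Suc k)\<bar> \<le> L * \<bar>g (Suc k) * y (Suc k)\<bar>"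
      by (simp add: L_def abs_mult)
    then have "\<bar>w0 (Suc k) * (m * y (Suc k))\<bar> \<le> w0 (Suc k) * (L * \<bar>g (Suc k) * y (Suc k)\<bar>)"
      unfolding abs_mult[of "w0 (Suc k)"] using w(1)[of "Suc k"] by (auto intro!: mult_left_mono)
    moreover have "\<bar>c2 k * x k\<bar> \<le> \<bar>x k\<bar>"
      using c2[of k] by (simp add: abs_mult mult_left_le_one_le)
    ultimately have "\<bar>x (Suc k)\<bar> \<le> \<bar>x k\<bar> + w0 (Suc k) * (L * \<bar>g (Suc k) * y (Suc k)\<bar>)"
      unfolding x by linarith
    then have "T (Suc k) \<le> (1 + L * w0 (Suc k)) * \<bar>g (Suc k) * y (Suc k)\<bar> + \<bar>x k\<bar>"
      by (simp add: T_def algebra_simps)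
    also have "\<dots> \<le> (1 + L * w0 (Suc k)) * (\<bar>g k * y k\<bar> + L * w1 k * \<bar>x k\<bar>) + (1 + L * w0 (Suc k)) * \<bar>x k\<bar>"
      using gy L w(1)[of "Suc k"] mult_nonneg_nonneg[OF L less_imp_le[OF w(1)[of "Suc k"]]]
      by (intro add_mono mult_left_mono) (auto simp: distrib_right)
    also have "\<dots> = (1 + L * w0 (Suc k)) * (T k + L * w1 k * \<bar>x k\<bar>)"
      by (simp add: T_def algebra_simps)
    also have "\<dots> \<le> (1 + L * w0 (Suc k)) * (T k + L * w1 k * T k)"
      using L w(1)[of "Suc k"] w(2)[of k] by (intro mult_left_mono add_left_mono) (auto simp: T_def)
    also have "\<dots> = (1 + L * w0 (Suc k)) * (1 + L * w1 k) * T k"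
      by (simp add: algebra_simps)
    also have "\<dots> \<le> exp (L * w0 (Suc k)) * exp (L * w1 k) * T k"
      using L w(1)[of "Suc k"] w(2)[of k] T_nonneg
      by (intro mult_right_mono mult_mono exp_ge_add_one_self) auto
    finally show ?thesis
      by (simp add: exp_add[symmetric] distrib_left)
  qed
  have T_le: "T k \<le> exp (L * (\<Sum>i<k. w0 (Suc i) + w1 i)) * T 0" for k
  proof (induction k)
    case (Suc k)
    have "T (Suc k) \<le> exp (L * (w0 (Suc k) + w1 k)) * (exp (L * (\<Sum>i<k. w0 (Suc i) + w1 i)) * T 0)"
      using Suc by (intro order_trans[OF T_Suc mult_left_mono]) auto
    then show ?case
      by (simp add: exp_add[symmetric] distrib_left mult.assoc[symmetric] add.commute)
  qed simp
  have sw: "summable (\<lambda>i. w0 (Suc i) + w1 i)"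
    using w by (intro summable_add) (auto simp: summable_Suc_iff)
  define M where "M = exp (L * (\<Sum>i. w0 (Suc i) + w1 i)) * T 0"
  have TM: "T k \<le> M" for k
  proof -
    have "(\<Sum>i<k. w0 (Suc i) + w1 i) \<le> (\<Sum>i. w0 (Suc i) + w1 i)"
      by (intro sum_le_suminf[OF sw]) (simp_all add: w(1,2) less_imp_le add_pos_pos)
    then have "exp (L * (\<Sum>i<k. w0 (Suc i) + w1 i)) * T 0 \<le> M"
      unfolding M_def using L T_nonneg by (intro mult_right_mono) (auto intro!: mult_left_mono)
    with T_le[of k] show ?thesis by linarith
  qed
  have xM: "\<bar>x k\<bar> \<le> M" for k
    using TM[of k] by (simp add: T_def)
  have yM: "\<bar>y k\<bar> \<le> M / prodinf c1" for k
  proof -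
    have "\<bar>y k\<bar> * prodinf c1 \<le> \<bar>y k\<bar> * g k"
      using b(2) by (rule mult_left_mono) simp
    also have "\<dots> \<le> M"
      using TM[of k] g_pos[of k] by (simp add: T_def abs_mult mult.commute)
    finally show ?thesis
      using b(1) by (simp add: pos_le_divide_eq)
  qed
  show "convergent y"
  proof (rule convergent_backward_recurrence[OF c1 prod(1)])
    show "y k = of_real (c1 k) * y (Suc k) + w1 k * (m * x k)" for k
      by (subst y) simp
    show "summable (\<lambda>k. norm (w1 k * (m * x k)))"
    proof (rule summable_comparison_test'[where N = 0])
      show "summable (\<lambda>k. w1 k * (\<bar>m\<bar> * M))"
        by (rule summable_mult2[OF w(4)])
      show "norm (norm (w1 k * (m * x k))) \<le> w1 k * (\<bar>m\<bar> * M)" for k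
        using w(2)[of k] xM[of k] by (auto simp: abs_mult intro!: mult_left_mono)
    qed
  qed
  show "convergent x"
  proof (rule convergent_forward_recurrence[OF c2 prod(2)])
    show "x (Suc k) = of_real (c2 k) * x k + (- (w0 (Suc k) * (m * y (Suc k))))" for k
      by (subst x) simp
    show "summable (\<lambda>k. norm (- (w0 (Suc k) * (m * y (Suc k)))))"
    proof (rule summable_comparison_test'[where N = 0])
      show "summable (\<lambda>k. w0 (Suc k) * (\<bar>m\<bar> * (M / prodinf c1)))"
        by (rule summable_mult2) (simp add: summable_Suc_iff w(3))
      show "norm (norm (- (w0 (Suc k) * (m * y (Suc k))))) \<le> w0 (Suc k) * (\<bar>m\<bar> * (M / prodinf c1))" for k
        using w(1)[of "Suc k"] yM[of "Suc k"] by (simp add: abs_mult mult_left_mono del: times_divide_eq_right)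
    qed
  qed
qed

text \<open>
  The inverse of the transfer matrix has nonnegative entries and a positive diagonal, so that
  positivity propagates from infinity down to \<open>0\<close>.
\<close>

lemma positive_limit_imp_positive:
  fixes x y w0 w1 c1 c2 :: "nat \<Rightarrow> real" and m :: real
  assumes w: "\<And>k. 0 < w0 k" "\<And>k. 0 < w1 k" and c: "\<And>k. 0 < c1 k" "\<And>k. 0 < c2 k" and m: "0 \<le> m"
    and y: "\<And>k. y k = c1 k * y (Suc k) + w1 k * (m * x k)"
    and x: "\<And>k. x (Suc k) = c2 k * x k - w0 (Suc k) * (m * y (Suc k))"
    and lim: "x \<longlonglongrightarrow> x'" "y \<longlonglongrightarrow> y'" "0 < x'" "0 < y'"
  shows "0 < x k \<and> 0 < y k"
proof -
  have "eventually (\<lambda>k. 0 < x k \<and> 0 < y k) sequentially"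
    using order_tendstoD(1)[OF lim(1,3)] order_tendstoD(1)[OF lim(2,4)] by (rule eventually_conj)
  then obtain N where N: "\<And>k. k \<ge> N \<Longrightarrow> 0 < x k \<and> 0 < y k"
    by (auto simp: eventually_sequentially)
  have previous: "0 < x k \<and> 0 < y k" if "0 < x (Suc k) \<and> 0 < y (Suc k)" for k
  proof -
    have "0 \<le> w0 (Suc k) * (m * y (Suc k))"
      using that w(1)[of "Suc k"] m by simp
    then have "0 < c2 k * x k"
      using x[of k] that by linarith
    then have xk: "0 < x k"
      using c(2)[of k] by (simp add: zero_less_mult_iff)
    have "0 < c1 k * y (Suc k)" "0 \<le> w1 k * (m * x k)"
      using that c(1)[of k] w(2)[of k] m xk by auto
    then have "0 < y k"
      unfolding y[of k] by linarith
    with xk show ?thesis ..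
  qed
  have "0 < x (N - i) \<and> 0 < y (N - i)" for i
  proof (induction i)
    case (Suc i)
    show ?case
    proof (cases "i < N")
      case True
      then have "Suc (N - Suc i) = N - i" by simp
      with previous[of "N - Suc i"] Suc show ?thesis by simp
    next
      case False
      then show ?thesis using Suc by simp
    qed
  qed (use N in simp)
  from this[of "N - k"] N[of k] show ?thesis
    by (cases "k \<le> N") auto
qed

lemma quantum_K_quotients_bounded:
  assumes "quantum_K_function a c1 c2 K"
  shows "\<exists>R\<ge>0. \<forall>m n. m \<noteq> 0 \<longrightarrow> \<bar>K_infty K m n $ 1 / K_infty K m n $ 2\<bar> \<le> R"
proof -
  obtain r :: "int \<Rightarrow> real" where r: "\<And>m n. m \<noteq> 0 \<Longrightarrow> \<bar>K_infty K m n $ 1 / K_infty K m n $ 2\<bar> \<le> r m"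
    and lim: "(r \<longlongrightarrow> 0) (filtercomap abs at_top)"
    using assms unfolding quantum_K_function_def by blast
  have "eventually (\<lambda>m. r m < 1) (filtercomap abs at_top)"
    using order_tendstoD(2)[OF lim, of 1] by simp
  then obtain N where N: "\<And>m. \<bar>m\<bar> \<ge> N \<Longrightarrow> r m < 1"
    by (auto simp: eventually_filtercomap eventually_at_top_linorder)
  have "r m \<le> 1 + (\<Sum>i\<in>{-N..N}. \<bar>r i\<bar>)" for m
  proof (cases "\<bar>m\<bar> \<ge> N")
    case True
    moreover have "0 \<le> (\<Sum>i\<in>{-N..N}. \<bar>r i\<bar>)"
      by (rule sum_nonneg) simp
    ultimately show ?thesis using N[of m] by linarith
  next
    case False
    then have "\<bar>r m\<bar> \<le> (\<Sum>i\<in>{-N..N}. \<bar>r i\<bar>)"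
      by (intro member_le_sum) auto
    then show ?thesis by linarith
  qed
  then show ?thesis
    using r by (intro exI[of _ "1 + (\<Sum>i\<in>{-N..N}. \<bar>r i\<bar>)"]) (meson order_trans add_nonneg_nonneg zero_le_one sum_nonneg abs_ge_zero)
qed

locale dirac_problem = positive_weights a for a +
  fixes c1 c2 :: "nat \<Rightarrow> nat \<Rightarrow> real" and K :: "int \<Rightarrow> nat \<Rightarrow> nat \<Rightarrow> real^2" and R :: real
  assumes a_summable: "summable (\<lambda>k. 1 / a n k)"
    and a_lim: "(\<lambda>n. \<Sum>k. 1 / a n k) \<longlonglongrightarrow> 0"
    and c1: "0 < c1 n k \<and> c1 n k \<le> 1" and c2: "0 < c2 n k \<and> c2 n k \<le> 1"
    and c1_prod: "convergent_prod (c1 n)" and c2_prod: "convergent_prod (c2 n)"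
    and K: "quantum_K_function a c1 c2 K"
    and R: "0 \<le> R" and K_quot: "m \<noteq> 0 \<Longrightarrow> \<bar>K_infty K m n $ 1 / K_infty K m n $ 2\<bar> \<le> R"
begin

definition w :: "nat \<Rightarrow> nat \<Rightarrow> real" where "w n k = 1 / a n k"
definition s :: "nat \<Rightarrow> real" where "s n = (\<Sum>k. w n k)"
text \<open>
  Replacing \<open>y\<close> by \<open>sg m * y\<close> turns the equations for \<open>m\<close> into those for \<open>\<bar>m\<bar>\<close>, and it makes the
  quotient of the components of the K function nonnegative. At \<open>m = 0\<close> the first component of the K
  function vanishes at infinity, hence everywhere, which is why \<open>kap\<close> is \<open>0\<close> there.
\<close>

definition sg :: "int \<Rightarrow> real" where "sg m = (if 0 \<le> m then 1 else - 1)"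
definition kap :: "int \<Rightarrow> nat \<Rightarrow> nat \<Rightarrow> real" where
  "kap m n k = (if m = 0 then 0 else sg m * K m n k $ 1 / K m n k $ 2)"
definition rho :: "int \<Rightarrow> nat \<Rightarrow> real" where
  "rho m n = sg m * K_infty K m n $ 1 / K_infty K m n $ 2"

lemma w_pos: "0 < w n k" and w_summable: "summable (w n)"
  using a_pos[of n k] a_summable[of n] by (auto simp: w_def[abs_def])

lemma sg_simps: "sg m * sg m = 1" "sg m * of_int m = of_int \<bar>m\<bar>" "of_int \<bar>m\<bar> * sg m = of_int m" "\<bar>sg m\<bar> = 1"
  by (auto simp: sg_def)

lemma K_facts:
  "K m n k = C_prod a c1 c2 m n k *v K m n 0"
  "0 < m \<Longrightarrow> 0 < K_infty K m n $ 1 \<and> 0 < K_infty K m n $ 2"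
  "m < 0 \<Longrightarrow> K_infty K m n $ 1 < 0 \<and> 0 < K_infty K m n $ 2"
  "K_infty K 0 n $ 1 = 0 \<and> K_infty K 0 n $ 2 \<noteq> 0"
proof -
  note K' = K[unfolded quantum_K_function_def]
  show "K m n k = C_prod a c1 c2 m n k *v K m n 0"
    by (rule conjunct1[OF K', rule_format])
  show "0 < m \<Longrightarrow> 0 < K_infty K m n $ 1 \<and> 0 < K_infty K m n $ 2"
    by (rule conjunct1[OF conjunct2[OF K'], rule_format])
  show "m < 0 \<Longrightarrow> K_infty K m n $ 1 < 0 \<and> 0 < K_infty K m n $ 2"
    by (rule conjunct1[OF conjunct2[OF conjunct2[OF K']], rule_format])
  show "K_infty K 0 n $ 1 = 0 \<and> K_infty K 0 n $ 2 \<noteq> 0"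
    by (rule conjunct1[OF conjunct2[OF conjunct2[OF conjunct2[OF K']]], rule_format])
qed

lemma K_rec:
  "K m n k $ 1 = c1 n k * K m n (Suc k) $ 1 + w (n + 1) k * (of_int m * K m n k $ 2)"
  "K m n (Suc k) $ 2 = c2 n k * K m n k $ 2 - w n (Suc k) * (of_int m * K m n (Suc k) $ 1)"
proof -
  have K': "K m n k = C_prod a c1 c2 m n k *v K m n 0" for k
    by (rule K_facts(1))
  have "K m n (Suc k) = C_mat a c1 c2 m n k *v K m n k"
    unfolding K'[of "Suc k"] K'[of k] by (simp add: matrix_vector_mul_assoc)
  then have K1: "K m n (Suc k) $ 1 = 1 / c1 n k * K m n k $ 1 + - of_int m / (a (n + 1) k * c1 n k) * K m n k $ 2"
    and K2: "K m n (Suc k) $ 2 = - of_int m / (a n (k + 1) * c1 n k) * K m n k $ 1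
       + (c2 n k + (of_int m)\<^sup>2 / (a n (k + 1) * a (n + 1) k * c1 n k)) * K m n k $ 2"
    by (simp_all add: C_mat_def matrix_vector_mult_def sum_2)
  show "K m n k $ 1 = c1 n k * K m n (Suc k) $ 1 + w (n + 1) k * (of_int m * K m n k $ 2)"
    unfolding K1 using c1[of n k] by (simp add: w_def algebra_simps)
  show "K m n (Suc k) $ 2 = c2 n k * K m n k $ 2 - w n (Suc k) * (of_int m * K m n (Suc k) $ 1)"
    unfolding K1 K2 by (simp add: w_def power2_eq_square algebra_simps)
qed

lemma K_convergent: "K m n \<longlonglongrightarrow> K_infty K m n"
proof -
  note conv = hyperbolic_recurrence_convergent[where x = "\<lambda>k. K m n k $ 2" and y = "\<lambda>k. K m n k $ 1" and m = "of_int m",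
    OF w_pos w_pos w_summable w_summable c1 c2 c1_prod c2_prod K_rec]
  obtain l1 where "(\<lambda>k. K m n k $ 1) \<longlonglongrightarrow> l1"
    using conv(2) unfolding convergent_def by (elim exE) (rule that)
  moreover obtain l2 where "(\<lambda>k. K m n k $ 2) \<longlonglongrightarrow> l2"
    using conv(1) unfolding convergent_def by (elim exE) (rule that)
  ultimately have "(\<lambda>k. K m n k $ i) \<longlonglongrightarrow> (vector [l1, l2] :: real^2) $ i" for i
    using exhaust_2[of i] by (elim disjE) simp_all
  then have "K m n \<longlonglongrightarrow> vector [l1, l2]"
    by (rule vec_tendstoI)
  then have "convergent (K m n)"
    by (auto simp: convergent_def)
  then show ?thesis
    by (simp add: K_infty_def convergent_LIMSEQ_iff)
qed

lemma K2_nonzero: "K_infty K m n $ 2 \<noteq> 0"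
  using K_facts(2)[of m n] K_facts(3)[of m n] K_facts(4)[of n] by (metis linorder_neqE_linordered_idom less_irrefl)

lemma K_positive:
  assumes "m \<noteq> 0"
  shows "0 < K m n k $ 2" "0 < sg m * K m n k $ 1"
proof -
  have "0 < K m n k $ 2 \<and> 0 < sg m * K m n k $ 1"
  proof (rule positive_limit_imp_positive[where x = "\<lambda>k. K m n k $ 2" and y = "\<lambda>k. sg m * K m n k $ 1"
        and m = "of_int \<bar>m\<bar>" and ?w0.0 = "w n" and ?w1.0 = "w (n + 1)" and ?c1.0 = "c1 n" and ?c2.0 = "c2 n"])
    show "sg m * K m n k $ 1 = c1 n k * (sg m * K m n (Suc k) $ 1) + w (n + 1) k * (of_int \<bar>m\<bar> * K m n k $ 2)" for k
      unfolding K_rec(1)[of m n k] sg_simps(2)[symmetric] by (simp add: algebra_simps)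
    show "K m n (Suc k) $ 2 = c2 n k * K m n k $ 2 - w n (Suc k) * (of_int \<bar>m\<bar> * (sg m * K m n (Suc k) $ 1))" for k
      unfolding K_rec(2)[of m n k] mult.assoc[symmetric] sg_simps(3) by simp
    show "(\<lambda>k. K m n k $ 2) \<longlonglongrightarrow> K_infty K m n $ 2" "(\<lambda>k. sg m * K m n k $ 1) \<longlonglongrightarrow> sg m * K_infty K m n $ 1"
      by (intro tendsto_intros K_convergent)+
    show "0 < K_infty K m n $ 2" "0 < sg m * K_infty K m n $ 1"
      using assms K_facts(2)[of m n] K_facts(3)[of m n] by (auto simp: sg_def neq_iff)
  qed (use w_pos c1 c2 in auto)
  then show "0 < K m n k $ 2" "0 < sg m * K m n k $ 1" by auto
qed

lemma rho_zero: "rho 0 n = 0"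
  by (simp add: rho_def K_facts(4))

lemma radial: "radial_problem (w n) (w (n + 1)) (c1 n) (c2 n) (kap m n) (of_int \<bar>m\<bar>) (rho m n) R"
proof (unfold_locales; (intro w_pos w_summable c1 c2 c1_prod c2_prod R)?)
  show "0 \<le> real_of_int \<bar>m\<bar>" by simp
  show "0 \<le> kap m n k" for k
    using K_positive[of m n k] by (auto simp: kap_def)
  show "kap m n \<longlonglongrightarrow> rho m n"
  proof (cases "m = 0")
    case True
    then show ?thesis by (simp add: rho_zero kap_def[abs_def])
  next
    case False
    then show ?thesis
      unfolding kap_def[abs_def] rho_def by (auto intro!: tendsto_intros K_convergent K2_nonzero)
  qed
  show "rho m n \<le> of_int \<bar>m\<bar> * R"
  proof (cases "m = 0")
    case True
    then show ?thesis by (simp add: rho_zero)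
  next
    case False
    have "rho m n \<le> \<bar>K_infty K m n $ 1 / K_infty K m n $ 2\<bar>"
      using abs_ge_self[of "K_infty K m n $ 1 / K_infty K m n $ 2"]
        abs_ge_minus_self[of "K_infty K m n $ 1 / K_infty K m n $ 2"]
      by (cases "0 \<le> m") (simp_all add: rho_def sg_def del: abs_divide)
    also have "\<dots> \<le> 1 * R"
      using K_quot[OF False] by simp
    also have "\<dots> \<le> of_int \<bar>m\<bar> * R"
      using R False by (intro mult_right_mono) auto
    finally show ?thesis .
  qed
  show "kap m n k = c1 n k * c2 n k * kap m n (Suc k) / (1 + of_int \<bar>m\<bar> * w n (Suc k) * kap m n (Suc k))
        + of_int \<bar>m\<bar> * w (n + 1) k" for k
  proof (cases "m = 0")
    case True
    then show ?thesis by (simp add: kap_def)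
  next
    case False
    define X where "X k = K m n k $ 2" for k
    define Y where "Y k = sg m * K m n k $ 1" for k
    have pos: "0 < X k" "0 < Y k" for k
      using K_positive[OF False] by (auto simp: X_def Y_def)
    have "X (Suc k) = c2 n k * X k - w n (Suc k) * (of_int \<bar>m\<bar> * Y (Suc k))"
      unfolding X_def Y_def K_rec(2)[of m n k] mult.assoc[symmetric] sg_simps(3) by simp
    then have X: "c2 n k * X k = X (Suc k) * (1 + of_int \<bar>m\<bar> * w n (Suc k) * (Y (Suc k) / X (Suc k)))"
      using pos(1)[of "Suc k"] by (simp add: field_simps)
    have Y: "Y k = c1 n k * Y (Suc k) + w (n + 1) k * (of_int \<bar>m\<bar> * X k)"
      unfolding X_def Y_def K_rec(1)[of m n k] sg_simps(2)[symmetric] by (simp add: algebra_simps)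
    define d where "d = 1 + of_int \<bar>m\<bar> * w n (Suc k) * (Y (Suc k) / X (Suc k))"
    have d: "0 < d"
      unfolding d_def using pos[of "Suc k"] w_pos[of n "Suc k"]
      by (intro add_pos_nonneg mult_nonneg_nonneg divide_nonneg_nonneg) (auto simp: less_imp_le)
    have "c1 n k * c2 n k * (Y (Suc k) / X (Suc k)) / d = c1 n k * (Y (Suc k) * (c2 n k * X k) / (X (Suc k) * d * X k))"
      using pos(1)[of k] pos(1)[of "Suc k"] d by (simp add: field_simps)
    also have "\<dots> = c1 n k * Y (Suc k) / X k"
      unfolding X d_def[symmetric] using pos(1)[of k] pos(1)[of "Suc k"] d by simp
    finally have "Y k / X k = c1 n k * c2 n k * (Y (Suc k) / X (Suc k)) / d + of_int \<bar>m\<bar> * w (n + 1) k"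
      using pos(1)[of k] by (subst Y) (simp add: add_divide_distrib)
    moreover have "kap m n k = Y k / X k" for k
      using False by (simp add: kap_def X_def Y_def)
    ultimately show ?thesis
      by (simp add: d_def)
  qed
qed

section \<open>The Dirac operator in radial components\<close>

text \<open>
  The sign of the equations in a component: the \<open>-\<close> parts satisfy the equations of the \<open>+\<close> parts with
  the two right-hand sides exchanged and negated.
\<close>

definition side :: "int \<Rightarrow> complex" where "side j = (if 1 \<le> j then 1 else - 1)"

lemma cmod_side: "cmod (side j) = 1"
  by (simp add: side_def)

lemma Dirac_parts:
  "xpart (Dirac a c1 c2 F) m j k =
     side j * (of_int m * xpart F m j k - Bbar_op a c1 (rad j) (ypart F m j) k)"
  "ypart (Dirac a c1 c2 F) m j k =
     side j * (- B_op a c2 (rad j) (xpart F m j) k - of_int m * ypart F m j k)"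
proof -
  have i: "int (nat (j - 1)) = j - 1" "int (nat (j - 1) + 1) = j" if "1 \<le> j"
    using that by auto
  have i': "- int (nat (- j)) = j" "- int (nat (- j) + 1) = j - 1" "nat (- (j - 1) - 1) = nat (- j)" if "\<not> 1 \<le> j"
    using that by auto
  have e: "coeff_plus f m n = f m (int n)" "coeff_minus f m n = f m (- int n)" for f n
    by (auto simp: coeff_plus_def coeff_minus_def fun_eq_iff)
  show "xpart (Dirac a c1 c2 F) m j k =
     side j * (of_int m * xpart F m j k - Bbar_op a c1 (rad j) (ypart F m j) k)"
    by (cases "1 \<le> j")
      (simp_all add: Dirac_def xpart_def ypart_def rad_def side_def delta0_def delta1_def delta2_def e i i' del: of_nat_add)
  show "ypart (Dirac a c1 c2 F) m j k =
     side j * (- B_op a c2 (rad j) (xpart F m j) k - of_int m * ypart F m j k)"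
    by (cases "1 \<le> j")
      (simp_all add: Dirac_def xpart_def ypart_def rad_def side_def delta0_def delta1_def delta2_def e i i' del: of_nat_add)
qed

end

section \<open>Sums over components and algebra of the equations\<close>

lemma sum_by_blocks:
  fixes h :: "int \<times> int \<times> nat \<Rightarrow> real"
  assumes "finite J"
  shows "sum h J = (\<Sum>(m, j)\<in>(\<lambda>(m, j, k). (m, j)) ` J. \<Sum>k\<in>{k. (m, j, k) \<in> J}. h (m, j, k))"
proof -
  let ?b = "\<lambda>(m :: int, j :: int, k :: nat). (m, j)"
  have "sum h J = (\<Sum>b\<in>?b ` J. sum h {i \<in> J. ?b i = b})"
    by (rule sum.image_gen[OF assms])
  also have "\<dots> = (\<Sum>(m, j)\<in>?b ` J. \<Sum>k\<in>{k. (m, j, k) \<in> J}. h (m, j, k))"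
  proof (rule sum.cong[OF refl], clarify)
    fix m j :: int
    have "{i \<in> J. ?b i = (m, j)} = (\<lambda>k. (m, j, k)) ` {k. (m, j, k) \<in> J}"
      by auto
    then show "sum h {i \<in> J. ?b i = (m, j)} = (\<Sum>k\<in>{k. (m, j, k) \<in> J}. h (m, j, k))"
      by (simp add: sum.reindex inj_on_def)
  qed
  finally show ?thesis .
qed

lemma finite_fibre: "finite J \<Longrightarrow> finite {k. (m, j, k) \<in> J}"
  for J :: "(int \<times> int \<times> nat) set"
  by (rule finite_subset[of _ "(snd \<circ> snd) ` J"]) force+

text \<open>
  In these two equivalences \<open>i\<close> is the reciprocal of \<open>A\<close>, \<open>s\<close> the sign of \<open>m\<close> and \<open>t\<close> the
  sign of the component; \<open>e\<close> stands for the contribution of the preceding index, which is absent at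
  \<open>k = 0\<close>.
\<close>

lemma backward_equation_iff:
  fixes A i s t m x y y' c G :: complex
  assumes "A * i = 1" "s * s = 1" "t * t = 1"
  shows "t * (m * x - A * (y - c * y')) = G \<longleftrightarrow> s * y = c * (s * y') + i * (s * m * x - s * t * G)"
proof
  assume "t * (m * x - A * (y - c * y')) = G"
  with assms show "s * y = c * (s * y') + i * (s * m * x - s * t * G)" by algebra
next
  assume "s * y = c * (s * y') + i * (s * m * x - s * t * G)"
  with assms show "t * (m * x - A * (y - c * y')) = G" by algebra
qed

lemma forward_equation_iff:
  fixes A i s t m x y e G :: complex
  assumes "A * i = 1" "s * s = 1" "t * t = 1"
  shows "t * (- (A * (x - e)) - m * y) = G \<longleftrightarrow> x = e - i * (s * m * (s * y) + t * G)"
proof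
  assume "t * (- (A * (x - e)) - m * y) = G"
  with assms show "x = e - i * (s * m * (s * y) + t * G)" by algebra
next
  assume "x = e - i * (s * m * (s * y) + t * G)"
  with assms show "t * (- (A * (x - e)) - m * y) = G" by algebra
qed

section \<open>Solving the Dirac equation\<close>

context dirac_problem
begin

abbreviation solves where
  "solves m n \<equiv> radial_problem.solves (w n) (w (n + 1)) (c1 n) (c2 n) (of_int \<bar>m\<bar>)"

abbreviation energy_le where
  "energy_le n \<equiv> radial_problem.energy_le (w n) (w (n + 1))"

abbreviation profile where
  "profile m n \<equiv> radial_problem.profile (w n) (w (n + 1)) (c1 n) (c2 n) (kap m n) (of_int \<bar>m\<bar>) R"

definition component :: "series \<times> series \<Rightarrow> series \<times> series \<Rightarrow> int \<Rightarrow> int \<Rightarrow> bool" where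
  "component F G m j \<longleftrightarrow>
     solves m (rad j) (xpart F m j) (\<lambda>k. of_real (sg m) * ypart F m j k)
       (\<lambda>k. of_real (sg m) * side j * xpart G m j k) (\<lambda>k. side j * ypart G m j k)"

text \<open>
  The condition at infinity as the vanishing of the combination that contracts backward. Unlike a
  condition on the two separate limits, it presupposes no convergence.
\<close>

definition boundary :: "series \<times> series \<Rightarrow> int \<Rightarrow> int \<Rightarrow> bool" where
  "boundary F m j \<longleftrightarrow>
     (\<lambda>k. of_real (sg m) * ypart F m j k - of_real (kap m (rad j) k) * xpart F m j k) \<longlonglongrightarrow> 0"

definition solution :: "series \<times> series \<Rightarrow> series \<times> series \<Rightarrow> bool" where
  "solution F G \<longleftrightarrow> F \<in> H a \<and> G \<in> H a \<and> (\<forall>m j. component F G m j \<and> boundary F m j)"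

lemma Dirac_eq_iff: "Dirac a c1 c2 F = G \<longleftrightarrow> (\<forall>m j. component F G m j)"
proof -
  have "Dirac a c1 c2 F = G \<longleftrightarrow>
     (\<forall>m j. (\<forall>k. xpart (Dirac a c1 c2 F) m j k = xpart G m j k) \<and>
            (\<forall>k. ypart (Dirac a c1 c2 F) m j k = ypart G m j k))"
    using parts_eqI[of "Dirac a c1 c2 F" G] by (auto simp: fun_eq_iff)
  also have "\<dots> \<longleftrightarrow> (\<forall>m j. component F G m j)"
  proof (intro all_cong1)
    fix m j
    define n where "n = rad j"
    define x where "x = xpart F m j"
    define y where "y = ypart F m j"
    define P where "P = xpart G m j"
    define Q where "Q = ypart G m j"
    have inv: "complex_of_real (a l k) * of_real (w l k) = 1" for l k
      using a_pos[of l k] by (simp add: w_def)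
    have s: "complex_of_real (sg m) * of_real (sg m) = 1" "side j * side j = 1"
      by (simp_all add: sg_def side_def)
    have M: "complex_of_real (of_int \<bar>m\<bar>) = of_real (sg m) * of_int m"
      by (simp add: sg_def)
    have X: "xpart (Dirac a c1 c2 F) m j k = P k \<longleftrightarrow> of_real (sg m) * y k =
        of_real (c1 n k) * (of_real (sg m) * y (Suc k)) +
        of_real (w (n + 1) k) * (of_real (sg m) * of_int m * x k - of_real (sg m) * side j * P k)" for k
      unfolding Dirac_parts Bbar_op_def
      using backward_equation_iff[OF inv[of "n + 1" k] s, of "of_int m" "x k" "y k" "of_real (c1 n k)" "y (Suc k)" "P k"]
      by (simp add: n_def x_def y_def)
    have Y0: "ypart (Dirac a c1 c2 F) m j 0 = Q 0 \<longleftrightarrow>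
        x 0 = 0 - of_real (w n 0) * (of_real (sg m) * of_int m * (of_real (sg m) * y 0) + side j * Q 0)"
      unfolding Dirac_parts B_op_def
      using forward_equation_iff[OF inv[of n 0] s, of "x 0" 0 "of_int m" "y 0" "Q 0"]
      by (simp add: n_def x_def y_def)
    have YS: "ypart (Dirac a c1 c2 F) m j (Suc k) = Q (Suc k) \<longleftrightarrow>
        x (Suc k) = of_real (c2 n k) * x k -
          of_real (w n (Suc k)) * (of_real (sg m) * of_int m * (of_real (sg m) * y (Suc k)) + side j * Q (Suc k))" for k
      unfolding Dirac_parts B_op_def
      using forward_equation_iff[OF inv[of n "Suc k"] s, of "x (Suc k)" "of_real (c2 n k) * x k" "of_int m" "y (Suc k)" "Q (Suc k)"]
      by (simp add: n_def x_def y_def)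
    have all: "(\<forall>k. T k) \<longleftrightarrow> T 0 \<and> (\<forall>k. T (Suc k))" for T :: "nat \<Rightarrow> bool"
      by (metis not0_implies_Suc)
    show "(\<forall>k. xpart (Dirac a c1 c2 F) m j k = xpart G m j k) \<and>
          (\<forall>k. ypart (Dirac a c1 c2 F) m j k = ypart G m j k) \<longleftrightarrow> component F G m j"
      unfolding component_def radial_problem.solves_def[OF radial] M
      unfolding n_def[symmetric] x_def[symmetric] y_def[symmetric] P_def[symmetric] Q_def[symmetric]
      unfolding all[of "\<lambda>k. ypart (Dirac a c1 c2 F) m j k = Q k"] X Y0 YS
      by (simp only: diff_0 mult_minus_left)
  qed
  finally show ?thesis .
qed

lemma dom_Dirac_iff:
  "F \<in> dom_Dirac a c1 c2 K \<longleftrightarrow> F \<in> H a \<and> Dirac a c1 c2 F \<in> H a \<and>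
     (\<forall>m j. \<exists>\<beta>. lim (ypart F m j) = \<beta> * of_real (K_infty K m (rad j) $ 1) \<and>
               lim (xpart F m j) = \<beta> * of_real (K_infty K m (rad j) $ 2))"
proof -
  obtain f g where F: "F = (f, g)" by (cases F)
  define BC where "BC n m Y X \<longleftrightarrow> (\<exists>\<beta>. lim Y = \<beta> * of_real (K_infty K m n $ 1) \<and>
     lim X = \<beta> * of_real (K_infty K m n $ 2))" for n m and X Y :: "nat \<Rightarrow> complex"
  have plus: "coeff_plus g m n = ypart F m (int n + 1)" "coeff_plus f m (n + 1) = xpart F m (int n + 1)"
    "rad (int n + 1) = n" for m n
    by (auto simp: F coeff_plus_def xpart_def ypart_def rad_def fun_eq_iff add.commute)
  have minus: "coeff_minus f m n = ypart F m (- int n)" "coeff_minus g m (n + 1) = xpart F m (- int n)"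
    "rad (- int n) = n" for m n
  proof -
    have e: "- int (n + 1) = - int n - 1" by simp
    show "coeff_minus g m (n + 1) = xpart F m (- int n)"
      unfolding coeff_minus_def e by (simp add: F xpart_def fun_eq_iff)
  qed (auto simp: F coeff_minus_def xpart_def ypart_def rad_def fun_eq_iff)
  have "(\<forall>m n. BC n m (coeff_plus g m n) (coeff_plus f m (n + 1)) \<and>
               BC n m (coeff_minus f m n) (coeff_minus g m (n + 1)))
      \<longleftrightarrow> (\<forall>m j. BC (rad j) m (ypart F m j) (xpart F m j))" (is "?L \<longleftrightarrow> ?R")
  proof
    assume ?L
    show ?R
    proof (intro allI)
      fix m j
      have "j = int (rad j) + 1 \<or> j = - int (rad j)"
        by (auto simp: rad_def)
      moreover have "BC (rad j) m (ypart F m (int (rad j) + 1)) (xpart F m (int (rad j) + 1))"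
        using \<open>?L\<close> unfolding plus by blast
      moreover have "BC (rad j) m (ypart F m (- int (rad j))) (xpart F m (- int (rad j)))"
        using \<open>?L\<close> unfolding minus by blast
      ultimately show "BC (rad j) m (ypart F m j) (xpart F m j)"
        by metis
    qed
  next
    assume R: ?R
    show ?L
    proof (intro allI conjI)
      fix m n
      show "BC n m (coeff_plus g m n) (coeff_plus f m (n + 1))"
        using R[rule_format, of "int n + 1" m] unfolding plus .
      show "BC n m (coeff_minus f m n) (coeff_minus g m (n + 1))"
        using R[rule_format, of "- int n" m] unfolding minus .
    qed
  qed
  then show ?thesis
    unfolding BC_def dom_Dirac_def F by simp
qed

lemma sum_component_le_hnorm:
  assumes "F \<in> H a"
  shows "(\<Sum>k<N. (norm (coord a F (m, j, k)))\<^sup>2) \<le> (hnorm a F)\<^sup>2"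
proof -
  have "(\<Sum>k<N. (norm (coord a F (m, j, k)))\<^sup>2) = (\<Sum>i\<in>(\<lambda>k. (m, j, k)) ` {..<N}. (norm (coord a F i))\<^sup>2)"
    by (simp add: sum.reindex inj_on_def)
  also have "\<dots> \<le> (hnorm a F)\<^sup>2"
    by (rule sum_coord_le[OF assms]) simp
  finally show ?thesis .
qed

definition block_energy :: "series \<times> series \<Rightarrow> int \<Rightarrow> int \<Rightarrow> real" where
  "block_energy G m j = (\<Sum>k. (norm (coord a G (m, j, k)))\<^sup>2)"

lemma block_summable: "G \<in> H a \<Longrightarrow> summable (\<lambda>k. (norm (coord a G (m, j, k)))\<^sup>2)"
  by (rule summableI_nonneg_bounded[OF _ sum_component_le_hnorm]) simp_all

lemma block_energy_nonneg: "G \<in> H a \<Longrightarrow> 0 \<le> block_energy G m j"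
  unfolding block_energy_def by (rule suminf_nonneg[OF block_summable]) simp_all

lemma sum_block_energy:
  assumes G: "G \<in> H a" and B: "finite B"
  shows "(\<Sum>(m, j)\<in>B. block_energy G m j) \<le> (hnorm a G)\<^sup>2"
proof (rule LIMSEQ_le_const2)
  show "(\<lambda>N. \<Sum>(m, j)\<in>B. \<Sum>k<N. (norm (coord a G (m, j, k)))\<^sup>2) \<longlonglongrightarrow> (\<Sum>(m, j)\<in>B. block_energy G m j)"
    unfolding block_energy_def case_prod_unfold
    by (intro tendsto_sum summable_LIMSEQ block_summable[OF G])
  have "(\<Sum>(m, j)\<in>B. \<Sum>k<N. (norm (coord a G (m, j, k)))\<^sup>2) \<le> (hnorm a G)\<^sup>2" for N
  proof -
    have "(\<Sum>(m, j)\<in>B. \<Sum>k<N. (norm (coord a G (m, j, k)))\<^sup>2)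
        = (\<Sum>(b, k)\<in>B \<times> {..<N}. (norm (coord a G (fst b, snd b, k)))\<^sup>2)"
      by (subst sum.cartesian_product[symmetric]) (simp add: case_prod_unfold)
    also have "\<dots> = (\<Sum>i\<in>(\<lambda>(b, k). (fst b, snd b, k)) ` (B \<times> {..<N}). (norm (coord a G i))\<^sup>2)"
      by (subst sum.reindex) (auto simp: inj_on_def case_prod_unfold prod_eq_iff)
    also have "\<dots> \<le> (hnorm a G)\<^sup>2"
      by (rule sum_coord_le[OF G]) (use B in simp)
    finally show ?thesis .
  qed
  then show "\<exists>M. \<forall>N\<ge>M. (\<Sum>(m, j)\<in>B. \<Sum>k<N. (norm (coord a G (m, j, k)))\<^sup>2) \<le> (hnorm a G)\<^sup>2"
    by blast
qed

lemma energy_le_iff: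
  assumes "\<And>k. cmod (x k) = cmod (xpart F m j k)" "\<And>k. cmod (y k) = cmod (ypart F m j k)"
  shows "energy_le (rad j) x y E \<longleftrightarrow> (\<forall>N. (\<Sum>k<N. (norm (coord a F (m, j, k)))\<^sup>2) \<le> E)"
  unfolding radial_problem.energy_le_def[OF radial] norm_coord assms w_def by simp

lemma source_energy:
  assumes "G \<in> H a"
  shows "energy_le (rad j) (\<lambda>k. of_real (sg m) * side j * xpart G m j k) (\<lambda>k. side j * ypart G m j k)
     (block_energy G m j)"
proof (subst energy_le_iff)
  show "\<forall>N. (\<Sum>k<N. (norm (coord a G (m, j, k)))\<^sup>2) \<le> block_energy G m j"
    unfolding block_energy_def by (intro allI sum_le_suminf block_summable assms) simp_all
qed (simp_all add: norm_mult cmod_side sg_simps)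

lemma solution_energy:
  "energy_le (rad j) (xpart F m j) (\<lambda>k. of_real (sg m) * ypart F m j k) E \<longleftrightarrow>
     (\<forall>N. (\<Sum>k<N. (norm (coord a F (m, j, k)))\<^sup>2) \<le> E)"
  by (rule energy_le_iff) (simp_all add: norm_mult sg_simps)

lemma pointwise_bound:
  assumes "component F G m j" "boundary F m j" "G \<in> H a"
  shows "(norm (coord a F (m, j, k)))\<^sup>2 \<le> profile m (rad j) k * block_energy G m j"
proof -
  have "w (rad j + 1) k * (cmod (xpart F m j k))\<^sup>2 + w (rad j) k * (cmod (of_real (sg m) * ypart F m j k))\<^sup>2
      \<le> profile m (rad j) k * block_energy G m j"
    by (rule radial_problem.solution_bound[OF radial assms(1)[unfolded component_def] source_energy[OF assms(3)]
          assms(2)[unfolded boundary_def]])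
  then show ?thesis
    by (simp add: norm_coord w_def norm_mult sg_simps)
qed

definition gain :: "nat \<Rightarrow> real" where "gain n = 16 * (s n * (s (n + 1) + R))"

lemma component_bound:
  assumes "component F G m j" "boundary F m j" "G \<in> H a"
  shows "(\<Sum>k<N. (norm (coord a F (m, j, k)))\<^sup>2) \<le> gain (rad j) * block_energy G m j"
proof -
  have "(\<Sum>k<N. (norm (coord a F (m, j, k)))\<^sup>2) \<le> (\<Sum>k<N. profile m (rad j) k * block_energy G m j)"
    by (intro sum_mono pointwise_bound assms)
  also have "\<dots> = (\<Sum>k<N. profile m (rad j) k) * block_energy G m j"
    by (rule sum_distrib_right[symmetric])
  also have "\<dots> \<le> gain (rad j) * block_energy G m j"
    using radial_problem.sum_profile[OF radial, of "rad j" m N]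
    unfolding radial_problem.S1_def[OF radial] gain_def s_def
    by (rule mult_right_mono[OF _ block_energy_nonneg[OF assms(3)]])
  finally show ?thesis .
qed

lemma gain_tendsto: "gain \<longlonglongrightarrow> 0"
proof -
  have s: "s \<longlonglongrightarrow> 0"
    using a_lim by (simp add: s_def[abs_def] w_def[abs_def])
  have "(\<lambda>n. 16 * (s n * (s (n + 1) + R))) \<longlonglongrightarrow> 16 * (0 * (0 + R))"
    using LIMSEQ_Suc[OF s] by (intro tendsto_intros s) simp
  then show ?thesis
    by (simp add: gain_def[abs_def])
qed

lemma gain_bounded: "\<exists>C>0. \<forall>n. gain n \<le> C"
proof -
  have "Bseq gain"
    using gain_tendsto by (intro convergent_imp_Bseq) (auto simp: convergent_def)
  then obtain C where "0 < C" "\<And>n. norm (gain n) \<le> C"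
    by (auto elim!: BseqE)
  then show ?thesis
    by (intro exI[of _ C]) (auto simp: abs_le_iff)
qed

lemma component_bound_high_frequency:
  assumes "component F G m j" "boundary F m j" "G \<in> H a" "m \<noteq> 0"
  shows "(\<Sum>k<N. (norm (coord a F (m, j, k)))\<^sup>2)
     \<le> 1 / (prodinf (c1 (rad j)) * prodinf (c2 (rad j)) * (of_int \<bar>m\<bar>)\<^sup>2) * block_energy G m j"
proof -
  have "energy_le (rad j) (xpart F m j) (\<lambda>k. of_real (sg m) * ypart F m j k) (gain (rad j) * block_energy G m j)"
    unfolding solution_energy using component_bound[OF assms(1-3)] by blast
  then have "energy_le (rad j) (xpart F m j) (\<lambda>k. of_real (sg m) * ypart F m j k)
     (block_energy G m j / (prodinf (c1 (rad j)) * prodinf (c2 (rad j)) * (of_int \<bar>m\<bar>)\<^sup>2))"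
    using assms(4)
    by (intro radial_problem.high_frequency_bound[OF radial _ assms(1)[unfolded component_def]
          source_energy[OF assms(3)] _ assms(2)[unfolded boundary_def]]) simp_all
  then show ?thesis
    unfolding solution_energy by simp
qed

text \<open>
  For large radial index the gain is small uniformly in \<open>m\<close>, since \<open>s n\<close> tends to \<open>0\<close>. For each of
  the remaining radial indices the high frequency bound leaves finitely many \<open>m\<close>. Neither bound
  covers both regimes: the first one does not decay in \<open>m\<close>, and the constant of the second one may
  blow up with the radial index.
\<close>

lemma small_components:
  assumes \<delta>: "0 < \<delta>"
  shows "\<exists>B. finite B \<and> (\<forall>m j F G N. (m, j) \<notin> B \<longrightarrow> component F G m j \<longrightarrow> boundary F m j \<longrightarrow> G \<in> H a \<longrightarrow>
     (\<Sum>k<N. (norm (coord a F (m, j, k)))\<^sup>2) \<le> \<delta> * block_energy G m j)"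
proof -
  obtain n0 where n0: "\<And>n. n \<ge> n0 \<Longrightarrow> gain n \<le> \<delta>"
    using order_tendstoD(2)[OF gain_tendsto \<delta>] unfolding eventually_sequentially by (meson less_imp_le)
  define p where "p n = prodinf (c1 n) * prodinf (c2 n)" for n
  have p: "0 < p n" for n
    unfolding p_def by (intro mult_pos_pos prod_lessThan_bounds(1) c1 c2 c1_prod c2_prod)
  (* Beyond M the high frequency constant is below \<delta> for all radial indices n < n0, because m^2 >= \<bar>m\<bar>. *)
  define M where "M = \<lceil>\<Sum>n<n0. 1 / (p n * \<delta>)\<rceil>"
  have M: "1 / (p n * \<delta>) \<le> of_int M" if "n < n0" for n
  proof -
    have "1 / (p n * \<delta>) \<le> (\<Sum>n<n0. 1 / (p n * \<delta>))"
      using that p \<delta> by (intro member_le_sum) (simp_all add: less_imp_le)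
    also have "\<dots> \<le> of_int M"
      by (simp add: M_def)
    finally show ?thesis .
  qed
  define B where "B = {- M..M} \<times> {- int n0..int n0}"
  have "(\<Sum>k<N. (norm (coord a F (m, j, k)))\<^sup>2) \<le> \<delta> * block_energy G m j"
    if mj: "(m, j) \<notin> B" and FG: "component F G m j" "boundary F m j" "G \<in> H a" for m j F G N
  proof (cases "rad j \<ge> n0")
    case True
    then show ?thesis
      using component_bound[OF FG, of N] mult_right_mono[OF n0[OF True] block_energy_nonneg[OF FG(3), of m j]]
      by linarith
  next
    case False
    then have "- int n0 \<le> j" "j \<le> int n0"
      by (auto simp: rad_def split: if_splits)
    with mj have m: "\<bar>m\<bar> > M"
      by (auto simp: B_def)
    have Mp: "0 < 1 / (p (rad j) * \<delta>)"
      using p \<delta> by simp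
    have Mm: "1 / (p (rad j) * \<delta>) < of_int \<bar>m\<bar>"
      using M[of "rad j"] m False by linarith
    then have "m \<noteq> 0"
      using Mp by auto
    then have "1 \<le> \<bar>m\<bar>" by simp
    then have "(of_int \<bar>m\<bar> :: real) * 1 \<le> of_int \<bar>m\<bar> * of_int \<bar>m\<bar>"
      by (intro mult_left_mono) linarith+
    then have "1 / (p (rad j) * \<delta>) \<le> (of_int \<bar>m\<bar>)\<^sup>2"
      using Mm by (simp only: power2_eq_square)
    then have "1 \<le> (of_int \<bar>m\<bar>)\<^sup>2 * (p (rad j) * \<delta>)"
      using p[of "rad j"] \<delta> by (simp only: pos_divide_le_eq mult_pos_pos)
    then have "1 / (p (rad j) * (of_int \<bar>m\<bar>)\<^sup>2) \<le> \<delta>"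
      using p[of "rad j"] \<open>m \<noteq> 0\<close> by (subst pos_divide_le_eq) (simp_all add: mult_ac)
    then have "1 / (p (rad j) * (of_int \<bar>m\<bar>)\<^sup>2) * block_energy G m j \<le> \<delta> * block_energy G m j"
      by (rule mult_right_mono[OF _ block_energy_nonneg[OF FG(3)]])
    then show ?thesis
      using component_bound_high_frequency[OF FG \<open>m \<noteq> 0\<close>, of N] unfolding p_def by linarith
  qed
  then show ?thesis
    by (intro exI[of _ B]) (auto simp: B_def)
qed

text \<open>
  Both sides say that \<open>y(\<infinity>)\<close> is \<open>K\<^sup>1(\<infinity>) / K\<^sup>2(\<infinity>)\<close> times \<open>x(\<infinity>)\<close>; the quotient makes sense
  because \<open>K\<^sup>2(\<infinity>)\<close> is never \<open>0\<close>.
\<close>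

lemma boundary_iff:
  assumes "convergent (xpart F m j)" "convergent (ypart F m j)"
  shows "boundary F m j \<longleftrightarrow> (\<exists>\<beta>. lim (ypart F m j) = \<beta> * of_real (K_infty K m (rad j) $ 1) \<and>
               lim (xpart F m j) = \<beta> * of_real (K_infty K m (rad j) $ 2))"
proof -
  define x where "x = lim (xpart F m j)"
  define y where "y = lim (ypart F m j)"
  define k1 where "k1 = complex_of_real (K_infty K m (rad j) $ 1)"
  define k2 where "k2 = complex_of_real (K_infty K m (rad j) $ 2)"
  have k2: "k2 \<noteq> 0"
    by (simp add: k2_def K2_nonzero)
  define \<epsilon> where "\<epsilon> = complex_of_real (sg m)"
  have \<epsilon>: "\<epsilon> * \<epsilon> = 1"
    by (simp add: \<epsilon>_def sg_def)
  have r: "complex_of_real (rho m (rad j)) = \<epsilon> * k1 / k2"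
    by (simp add: rho_def \<epsilon>_def k1_def k2_def)
  have lim: "(\<lambda>k. of_real (sg m) * ypart F m j k - of_real (kap m (rad j) k) * xpart F m j k)
     \<longlonglongrightarrow> of_real (sg m) * y - of_real (rho m (rad j)) * x"
    using assms unfolding x_def y_def convergent_LIMSEQ_iff
    by (intro tendsto_intros radial_problem.kap_lim[OF radial])
  have "boundary F m j \<longleftrightarrow> of_real (sg m) * y - of_real (rho m (rad j)) * x = 0"
  proof
    assume "boundary F m j"
    then show "of_real (sg m) * y - of_real (rho m (rad j)) * x = 0"
      unfolding boundary_def by (rule LIMSEQ_unique[OF lim])
  next
    assume "of_real (sg m) * y - of_real (rho m (rad j)) * x = 0"
    with lim show "boundary F m j"
      unfolding boundary_def by (simp only:)
  qed
  then have "boundary F m j \<longleftrightarrow> \<epsilon> * y - \<epsilon> * k1 / k2 * x = 0"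
    unfolding r \<epsilon>_def[symmetric] .
  also have "\<dots> \<longleftrightarrow> (\<exists>\<beta>. y = \<beta> * k1 \<and> x = \<beta> * k2)"
  proof
    assume "\<epsilon> * y - \<epsilon> * k1 / k2 * x = 0"
    then have "\<epsilon> * (\<epsilon> * y) = \<epsilon> * (\<epsilon> * k1 / k2 * x)"
      by simp
    then have "y = x / k2 * k1"
      unfolding mult.assoc[symmetric] \<epsilon> times_divide_eq_right by (simp add: \<epsilon> mult.commute)
    moreover have "x = x / k2 * k2"
      using k2 by simp
    ultimately show "\<exists>\<beta>. y = \<beta> * k1 \<and> x = \<beta> * k2" by blast
  qed (use k2 in auto)
  finally show ?thesis
    by (simp only: x_def y_def k1_def k2_def)
qed

lemma component_convergent:
  assumes "F \<in> H a" "G \<in> H a" "component F G m j"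
  shows "convergent (xpart F m j)" "convergent (ypart F m j)"
proof -
  have "energy_le (rad j) (xpart F m j) (\<lambda>k. of_real (sg m) * ypart F m j k) ((hnorm a F)\<^sup>2)"
    unfolding solution_energy using sum_component_le_hnorm[OF assms(1)] by blast
  note conv = radial_problem.solution_convergent[OF radial assms(3)[unfolded component_def] source_energy[OF assms(2)] this]
  show "convergent (xpart F m j)"
    by (rule conv(1))
  have "convergent (\<lambda>k. of_real (sg m) * (of_real (sg m) * ypart F m j k))"
    by (intro convergent_mult convergent_const conv(2))
  then show "convergent (ypart F m j)"
    by (simp add: mult.assoc[symmetric] of_real_mult[symmetric] sg_simps del: of_real_mult)
qed

lemma solution_iff: "solution F G \<longleftrightarrow> F \<in> dom_Dirac a c1 c2 K \<and> Dirac a c1 c2 F = G"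
proof
  assume S: "solution F G"
  then have D: "Dirac a c1 c2 F = G"
    by (simp add: Dirac_eq_iff solution_def)
  have "\<exists>\<beta>. lim (ypart F m j) = \<beta> * of_real (K_infty K m (rad j) $ 1) \<and>
               lim (xpart F m j) = \<beta> * of_real (K_infty K m (rad j) $ 2)" for m j
    using S boundary_iff[OF component_convergent[of F G m j]] unfolding solution_def by blast
  then show "F \<in> dom_Dirac a c1 c2 K \<and> Dirac a c1 c2 F = G"
    unfolding dom_Dirac_iff D using S D by (auto simp: solution_def)
next
  assume R: "F \<in> dom_Dirac a c1 c2 K \<and> Dirac a c1 c2 F = G"
  then have FG: "F \<in> H a" "G \<in> H a"
    by (auto simp: dom_Dirac_iff)
  have c: "component F G m j" for m j
    using R Dirac_eq_iff by blast
  have "boundary F m j" for m j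
    using R boundary_iff[OF component_convergent[OF FG c]] unfolding dom_Dirac_iff by blast
  with FG c show "solution F G"
    by (simp add: solution_def)
qed

lemma bound_by_blocks:
  assumes G: "G \<in> H a" and C: "0 \<le> C" and J: "finite J"
    and le: "\<And>m j. (\<Sum>k\<in>{k. (m, j, k) \<in> J}. (norm (coord a F (m, j, k)))\<^sup>2) \<le> C * block_energy G m j"
  shows "(\<Sum>i\<in>J. (norm (coord a F i))\<^sup>2) \<le> C * (hnorm a G)\<^sup>2"
proof -
  let ?B = "(\<lambda>(m, j, k). (m, j)) ` J"
  have "(\<Sum>i\<in>J. (norm (coord a F i))\<^sup>2) = (\<Sum>(m, j)\<in>?B. \<Sum>k\<in>{k. (m, j, k) \<in> J}. (norm (coord a F (m, j, k)))\<^sup>2)"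
    by (rule sum_by_blocks[OF J])
  also have "\<dots> \<le> (\<Sum>(m, j)\<in>?B. C * block_energy G m j)"
    by (intro sum_mono) (auto intro: le)
  also have "\<dots> = C * (\<Sum>(m, j)\<in>?B. block_energy G m j)"
    by (simp add: sum_distrib_left case_prod_unfold)
  also have "\<dots> \<le> C * (hnorm a G)\<^sup>2"
    using J by (intro mult_left_mono sum_block_energy[OF G] C) simp
  finally show ?thesis .
qed

lemma sum_fibre_le:
  fixes J :: "(int \<times> int \<times> nat) set"
  assumes J: "finite J" and le: "\<And>N. (\<Sum>k<N. (norm (coord a F (m, j, k)))\<^sup>2) \<le> E"
  shows "(\<Sum>k\<in>{k. (m, j, k) \<in> J}. (norm (coord a F (m, j, k)))\<^sup>2) \<le> E"
proof -
  obtain N where "{k. (m, j, k) \<in> J} \<subseteq> {..<N}"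
    using iffD1[OF finite_nat_iff_bounded finite_fibre[OF J, of m j]] by (elim exE) (rule that)
  then have "(\<Sum>k\<in>{k. (m, j, k) \<in> J}. (norm (coord a F (m, j, k)))\<^sup>2) \<le> (\<Sum>k<N. (norm (coord a F (m, j, k)))\<^sup>2)"
    by (intro sum_mono2) simp_all
  with le[of N] show ?thesis by linarith
qed

lemma norm_bound:
  assumes C: "0 < C" "\<And>n. gain n \<le> C" and G: "G \<in> H a"
    and FG: "\<And>m j. component F G m j" "\<And>m j. boundary F m j"
  shows "F \<in> H a" "hnorm a F \<le> sqrt C * hnorm a G"
proof -
  have J: "(\<Sum>i\<in>J. (norm (coord a F i))\<^sup>2) \<le> C * (hnorm a G)\<^sup>2" if "finite J" for J
  proof (rule bound_by_blocks[OF G _ that])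
    fix m j
    have "gain (rad j) * block_energy G m j \<le> C * block_energy G m j"
      by (rule mult_right_mono[OF C(2) block_energy_nonneg[OF G]])
    then show "(\<Sum>k\<in>{k. (m, j, k) \<in> J}. (norm (coord a F (m, j, k)))\<^sup>2) \<le> C * block_energy G m j"
      using component_bound[OF FG G] by (intro sum_fibre_le[OF that]) (meson order_trans)
  qed (use C in simp)
  show "F \<in> H a"
    by (rule H_of_coord_bound(1)[OF J])
  have "(hnorm a F)\<^sup>2 \<le> C * (hnorm a G)\<^sup>2"
    by (rule H_of_coord_bound(2)[OF J])
  also have "\<dots> = (sqrt C * hnorm a G)\<^sup>2"
    using C(1) by (simp add: power_mult_distrib)
  finally show "hnorm a F \<le> sqrt C * hnorm a G"
    by (rule power2_le_imp_le) (use C(1) hnorm_nonneg in simp)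
qed

lemma solution_exists:
  assumes G: "G \<in> H a"
  shows "\<exists>F. solution F G"
proof -
  define P where "P m j x y \<longleftrightarrow>
      solves m (rad j) x y (\<lambda>k. of_real (sg m) * side j * xpart G m j k) (\<lambda>k. side j * ypart G m j k)
      \<and> (\<lambda>k. y k - of_real (kap m (rad j) k) * x k) \<longlonglongrightarrow> 0" for m j x y
  have "\<exists>x y. P m j x y" for m j
    unfolding P_def by (rule radial_problem.solution_exists[OF radial source_energy[OF G]])
  then have "\<forall>b. \<exists>v. P (fst b) (snd b) (fst v) (snd v)"
    by simp
  from choice[OF this] obtain v where v: "\<And>b. P (fst b) (snd b) (fst (v b)) (snd (v b))"
    by blast
  define X where "X m j = fst (v (m, j))" for m j
  define Y where "Y m j = snd (v (m, j))" for m j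
  have XY: "P m j (X m j) (Y m j)" for m j
    using v[of "(m, j)"] by (simp add: X_def Y_def)
  define F where "F = assemble X (\<lambda>m j k. of_real (sg m) * Y m j k)"
  have s: "complex_of_real (sg m) * (of_real (sg m) * z) = z" for m z
    by (simp add: sg_def)
  have "component F G m j" "boundary F m j" for m j
    using XY[of m j] by (simp_all add: P_def component_def boundary_def F_def s)
  moreover from this have "F \<in> H a"
    using gain_bounded norm_bound(1)[OF _ _ G] by blast
  ultimately have "solution F G"
    using G by (simp add: solution_def)
  then show ?thesis ..
qed

lemma Dirac_zero: "Dirac a c1 c2 0 = 0"
  and Dirac_add: "Dirac a c1 c2 (F + G) = Dirac a c1 c2 F + Dirac a c1 c2 G"
  and Dirac_hscale: "Dirac a c1 c2 (hscale c F) = hscale c (Dirac a c1 c2 F)"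
proof -
  show "Dirac a c1 c2 0 = 0"
    by (rule parts_eqI; intro ext) (simp_all add: Dirac_parts parts_zero B_op_def Bbar_op_def)
  show "Dirac a c1 c2 (F + G) = Dirac a c1 c2 F + Dirac a c1 c2 G"
    by (rule parts_eqI; intro ext) (simp_all add: Dirac_parts parts_add B_op_def Bbar_op_def algebra_simps)
  show "Dirac a c1 c2 (hscale c F) = hscale c (Dirac a c1 c2 F)"
    by (rule parts_eqI; intro ext) (simp_all add: Dirac_parts parts_hscale B_op_def Bbar_op_def algebra_simps)
qed

lemma solution_alt: "solution F G \<longleftrightarrow> F \<in> H a \<and> G \<in> H a \<and> Dirac a c1 c2 F = G \<and> (\<forall>m j. boundary F m j)"
  unfolding solution_def Dirac_eq_iff by blast

lemma solution_zero: "solution 0 0"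
  by (simp add: solution_alt Dirac_zero H_zero boundary_def parts_zero)

lemma solution_add:
  assumes "solution F G" "solution F' G'"
  shows "solution (F + F') (G + G')"
proof -
  have "boundary (F + F') m j" for m j
  proof -
    have "boundary F m j" "boundary F' m j"
      using assms by (simp_all add: solution_alt)
    from tendsto_add[OF this[unfolded boundary_def]] show ?thesis
      unfolding boundary_def parts_add by (simp add: algebra_simps)
  qed
  with assms show ?thesis
    by (simp add: solution_alt Dirac_add H_add)
qed

lemma solution_hscale:
  assumes "solution F G"
  shows "solution (hscale c F) (hscale c G)"
proof -
  have "boundary (hscale c F) m j" for m j
  proof -
    have "boundary F m j"
      using assms by (simp add: solution_alt)
    from tendsto_mult_left[OF this[unfolded boundary_def], of c] show ?thesis
      unfolding boundary_def parts_hscale by (simp add: algebra_simps)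
  qed
  with assms show ?thesis
    by (simp add: solution_alt Dirac_hscale H_hscale)
qed

lemma solution_unique:
  assumes "solution F G" "solution F' G"
  shows "F = F'"
proof -
  have m: "hscale (- 1) F' + F = F - F'" "hscale (- 1) G + G = 0"
    by (simp_all add: hscale_def prod_eq_iff fun_eq_iff)
  have S: "solution (F - F') 0"
    using solution_add[OF solution_hscale[OF assms(2), of "- 1"] assms(1)] unfolding m .
  obtain C where C: "0 < C" "\<And>n. gain n \<le> C"
    using gain_bounded by blast
  have F: "F - F' \<in> H a"
    using S by (simp add: solution_def)
  have "hnorm a (F - F') \<le> sqrt C * hnorm a 0"
    using S by (intro norm_bound(2)[OF C H_zero]) (auto simp: solution_def)
  moreover have "hnorm a 0 = 0"
    by (simp add: hnorm_def norm0_def case_prod_unfold)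
  ultimately have "hdist a F F' = 0"
    using hnorm_nonneg[of "F - F'"] by (simp add: hdist_def)
  then show ?thesis
    using assms H.zero[of F F'] by (simp add: solution_def)
qed

section \<open>Bounded inverse and compactness\<close>

lemma Dirac_invertible: "invertible_operator a (dom_Dirac a c1 c2 K) (Dirac a c1 c2)"
  unfolding invertible_operator_def
proof (intro conjI)
  let ?S = "dom_Dirac a c1 c2 K" and ?D = "Dirac a c1 c2"
  have sol: "solution F (?D F)" if "F \<in> ?S" for F
    using that by (simp add: solution_iff)
  show "?S \<subseteq> H a"
    by (auto simp: dom_Dirac_iff)
  show "linear_operator ?S ?D"
    unfolding linear_operator_def
  proof (intro conjI ballI allI)
    show "0 \<in> ?S" using solution_zero by (simp add: solution_iff)
  next
    fix F G assume "F \<in> ?S" "G \<in> ?S"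
    then have "solution (F + G) (?D F + ?D G)"
      by (intro solution_add sol)
    then show "F + G \<in> ?S" "?D (F + G) = ?D F + ?D G"
      by (simp_all add: solution_iff)
  next
    fix z F assume "F \<in> ?S"
    then have "solution (hscale z F) (hscale z (?D F))"
      by (intro solution_hscale sol)
    then show "hscale z F \<in> ?S" "?D (hscale z F) = hscale z (?D F)"
      by (simp_all add: solution_iff)
  qed
  show "bij_betw ?D ?S (H a)"
  proof (rule bij_betw_imageI)
    show "inj_on ?D ?S"
      by (rule inj_onI) (metis sol solution_unique)
    show "?D ` ?S = H a"
    proof
      show "?D ` ?S \<subseteq> H a" by (auto simp: dom_Dirac_iff)
      show "H a \<subseteq> ?D ` ?S"
      proof
        fix G assume "G \<in> H a"
        then obtain F where "solution F G" using solution_exists by blast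
        then show "G \<in> ?D ` ?S" unfolding solution_iff by blast
      qed
    qed
  qed
  obtain C where C: "0 < C" "\<And>n. gain n \<le> C"
    using gain_bounded by blast
  have "hnorm a F \<le> sqrt C * hnorm a (?D F)" if "F \<in> ?S" for F
    using sol[OF that] by (intro norm_bound(2)[OF C]) (auto simp: solution_def)
  then show "\<exists>C. \<forall>F\<in>?S. hnorm a F \<le> C * hnorm a (?D F)"
    by blast
qed

text \<open>
  Outside finitely many components the inverse is small in norm, and inside these the solutions are
  majorized by a fixed summable profile.
\<close>

lemma uniform_tails:
  assumes \<epsilon>: "0 < \<epsilon>"
  shows "\<exists>I. finite I \<and> (\<forall>F G J. solution F G \<longrightarrow> hnorm a G \<le> M \<longrightarrow> finite J \<longrightarrow> J \<inter> I = {} \<longrightarrow>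
     (\<Sum>i\<in>J. (norm (coord a F i))\<^sup>2) \<le> \<epsilon>)"
proof -
  (* Each component of the solution will have a tail of at most \<delta> times the energy of its source. *)
  define \<delta> where "\<delta> = \<epsilon> / (M\<^sup>2 + 1)"
  have M1: "0 < M\<^sup>2 + 1" by (simp add: add_nonneg_pos)
  have \<delta>: "0 < \<delta>" using \<epsilon> M1 by (simp add: \<delta>_def)
  obtain B where B: "finite B" and small: "\<And>m j F G N. (m, j) \<notin> B \<Longrightarrow> component F G m j \<Longrightarrow> boundary F m j \<Longrightarrow> G \<in> H a \<Longrightarrow>
     (\<Sum>k<N. (norm (coord a F (m, j, k)))\<^sup>2) \<le> \<delta> * block_energy G m j"
    using small_components[OF \<delta>] by blast
  have "\<exists>N. \<forall>k\<ge>N. \<forall>n. (\<Sum>i\<in>{k..<n}. profile m (rad j) i) \<le> \<delta>" for m j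
  proof -
    obtain N where "\<forall>k\<ge>N. \<forall>n. norm (\<Sum>i\<in>{k..<n}. profile m (rad j) i) < \<delta>"
      using radial_problem.profile_summable[OF radial, of "rad j" m] \<delta> unfolding summable_Cauchy by blast
    then show ?thesis
      by (intro exI[of _ N]) (auto simp: abs_less_iff less_imp_le)
  qed
  then have ex: "\<exists>N. \<forall>n. (\<Sum>i\<in>{N..<n}. profile m (rad j) i) \<le> \<delta>" for m j
    by blast
  define N where "N m j = (SOME N. \<forall>n. (\<Sum>i\<in>{N..<n}. profile m (rad j) i) \<le> \<delta>)" for m j
  have N: "(\<Sum>i\<in>{N m j..<n}. profile m (rad j) i) \<le> \<delta>" for m j n
    using someI_ex[OF ex, folded N_def] by (rule spec)
  define I where "I = (\<Union>(m, j)\<in>B. (\<lambda>k. (m, j, k)) ` {..<N m j})"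
  have I: "finite I"
    using B by (auto simp: I_def)
  have "(\<Sum>i\<in>J. (norm (coord a F i))\<^sup>2) \<le> \<epsilon>"
    if S: "solution F G" and GM: "hnorm a G \<le> M" and J: "finite J" "J \<inter> I = {}" for F G J
  proof -
    have c: "component F G m j" "boundary F m j" and G: "G \<in> H a" for m j
      using S by (auto simp: solution_def)
    have "(\<Sum>k\<in>{k. (m, j, k) \<in> J}. (norm (coord a F (m, j, k)))\<^sup>2) \<le> \<delta> * block_energy G m j" for m j
    proof (cases "(m, j) \<in> B")
      case False
      then show ?thesis
        by (intro sum_fibre_le[OF J(1)] small c G)
    next
      case True
      obtain n where n: "{k. (m, j, k) \<in> J} \<subseteq> {..<n}"
        using iffD1[OF finite_nat_iff_bounded finite_fibre[OF J(1), of m j]] by (elim exE) (rule that)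
      have "k \<ge> N m j" if "(m, j, k) \<in> J" for k
      proof (rule ccontr)
        assume "\<not> k \<ge> N m j"
        then have "(m, j, k) \<in> I"
          using True by (force simp: I_def)
        with J(2) that show False by blast
      qed
      with n have sub: "{k. (m, j, k) \<in> J} \<subseteq> {N m j..<n}"
        by auto
      have "(\<Sum>k\<in>{k. (m, j, k) \<in> J}. (norm (coord a F (m, j, k)))\<^sup>2)
          \<le> (\<Sum>k\<in>{N m j..<n}. (norm (coord a F (m, j, k)))\<^sup>2)"
        by (rule sum_mono2[OF _ sub]) simp_all
      also have "\<dots> \<le> (\<Sum>k\<in>{N m j..<n}. profile m (rad j) k * block_energy G m j)"
        by (intro sum_mono pointwise_bound c G)
      also have "\<dots> = (\<Sum>k\<in>{N m j..<n}. profile m (rad j) k) * block_energy G m j"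
        by (rule sum_distrib_right[symmetric])
      also have "\<dots> \<le> \<delta> * block_energy G m j"
        by (rule mult_right_mono[OF N block_energy_nonneg[OF G]])
      finally show ?thesis .
    qed
    then have "(\<Sum>i\<in>J. (norm (coord a F i))\<^sup>2) \<le> \<delta> * (hnorm a G)\<^sup>2"
      using \<delta> by (intro bound_by_blocks[OF G _ J(1)]) simp_all
    also have "\<dots> \<le> \<delta> * (M\<^sup>2 + 1)"
      using \<delta> power_mono[OF GM hnorm_nonneg, of 2] by (intro mult_left_mono) linarith+
    also have "\<dots> = \<epsilon>"
      using M1 by (simp add: \<delta>_def)
    finally show ?thesis .
  qed
  with I show ?thesis by blast
qed

lemma inverse_compact: "compact_operator a (inv_into (dom_Dirac a c1 c2 K) (Dirac a c1 c2))"
proof -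
  let ?S = "dom_Dirac a c1 c2 K" and ?D = "Dirac a c1 c2"
  define Q where "Q = inv_into ?S ?D"
  have bij: "bij_betw ?D ?S (H a)"
    using Dirac_invertible by (simp add: invertible_operator_def)
  have Q: "solution (Q G) G" if "G \<in> H a" for G
    unfolding solution_iff Q_def
    using that bij bij_betw_inv_into_right[OF bij that] inv_into_into[of G ?D ?S] by (auto simp: bij_betw_def)
  have Q_eq: "Q G = F" if "solution F G" for F G
    using solution_unique[OF Q that] that by (simp add: solution_def)
  have lin: "linear_operator (H a) Q"
    unfolding linear_operator_def
    by (intro conjI ballI allI H_zero H_add H_hscale Q_eq solution_add solution_hscale Q)
  have maps: "Q ` H a \<subseteq> H a"
    using Q by (auto simp: solution_def)
  have "compactin H.mtopology (H.mtopology closure_of (Q ` S))" if bdd: "H.mbounded S" for S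
  proof -
    obtain x M0 where M0: "S \<subseteq> H.mcball x M0"
      using bdd unfolding H.mbounded_def by blast
    have SH: "S \<subseteq> H a"
      using M0 by (auto simp: H.mcball_def)
    define M where "M = M0 + hnorm a x"
    have SM: "hnorm a G \<le> M" if "G \<in> S" for G
    proof -
      have x: "x \<in> H a" and G: "G \<in> H a" and d: "hdist a x G \<le> M0"
        using M0 that by (auto simp: H.mcball_def)
      have "hdist a G 0 \<le> hdist a G x + hdist a x 0"
        by (rule H.triangle[OF G x H_zero])
      then show ?thesis
        using d H.commute[of x G] by (simp add: hdist_def M_def)
    qed
    obtain C where C: "0 < C" "\<And>n. gain n \<le> C"
      using gain_bounded by blast
    show ?thesis
    proof (rule relatively_compact_of_uniform_tails)
      show "Q ` S \<subseteq> H a"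
        using maps SH by blast
      fix F assume "F \<in> Q ` S"
      then obtain G where G: "G \<in> S" "F = Q G" by blast
      have "solution F G"
        using Q SH G by blast
      then have "hnorm a F \<le> sqrt C * hnorm a G"
        by (intro norm_bound(2)[OF C]) (auto simp: solution_def)
      also have "\<dots> \<le> sqrt C * M"
        using C(1) SM[OF G(1)] by (intro mult_left_mono) simp_all
      finally show "hnorm a F \<le> sqrt C * M" .
    next
      fix \<epsilon> :: real assume "0 < \<epsilon>"
      then obtain I where I: "finite I" and tail: "\<And>F G J. solution F G \<Longrightarrow> hnorm a G \<le> M \<Longrightarrow> finite J \<Longrightarrow> J \<inter> I = {} \<Longrightarrow>
          (\<Sum>i\<in>J. (norm (coord a F i))\<^sup>2) \<le> \<epsilon>"
        using uniform_tails[OF \<open>0 < \<epsilon>\<close>, of M] by blast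
      have "(\<Sum>i\<in>J. (norm (coord a F i))\<^sup>2) \<le> \<epsilon>" if F: "F \<in> Q ` S" and J: "finite J" "J \<inter> I = {}" for F J
      proof -
        obtain G where G: "G \<in> S" "F = Q G" using F by blast
        have "solution F G"
          using Q SH G by blast
        then show ?thesis
          by (rule tail[OF _ SM[OF G(1)] J])
      qed
      with I show "\<exists>I. finite I \<and> (\<forall>F\<in>Q ` S. \<forall>J. finite J \<longrightarrow> J \<inter> I = {} \<longrightarrow> (\<Sum>i\<in>J. (norm (coord a F i))\<^sup>2) \<le> \<epsilon>)"
        by blast
    qed
  qed
  with lin maps show ?thesis
    unfolding compact_operator_def Q_def by blast
qed

end

theorem theorem6p3:
  fixes a c1 c2 :: "nat \<Rightarrow> nat \<Rightarrow> real" and \<kappa> :: real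
    and K :: "int \<Rightarrow> nat \<Rightarrow> nat \<Rightarrow> real^2"
  assumes "\<And>n k. a n k > 0"
    and "\<And>n. summable (\<lambda>k. 1 / a n k)"
    and "(\<lambda>n. \<Sum>k. 1 / a n k) \<longlonglongrightarrow> 0"
    and "\<And>n k. 0 < c1 n k \<and> c1 n k \<le> 1"
    and "\<And>n k. 0 < c2 n k \<and> c2 n k \<le> 1"
    and "\<And>n. convergent_prod (c1 n)"
    and "\<And>n. convergent_prod (c2 n)"
    and "\<kappa> > 0"
    and "\<And>n k. 1 / \<kappa> \<le> c1 n k"
    and "\<And>n k. 1 / \<kappa> \<le> c2 n k"
    and "quantum_K_function a c1 c2 K"
  shows "invertible_operator a (dom_Dirac a c1 c2 K) (Dirac a c1 c2) \<and>
         compact_operator a (inv_into (dom_Dirac a c1 c2 K) (Dirac a c1 c2))"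
proof -
  obtain R where R: "0 \<le> R" "\<And>m n. m \<noteq> 0 \<Longrightarrow> \<bar>K_infty K m n $ 1 / K_infty K m n $ 2\<bar> \<le> R"
    using quantum_K_quotients_bounded[OF assms(11)] by blast
  interpret dirac_problem a c1 c2 K R
    by unfold_locales (fact assms R)+
  show ?thesis
    using Dirac_invertible inverse_compact by blast
qed

end
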